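(* Let $G$ be a countable infinite group with $H^1(G,\ell^2(G)) = \{0\}$. Let $(\mu_g)_{g \in G}$ be a family of probability measures on a standard Borel space $X_0$, and let $(X,\mu) = \prod_{g \in G} (X_0,\mu_g)$, where $\mu$ is assumed to be nonatomic. If the Bernoulli action $G \curvearrowright (X,\mu)$ is nonsingular, then there exists a partition $X_0 = Y_0 \sqcup Z_0$ into Borel sets such that, writing $Y = Y_0^G \subset X$, we have: 1. $\mu(Y) > 0$ and $\mu|_Y \sim \nu^G$ for some probability measure $\nu$ on $Y_0$ (so that $G \curvearrowright (Y,\mu)$ is, up to replacing $\mu|_Y$ by the equivalent measure $\nu^G$, an ergodic pmp Bernoulli action); 2. $\sum_{g \in G} \mu_g(Z_0) < \infty$, and the action $G \curvearrowright (X \setminus Y,\mu)$ is dissipative.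
   Context: The Bernoulli action $G \curvearrowright X = X_0^G$ is $(g \cdot x)_h = x_{g^{-1}h}$ for $g,h \in G$, $x \in X$. An action $G \curvearrowright (X,\mu)$ is nonsingular if it preserves the measure class of $\mu$; "pmp" means probability measure preserving. The symbol $\sim$ denotes equivalence of measures (same null sets). $H^1(G,\ell^2(G))$ is the first cohomology of $G$ with coefficients in the left regular representation: 1-cocycles are maps $c : G \to \ell^2(G)$ with $c_{gh} = c_g + g\cdot c_h$, inner 1-cocycles are those of the form $c_g = \xi - g \cdot \xi$ with $\xi \in \ell^2(G)$, and $H^1$ is the quotient of the space of 1-cocycles by the space of inner ones. A nonsingular action $G \curvearrowright (X,\mu)$ is dissipative if there exists a Borel set $\mathcal{U} \subset X$ such that all $g \cdot \mathcal{U}$, $g \in G$, are disjoint and $\bigcup_{g \in G} g \cdot \mathcal{U} = X$ up to measure zero. *)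

theory Defs
  imports "HOL-Probability.Probability" "HOL-Algebra.Group_Action"
begin

section \<open>First cohomology with coefficients in the left regular representation\<close>

text \<open>Elements of $\ell^2(G)$ are total functions that vanish off \<^term>\<open>carrier G\<close>.\<close>

definition l2_space :: "('g, 'b) monoid_scheme \<Rightarrow> ('g \<Rightarrow> complex) set" where
  "l2_space G = {\<xi>. (\<forall>k. k \<notin> carrier G \<longrightarrow> \<xi> k = 0) \<and>
                    (\<lambda>k. (cmod (\<xi> k))\<^sup>2) summable_on carrier G}"

definition left_regular :: "('g, 'b) monoid_scheme \<Rightarrow> 'g \<Rightarrow> ('g \<Rightarrow> complex) \<Rightarrow> 'g \<Rightarrow> complex" where
  "left_regular G g \<xi> = (\<lambda>k. if k \<in> carrier G then \<xi> (inv\<^bsub>G\<^esub> g \<otimes>\<^bsub>G\<^esub> k) else 0)"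

definition l2_cocycles :: "('g, 'b) monoid_scheme \<Rightarrow> ('g \<Rightarrow> 'g \<Rightarrow> complex) set" where
  "l2_cocycles G = {c \<in> carrier G \<rightarrow>\<^sub>E l2_space G.
     \<forall>g\<in>carrier G. \<forall>h\<in>carrier G. c (g \<otimes>\<^bsub>G\<^esub> h) = (\<lambda>k. c g k + left_regular G g (c h) k)}"

definition l2_inner_cocycles :: "('g, 'b) monoid_scheme \<Rightarrow> ('g \<Rightarrow> 'g \<Rightarrow> complex) set" where
  "l2_inner_cocycles G =
     (\<lambda>\<xi>. \<lambda>g\<in>carrier G. \<lambda>k. \<xi> k - left_regular G g \<xi> k) ` l2_space G"

text \<open>The additive group of 1-cocycles, written as a (multiplicative) \<^typ>\<open>'a monoid\<close> record so that
  the quotient by the inner cocycles is a factor group.\<close>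

definition l2_cocycle_group :: "('g, 'b) monoid_scheme \<Rightarrow> ('g \<Rightarrow> 'g \<Rightarrow> complex) monoid" where
  "l2_cocycle_group G = \<lparr>carrier = l2_cocycles G,
     mult = (\<lambda>c d. \<lambda>g\<in>carrier G. \<lambda>k. c g k + d g k),
     one = (\<lambda>g\<in>carrier G. \<lambda>k. 0)\<rparr>"

definition l2_H1 :: "('g, 'b) monoid_scheme \<Rightarrow> ('g \<Rightarrow> 'g \<Rightarrow> complex) set monoid" where
  "l2_H1 G = l2_cocycle_group G Mod l2_inner_cocycles G"


section \<open>Measures\<close>

definition standard_borel :: "'a measure \<Rightarrow> bool" where
  "standard_borel M \<longleftrightarrow> (\<exists>T. completely_metrizable_space T \<and> second_countable T \<and>
     space M = topspace T \<and> sets M = sigma_sets (topspace T) {U. openin T U})"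

definition nonatomic :: "'a measure \<Rightarrow> bool" where
  "nonatomic M \<longleftrightarrow> (\<forall>A\<in>sets M. emeasure M A > 0 \<longrightarrow>
     (\<exists>B\<in>sets M. B \<subseteq> A \<and> 0 < emeasure M B \<and> emeasure M B < emeasure M A))"

definition measure_equiv :: "'a measure \<Rightarrow> 'a measure \<Rightarrow> bool" where
  "measure_equiv M N \<longleftrightarrow> sets M = sets N \<and> null_sets M = null_sets N"


section \<open>Group actions on measure spaces\<close>

text \<open>The library's \<^locale>\<open>group_action\<close> wants permutations that are extensional on the space
  acted upon, hence the \<^const>\<open>restrict\<close>; thus the same map \<open>a\<close> can also be used on an
  invariant subset.\<close>

definition measurable_action ::
    "('g, 'b) monoid_scheme \<Rightarrow> 'x measure \<Rightarrow> ('g \<Rightarrow> 'x \<Rightarrow> 'x) \<Rightarrow> bool" where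
  "measurable_action G M a \<longleftrightarrow>
     group_action G (space M) (\<lambda>g. restrict (a g) (space M)) \<and>
     (\<forall>g\<in>carrier G. a g \<in> M \<rightarrow>\<^sub>M M)"

definition nonsingular_action ::
    "('g, 'b) monoid_scheme \<Rightarrow> 'x measure \<Rightarrow> ('g \<Rightarrow> 'x \<Rightarrow> 'x) \<Rightarrow> bool" where
  "nonsingular_action G M a \<longleftrightarrow> measurable_action G M a \<and>
     (\<forall>g\<in>carrier G. measure_equiv (distr M M (a g)) M)"

definition pmp_action ::
    "('g, 'b) monoid_scheme \<Rightarrow> 'x measure \<Rightarrow> ('g \<Rightarrow> 'x \<Rightarrow> 'x) \<Rightarrow> bool" where
  "pmp_action G M a \<longleftrightarrow> measurable_action G M a \<and> prob_space M \<and>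
     (\<forall>g\<in>carrier G. distr M M (a g) = M)"

definition ergodic_action ::
    "('g, 'b) monoid_scheme \<Rightarrow> 'x measure \<Rightarrow> ('g \<Rightarrow> 'x \<Rightarrow> 'x) \<Rightarrow> bool" where
  "ergodic_action G M a \<longleftrightarrow> nonsingular_action G M a \<and>
     (\<forall>A\<in>sets M. (\<forall>g\<in>carrier G. a g ` A = A) \<longrightarrow>
        A \<in> null_sets M \<or> space M - A \<in> null_sets M)"

definition dissipative_action ::
    "('g, 'b) monoid_scheme \<Rightarrow> 'x measure \<Rightarrow> ('g \<Rightarrow> 'x \<Rightarrow> 'x) \<Rightarrow> bool" where
  "dissipative_action G M a \<longleftrightarrow> nonsingular_action G M a \<and>
     (\<exists>U\<in>sets M. disjoint_family_on (\<lambda>g. a g ` U) (carrier G) \<and>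
        space M - (\<Union>g\<in>carrier G. a g ` U) \<in> null_sets M)"

definition bernoulli :: "('g, 'b) monoid_scheme \<Rightarrow> 'g \<Rightarrow> ('g \<Rightarrow> 'a) \<Rightarrow> 'g \<Rightarrow> 'a" where
  "bernoulli G g x = (\<lambda>h\<in>carrier G. x (inv\<^bsub>G\<^esub> g \<otimes>\<^bsub>G\<^esub> h))"

end

theory Submission
  imports Defs
begin

text \<open>
  Compare all the marginals with one of them, \<open>L = \<mu> \<one>\<close>, and write \<open>f h\<close> for the square root of
  the density of \<open>\<mu> h\<close>, a unit vector of \<open>L\<^sup>2(L)\<close>. Translation by \<open>g\<close> turns the product of the
  \<open>\<mu> h\<close> into the product of the \<open>\<mu> (g\<^sup>-\<^sup>1 h)\<close>, so Kakutani's criterion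
  (\<open>kakutani_summable\<close>) reads nonsingularity as
  \<open>\<Sum>h. \<parallel>f h - f (g\<^sup>-\<^sup>1 h)\<parallel>\<^sup>2 < \<infinity>\<close> for every \<open>g\<close>: the family \<open>f\<close> is the potential of a 1-cocycle with
  values in \<open>\<ell>\<^sup>2(G) \<otimes> L\<^sup>2(L)\<close>. Vanishing of the cohomology of \<open>\<ell>\<^sup>2(G)\<close> says, for
  scalar potentials: a function on \<open>G\<close> whose translation differences are all square summable
  differs from a constant by an element of \<open>\<ell>\<^sup>2(G)\<close>.

  Applied to \<open>h \<mapsto> f h x\<close> for almost every \<open>x\<close>, this yields a pointwise limit \<open>F\<close>. That
  \<open>\<Sum>h. \<parallel>f h - F\<parallel>\<^sup>2\<close> is finite (\<open>L2_limit_if_H1_trivial\<close>) comes from a second application, to the norms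
  \<open>h \<mapsto> \<parallel>f h - F\<parallel>\<close> taken both in \<open>L\<close> and in \<open>L\<close> with an unbounded weight: the norms converge in
  both cases, and as the weight is arbitrarily large wherever mass could escape, finiteness of the
  weighted limit leaves only \<open>0\<close> as the unweighted one.

  Now \<open>\<nu>\<close> has density \<open>F\<^sup>2\<close>, the set \<open>Y0\<close> is \<open>{F \<noteq> 0}\<close>, and \<open>Z0\<close> is its complement, whose measures
  \<open>\<mu> h Z0 \<le> \<parallel>f h - F\<parallel>\<^sup>2\<close> are summable. By Kakutani's criterion
  (\<open>kakutani_absolutely_continuous\<close>), \<open>\<nu>\<^sup>G\<close> is absolutely continuous with respect to the given
  product, hence \<open>Y\<close> has positive measure; used once more for the marginals conditioned on
  \<open>Y0\<close>, it gives the converse on \<open>Y\<close>. A Bernoulli action with one base measure is ergodic because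
  far translates of a rectangle are independent (\<open>ergodic_action_bernoulli\<close>).

  Off \<open>Y\<close>, Borel--Cantelli makes the set of coordinates in \<open>Z0\<close> finite and nonempty, and \<open>G\<close> moves
  such sets properly. A fundamental domain is obtained by choosing in each orbit the minimum of a
  real function which is proper and injective (\<open>dissipative_action_if_free_proper\<close>); this needs
  trivial stabilizers, and they are trivial almost everywhere because \<open>\<nu>\<close> is not a point mass,
  which is where nonatomicity enters.
\<close>

section \<open>Potentials with square-summable differences\<close>

abbreviation sqnorm :: "'x measure \<Rightarrow> ('x \<Rightarrow> real) \<Rightarrow> ennreal" where
  "sqnorm N u \<equiv> \<integral>\<^sup>+x. ennreal ((u x)\<^sup>2) \<partial>N"

text \<open>Sums over \<open>G\<close> are written as integrals for the counting measure, so that interchanging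
  them with integrals over the base space is Tonelli's theorem.\<close>

lemma summable_on_iff_nn_integral:
  fixes f :: "'i \<Rightarrow> real"
  assumes "\<And>x. x \<in> A \<Longrightarrow> 0 \<le> f x"
  shows "f summable_on A \<longleftrightarrow> (\<integral>\<^sup>+x. ennreal (f x) \<partial>count_space A) < \<infinity>"
proof -
  have "f summable_on A \<longleftrightarrow> (\<lambda>x. norm (f x)) summable_on A"
    using assms by (intro summable_on_cong) auto
  also have "\<dots> \<longleftrightarrow> Infinite_Set_Sum.abs_summable_on f A"
    by (rule abs_summable_equivalent)
  also have "\<dots> \<longleftrightarrow> (\<integral>\<^sup>+x. ennreal (norm (f x)) \<partial>count_space A) < \<infinity>"
    unfolding Infinite_Set_Sum.abs_summable_on_def integrable_iff_bounded by simp
  also have "(\<integral>\<^sup>+x. ennreal (norm (f x)) \<partial>count_space A) = (\<integral>\<^sup>+x. ennreal (f x) \<partial>count_space A)"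
    using assms by (intro nn_integral_cong) auto
  finally show ?thesis .
qed

text \<open>The coset of \<open>c\<close> contains \<open>c\<close>, and the only coset is that of the inner cocycles.\<close>

lemma cocycle_inner_if_H1_trivial:
  assumes "group G" and "carrier (l2_H1 G) = {\<one>\<^bsub>l2_H1 G\<^esub>}" and c: "c \<in> l2_cocycles G"
  shows "\<exists>\<xi>\<in>l2_space G. \<forall>g\<in>carrier G. \<forall>k. c g k = \<xi> k - left_regular G g \<xi> k"
proof -
  let ?Z = "l2_cocycle_group G" and ?B = "l2_inner_cocycles G"
  have "?B #>\<^bsub>?Z\<^esub> c \<in> carrier (l2_H1 G)"
    using c by (auto simp: l2_H1_def FactGroup_def RCOSETS_def l2_cocycle_group_def)
  then have coset: "?B #>\<^bsub>?Z\<^esub> c = ?B"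
    using assms(2) by (simp add: l2_H1_def FactGroup_def)
  have c_ext: "c \<in> extensional (carrier G)"
    using c by (auto simp: l2_cocycles_def PiE_iff)
  have z: "(\<lambda>g\<in>carrier G. \<lambda>k. 0) \<in> ?B"
    unfolding l2_inner_cocycles_def
    by (rule image_eqI[of _ _ "\<lambda>_. 0"]) (auto simp: l2_space_def left_regular_def fun_eq_iff)
  have "(\<lambda>g\<in>carrier G. \<lambda>k. 0) \<otimes>\<^bsub>?Z\<^esub> c = c"
    using c_ext by (auto simp: l2_cocycle_group_def fun_eq_iff extensional_def restrict_def)
  with z have "c \<in> ?B #>\<^bsub>?Z\<^esub> c"
    unfolding r_coset_def by (metis (no_types, lifting) UN_iff singletonI)
  then have "c \<in> ?B" using coset by simp
  then show ?thesis
    by (auto simp: l2_inner_cocycles_def)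
qed

text \<open>The differences of \<open>b\<close> form a cocycle; if it is inner, given by \<open>\<xi>\<close>, then \<open>b - \<xi>\<close> is
  invariant under translation and hence constant.\<close>

lemma l2_potential_const_if_H1_trivial:
  fixes G (structure) and b :: "'g \<Rightarrow> real"
  assumes G: "group G" and H1: "carrier (l2_H1 G) = {\<one>\<^bsub>l2_H1 G\<^esub>}"
    and b: "\<And>g. g \<in> carrier G \<Longrightarrow>
      sqnorm (count_space (carrier G)) (\<lambda>h. b h - b (inv g \<otimes> h)) < \<infinity>"
  shows "\<exists>a. sqnorm (count_space (carrier G)) (\<lambda>h. b h - a) < \<infinity>"
proof -
  interpret group G by fact
  let ?c = "\<lambda>g\<in>carrier G. \<lambda>k. if k \<in> carrier G then complex_of_real (b k - b (inv g \<otimes> k)) else 0"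
  have summ: "(\<lambda>h. (b h - b (inv g \<otimes> h))\<^sup>2) summable_on carrier G" if "g \<in> carrier G" for g
    using b[OF that] by (subst summable_on_iff_nn_integral) auto
  have "?c \<in> l2_cocycles G"
    unfolding l2_cocycles_def
  proof (intro CollectI conjI ballI PiE_I)
    fix g assume g: "g \<in> carrier G"
    have "(\<lambda>k. (cmod (?c g k))\<^sup>2) summable_on carrier G \<longleftrightarrow>
        (\<lambda>h. (b h - b (inv g \<otimes> h))\<^sup>2) summable_on carrier G"
      using g by (intro summable_on_cong) (simp del: of_real_diff)
    then show "?c g \<in> l2_space G"
      using summ[OF g] g by (auto simp: l2_space_def)
  next
    fix g h assume "g \<in> carrier G" "h \<in> carrier G"
    then show "?c (g \<otimes> h) = (\<lambda>k. ?c g k + left_regular G g (?c h) k)"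
      by (auto simp: fun_eq_iff left_regular_def inv_mult_group m_assoc)
  qed auto
  from cocycle_inner_if_H1_trivial[OF G H1 this] obtain \<xi> where \<xi>: "\<xi> \<in> l2_space G"
    and eq: "\<And>g k. g \<in> carrier G \<Longrightarrow> ?c g k = \<xi> k - left_regular G g \<xi> k" by blast
  define a where "a = Re (complex_of_real (b \<one>) - \<xi> \<one>)"
  have ab: "(b k - a)\<^sup>2 \<le> (cmod (\<xi> k))\<^sup>2" if k: "k \<in> carrier G" for k
  proof -
    have "complex_of_real (b k - b \<one>) = \<xi> k - \<xi> \<one>"
      using eq[OF k, of k] k by (simp add: left_regular_def l_inv)
    then have "b k - b \<one> = Re (\<xi> k) - Re (\<xi> \<one>)"
      by (metis Re_complex_of_real minus_complex.simps(1))
    then have "b k - a = Re (\<xi> k)" by (simp add: a_def)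
    then show ?thesis
      by (metis abs_Re_le_cmod abs_le_square_iff abs_norm_cancel)
  qed
  have "sqnorm (count_space (carrier G)) (\<lambda>h. b h - a) \<le>
      sqnorm (count_space (carrier G)) (\<lambda>h. cmod (\<xi> h))"
    using ab by (intro nn_integral_mono) (auto intro: ennreal_leI)
  also have "\<dots> < \<infinity>"
    using \<xi> by (subst summable_on_iff_nn_integral[symmetric]) (auto simp: l2_space_def)
  finally show ?thesis by blast
qed

section \<open>Limits in $L^2$ of almost invariant families\<close>

lemma sqnorm_add_le:
  assumes [measurable]: "u \<in> borel_measurable N" "v \<in> borel_measurable N"
  shows "sqnorm N (\<lambda>x. u x + v x) \<le> 2 * sqnorm N u + 2 * sqnorm N v"
proof -
  have "ennreal ((u x + v x)\<^sup>2) \<le> 2 * ennreal ((u x)\<^sup>2) + 2 * ennreal ((v x)\<^sup>2)" for x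
  proof -
    have "(u x + v x)\<^sup>2 \<le> 2 * (u x)\<^sup>2 + 2 * (v x)\<^sup>2"
      using zero_le_power2[of "u x - v x"] by (simp add: power2_eq_square algebra_simps)
    then have "ennreal ((u x + v x)\<^sup>2) \<le> ennreal (2 * (u x)\<^sup>2 + 2 * (v x)\<^sup>2)"
      by (rule ennreal_leI)
    then show ?thesis by (simp add: ennreal_mult)
  qed
  then have "sqnorm N (\<lambda>x. u x + v x) \<le> (\<integral>\<^sup>+x. 2 * ennreal ((u x)\<^sup>2) + 2 * ennreal ((v x)\<^sup>2) \<partial>N)"
    by (rule nn_integral_mono)
  then show ?thesis by (simp add: nn_integral_add nn_integral_cmult)
qed

lemma integrable_mult_if_square_integrable:
  fixes u v :: "'a \<Rightarrow> real"
  assumes [measurable]: "u \<in> borel_measurable L" "v \<in> borel_measurable L"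
    and u: "integrable L (\<lambda>x. (u x)\<^sup>2)" and v: "integrable L (\<lambda>x. (v x)\<^sup>2)"
  shows "integrable L (\<lambda>x. u x * v x)"
proof (rule Bochner_Integration.integrable_bound[OF Bochner_Integration.integrable_add[OF u v]])
  have "\<bar>u x * v x\<bar> \<le> (u x)\<^sup>2 + (v x)\<^sup>2" for x
  proof -
    have "2 * (\<bar>u x\<bar> * \<bar>v x\<bar>) \<le> (u x)\<^sup>2 + (v x)\<^sup>2"
      using zero_le_power2[of "\<bar>u x\<bar> - \<bar>v x\<bar>"] by (simp add: power2_diff)
    moreover have "0 \<le> \<bar>u x\<bar> * \<bar>v x\<bar>" by simp
    ultimately show ?thesis unfolding abs_mult by linarith
  qed
  then show "AE x in L. norm (u x * v x) \<le> norm ((u x)\<^sup>2 + (v x)\<^sup>2)" by simp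
qed measurable

text \<open>The reverse triangle inequality of \<open>L\<^sup>2\<close>, from Cauchy--Schwarz.\<close>

lemma L2_norm_diff_le:
  fixes u v :: "'x \<Rightarrow> real"
  assumes [measurable]: "u \<in> borel_measurable N" "v \<in> borel_measurable N"
    and fu: "sqnorm N u < \<infinity>" and fv: "sqnorm N v < \<infinity>"
  shows "ennreal ((sqrt (enn2real (sqnorm N u)) - sqrt (enn2real (sqnorm N v)))\<^sup>2)
    \<le> sqnorm N (\<lambda>x. u x - v x)"
proof -
  have iu: "integrable N (\<lambda>x. (u x)\<^sup>2)" and iv: "integrable N (\<lambda>x. (v x)\<^sup>2)"
    using fu fv by (auto simp: integrable_iff_bounded)
  have iuv': "integrable N (\<lambda>x. u x * v x)"
    by (rule integrable_mult_if_square_integrable) (use iu iv in auto)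
  have iuv: "integrable N (\<lambda>x. \<bar>u x\<bar> * \<bar>v x\<bar>)"
    using integrable_abs[OF iuv'] by (simp add: abs_mult)
  define A B C where "A = (\<integral>x. (u x)\<^sup>2 \<partial>N)" and "B = (\<integral>x. (v x)\<^sup>2 \<partial>N)"
    and "C = (\<integral>x. \<bar>u x\<bar> * \<bar>v x\<bar> \<partial>N)"
  have A: "sqnorm N u = ennreal A" "0 \<le> A"
    and B: "sqnorm N v = ennreal B" "0 \<le> B"
    and C: "(\<integral>\<^sup>+x. ennreal (\<bar>u x\<bar> * \<bar>v x\<bar>) \<partial>N) = ennreal C" "0 \<le> C"
    unfolding A_def B_def C_def using iu iv iuv by (auto intro!: nn_integral_eq_integral)
  have "(\<integral>\<^sup>+x. ennreal \<bar>u x\<bar> * ennreal \<bar>v x\<bar> \<partial>N)\<^sup>2 \<le>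
      (\<integral>\<^sup>+x. (ennreal \<bar>u x\<bar>)\<^sup>2 \<partial>N) * (\<integral>\<^sup>+x. (ennreal \<bar>v x\<bar>)\<^sup>2 \<partial>N)"
    by (rule Cauchy_Schwarz_nn_integral) auto
  then have "(ennreal C)\<^sup>2 \<le> ennreal A * ennreal B"
    using A B C by (simp add: ennreal_mult[symmetric] ennreal_power)
  then have "C\<^sup>2 \<le> A * B"
    using A B C by (simp add: ennreal_mult[symmetric] ennreal_power)
  then have "C \<le> sqrt A * sqrt B"
    using A B C by (metis real_le_rsqrt real_sqrt_mult)
  moreover have "(\<integral>x. u x * v x \<partial>N) \<le> C"
    unfolding C_def using iuv iuv' by (intro integral_mono) (auto simp: abs_mult[symmetric])
  moreover have "(sqrt A - sqrt B)\<^sup>2 = A + B - 2 * (sqrt A * sqrt B)"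
    using A B by (simp add: power2_diff)
  moreover have "(\<integral>x. (u x - v x)\<^sup>2 \<partial>N) = A + B - 2 * (\<integral>x. u x * v x \<partial>N)"
    unfolding A_def B_def using iu iv iuv' by (simp add: power2_diff mult.assoc)
  ultimately have "(sqrt A - sqrt B)\<^sup>2 \<le> (\<integral>x. (u x - v x)\<^sup>2 \<partial>N)"
    by linarith
  moreover have "sqnorm N (\<lambda>x. u x - v x) = ennreal (\<integral>x. (u x - v x)\<^sup>2 \<partial>N)"
  proof (rule nn_integral_eq_integral)
    show "integrable N (\<lambda>x. (u x - v x)\<^sup>2)"
      using iu iv iuv' by (simp add: power2_diff mult.assoc)
  qed simp
  ultimately show ?thesis
    using A B by (simp add: ennreal_leI)
qed

lemma nn_integral_count_space_enum:
  assumes "bij_betw e (UNIV :: nat set) A"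
  shows "(\<integral>\<^sup>+h. \<phi> h \<partial>count_space A) = (\<Sum>n. \<phi> (e n))"
  by (simp add: nn_integral_bij_count_space[OF assms, symmetric] nn_integral_count_space_nat)

lemma tendsto_zero_if_suminf_ennreal_finite:
  fixes \<phi> :: "nat \<Rightarrow> real"
  assumes "\<And>n. 0 \<le> \<phi> n" and "(\<Sum>n. ennreal (\<phi> n)) < \<infinity>"
  shows "\<phi> \<longlonglongrightarrow> 0"
  using assms by (intro summable_LIMSEQ_zero summable_suminf_not_top) auto

lemma enn2real_tendsto_zero_if_count_space_finite:
  assumes e: "bij_betw e (UNIV :: nat set) A" and fin: "(\<integral>\<^sup>+h. q h \<partial>count_space A) < \<infinity>"
  shows "\<And>h. h \<in> A \<Longrightarrow> q h < \<infinity>" and "(\<lambda>n. enn2real (q (e n))) \<longlonglongrightarrow> 0"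
proof -
  show *: "q h < \<infinity>" if "h \<in> A" for h
    by (rule le_less_trans[OF nn_integral_ge_point[OF that] fin])
  have "e n \<in> A" for n using e by (auto simp: bij_betw_def)
  then have "q (e n) = ennreal (enn2real (q (e n)))" for n using * by simp
  then have "(\<Sum>n. ennreal (enn2real (q (e n)))) < \<infinity>"
    using fin unfolding nn_integral_count_space_enum[OF e] by simp
  then show "(\<lambda>n. enn2real (q (e n))) \<longlonglongrightarrow> 0"
    by (rule tendsto_zero_if_suminf_ennreal_finite[rotated]) simp
qed

lemma tendsto_if_square_diff_tendsto_zero:
  fixes s :: "nat \<Rightarrow> real"
  assumes "(\<lambda>n. (s n - b)\<^sup>2) \<longlonglongrightarrow> 0"
  shows "s \<longlonglongrightarrow> b"
  using tendsto_real_sqrt[OF assms] by (simp add: tendsto_rabs_zero_iff LIM_zero_iff)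

text \<open>By the reverse triangle inequality, norms inherit square-summable differences from the
  vectors, so the scalar statement applies to them. The measure \<open>N\<close> is arbitrary, which allows
  weights.\<close>

lemma L2_norms_converge_if_H1_trivial:
  fixes u :: "'g \<Rightarrow> 'x \<Rightarrow> real" and G :: "('g, 'b) monoid_scheme" (structure)
  assumes G: "group G" and H1: "carrier (l2_H1 G) = {\<one>\<^bsub>l2_H1 G\<^esub>}"
    and meas[measurable]: "\<And>h. h \<in> carrier G \<Longrightarrow> u h \<in> borel_measurable N"
    and one: "sqnorm N (u \<one>) < \<infinity>"
    and diff: "\<And>g. g \<in> carrier G \<Longrightarrow>
      (\<integral>\<^sup>+h. sqnorm N (\<lambda>x. u h x - u (inv g \<otimes> h) x) \<partial>count_space (carrier G)) < \<infinity>"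
  shows "\<forall>h\<in>carrier G. sqnorm N (u h) < \<infinity>"
    and "\<exists>a. sqnorm (count_space (carrier G)) (\<lambda>h. sqrt (enn2real (sqnorm N (u h))) - a) < \<infinity>"
proof -
  interpret group G by fact
  show fin: "\<forall>h\<in>carrier G. sqnorm N (u h) < \<infinity>"
  proof
    fix h assume h[simp]: "h \<in> carrier G"
    have "sqnorm N (\<lambda>x. u h x - u (inv h \<otimes> h) x) < \<infinity>"
      by (rule le_less_trans[OF nn_integral_ge_point[OF h,
        of "\<lambda>k. sqnorm N (\<lambda>x. u k x - u (inv h \<otimes> k) x)"] diff[OF h]])
    then have d: "sqnorm N (\<lambda>x. u h x - u \<one> x) < \<infinity>" by simp
    have "sqnorm N (u h) \<le> 2 * sqnorm N (\<lambda>x. u h x - u \<one> x) + 2 * sqnorm N (u \<one>)"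
      using sqnorm_add_le[of "\<lambda>x. u h x - u \<one> x" N "u \<one>"] by simp
    also have "\<dots> < \<infinity>"
      using d one by (simp add: ennreal_mult_less_top)
    finally show "sqnorm N (u h) < \<infinity>" .
  qed
  define r where "r h = sqrt (enn2real (sqnorm N (u h)))" for h
  have "\<exists>a. sqnorm (count_space (carrier G)) (\<lambda>h. r h - a) < \<infinity>"
  proof (rule l2_potential_const_if_H1_trivial[OF G H1])
    fix g assume g: "g \<in> carrier G"
    have "sqnorm (count_space (carrier G)) (\<lambda>h. r h - r (inv g \<otimes> h)) \<le>
      (\<integral>\<^sup>+h. sqnorm N (\<lambda>x. u h x - u (inv g \<otimes> h) x) \<partial>count_space (carrier G))"
      unfolding r_def using g fin by (intro nn_integral_mono L2_norm_diff_le) auto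
    also have "\<dots> < \<infinity>" by (rule diff[OF g])
    finally show "sqnorm (count_space (carrier G)) (\<lambda>h. r h - r (inv g \<otimes> h)) < \<infinity>" .
  qed
  then show "\<exists>a. sqnorm (count_space (carrier G)) (\<lambda>h. sqrt (enn2real (sqnorm N (u h))) - a) < \<infinity>"
    unfolding r_def .
qed

lemma suminf_half_powers_finite: "(\<Sum>i. ennreal ((1/2) ^ i)) < \<infinity>"
proof -
  have "summable (\<lambda>i. (1/2 :: real) ^ i)" by (rule summable_geometric) simp
  then show ?thesis by (subst suminf_ennreal2) simp_all
qed

text \<open>A de la Vallee Poussin argument: the tails \<open>{S > n}\<close> shrink to a null set, so adding up
  indicators of tails that are chosen sparsely enough keeps countably many integrable
  functions integrable, while the weight tends to infinity along with \<open>S\<close>.\<close>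

lemma exists_unbounded_weight:
  fixes S :: "'x \<Rightarrow> ennreal" and Q :: "nat \<Rightarrow> 'x \<Rightarrow> ennreal"
  assumes [measurable]: "S \<in> borel_measurable L" "\<And>i. Q i \<in> borel_measurable L"
    and S: "AE x in L. S x < \<infinity>" and Q: "\<And>i. (\<integral>\<^sup>+x. Q i x \<partial>L) < \<infinity>"
  shows "\<exists>w\<in>borel_measurable L. (\<forall>i. (\<integral>\<^sup>+x. w x * Q i x \<partial>L) < \<infinity>) \<and>
    (\<forall>k::nat. \<exists>n::nat. \<forall>x. of_nat n < S x \<longrightarrow> of_nat k \<le> w x)"
proof -
  define c where "c i = (1/2) ^ i / (1 + enn2real (\<integral>\<^sup>+x. Q i x \<partial>L))" for i
  have c: "0 < c i" for i
    unfolding c_def by (intro divide_pos_pos add_pos_nonneg) auto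
  define T where "T x = (\<Sum>i. ennreal (c i) * Q i x)" for x
  have [measurable]: "T \<in> borel_measurable L" unfolding T_def by measurable
  have "(\<integral>\<^sup>+x. T x \<partial>L) = (\<Sum>i. ennreal (c i) * (\<integral>\<^sup>+x. Q i x \<partial>L))"
    unfolding T_def by (simp add: nn_integral_suminf nn_integral_cmult)
  also have "\<dots> \<le> (\<Sum>i. ennreal ((1/2) ^ i))"
  proof (intro suminf_le)
    fix i
    define q where "q = enn2real (\<integral>\<^sup>+x. Q i x \<partial>L)"
    have q: "(\<integral>\<^sup>+x. Q i x \<partial>L) = ennreal q" "0 \<le> q"
      using Q[of i] by (auto simp: q_def)
    have "(1/2) ^ i * (q / (1 + q)) \<le> (1/2) ^ i * 1"
      using q by (intro mult_left_mono) auto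
    then have "c i * q \<le> (1/2) ^ i"
      by (simp add: c_def q_def[symmetric])
    then show "ennreal (c i) * (\<integral>\<^sup>+x. Q i x \<partial>L) \<le> ennreal ((1/2) ^ i)"
      using q c[of i] by (simp add: ennreal_mult[symmetric] ennreal_leI)
  qed auto
  also have "\<dots> < \<infinity>"
    by (rule suminf_half_powers_finite)
  finally have T: "(\<integral>\<^sup>+x. T x \<partial>L) < \<infinity>" .
  have "(\<lambda>n. \<integral>\<^sup>+x. indicator {x. of_nat n < S x} x * T x \<partial>L) \<longlonglongrightarrow> (\<integral>\<^sup>+x. 0 \<partial>L)"
  proof (rule nn_integral_dominated_convergence[where w=T])
    show "AE x in L. (\<lambda>n. indicator {x. of_nat n < S x} x * T x) \<longlonglongrightarrow> 0"
      using S
    proof eventually_elim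
      fix x assume "S x < \<infinity>"
      then obtain m :: nat where m: "S x \<le> of_nat m"
        by (metis ennreal_Ex_less_of_nat infinity_ennreal_def less_imp_le)
      have "\<forall>\<^sub>F n in sequentially. indicator {x. of_nat n < S x} x * T x = 0"
        using eventually_ge_at_top[of m]
      proof eventually_elim
        fix n assume "m \<le> n"
        then have "S x \<le> of_nat n" using m by (meson order_trans of_nat_mono)
        then show "indicator {x. of_nat n < S x} x * T x = 0" by (auto simp: indicator_def)
      qed
      then show "(\<lambda>n. indicator {x. of_nat n < S x} x * T x) \<longlonglongrightarrow> 0"
        by (rule tendsto_eventually)
    qed
  qed (use T in \<open>auto simp: indicator_def\<close>)
  then have lim: "(\<lambda>n. \<integral>\<^sup>+x. indicator {x. of_nat n < S x} x * T x \<partial>L) \<longlonglongrightarrow> 0" by simp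
  have "\<exists>n. (\<integral>\<^sup>+x. indicator {x. of_nat n < S x} x * T x \<partial>L) < ennreal ((1/2) ^ k)" for k :: nat
    using order_tendstoD(2)[OF lim, of "ennreal ((1/2) ^ k)"] by (auto simp: eventually_sequentially)
  then obtain M :: "nat \<Rightarrow> nat" where M:
    "\<And>k. (\<integral>\<^sup>+x. indicator {x. of_nat (M k) < S x} x * T x \<partial>L) < ennreal ((1/2) ^ k)"
    by metis
  define w where "w x = (\<Sum>k. indicator {x. of_nat (M k) < S x} x :: ennreal)" for x
  have [measurable]: "w \<in> borel_measurable L" unfolding w_def by measurable
  have "(\<integral>\<^sup>+x. w x * T x \<partial>L) = (\<Sum>k. \<integral>\<^sup>+x. indicator {x. of_nat (M k) < S x} x * T x \<partial>L)"
    unfolding w_def by (subst nn_integral_suminf[symmetric]) (auto simp: ennreal_suminf_multc)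
  also have "\<dots> \<le> (\<Sum>k. ennreal ((1/2) ^ k))"
    using M by (intro suminf_le) (auto intro: less_imp_le)
  also have "\<dots> < \<infinity>"
    by (rule suminf_half_powers_finite)
  finally have wT: "(\<integral>\<^sup>+x. w x * T x \<partial>L) < \<infinity>" .
  have wQ: "(\<integral>\<^sup>+x. w x * Q i x \<partial>L) < \<infinity>" for i
  proof -
    have "ennreal (c i) * (\<integral>\<^sup>+x. w x * Q i x \<partial>L) = (\<integral>\<^sup>+x. w x * (ennreal (c i) * Q i x) \<partial>L)"
      by (subst nn_integral_cmult[symmetric]) (auto simp: ac_simps)
    also have "\<dots> \<le> (\<integral>\<^sup>+x. w x * T x \<partial>L)"
      unfolding T_def
      by (intro nn_integral_mono mult_left_mono)
        (use sum_le_suminf[of "\<lambda>i. ennreal (c i) * Q i x" "{i}" for x] in auto)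
    also note wT
    finally show ?thesis
      using c[of i] by (auto simp: ennreal_mult_less_top)
  qed
  have "\<exists>n::nat. \<forall>x. of_nat n < S x \<longrightarrow> of_nat k \<le> w x" for k :: nat
  proof (intro exI allI impI)
    fix x assume x: "of_nat (\<Sum>j<k. M j) < S x"
    have "of_nat (M j) < S x" if "j < k" for j
    proof -
      have "M j \<le> (\<Sum>j<k. M j)" using that by (intro member_le_sum) auto
      then show ?thesis using x by (meson of_nat_mono le_less_trans)
    qed
    then have "(\<Sum>j<k. indicator {x. of_nat (M j) < S x} x :: ennreal) = of_nat k"
      by simp
    moreover have "(\<Sum>j<k. indicator {x. of_nat (M j) < S x} x :: ennreal) \<le> w x"
      unfolding w_def by (rule sum_le_suminf[OF summableI]) simp_all
    ultimately show "of_nat k \<le> w x" by simp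
  qed
  then show ?thesis
    using wQ by (intro bexI[of _ w] conjI allI) simp_all
qed

text \<open>The limit \<open>F\<close> is found pointwise. To exclude that a fixed amount \<open>a\<^sup>2\<close> of mass of
  \<open>(f h - F)\<^sup>2\<close> escapes to where \<open>S = \<Sum>h. (f h - F)\<^sup>2\<close> is large, integrate against a weight \<open>w\<close>
  that is unbounded in \<open>S\<close>: the weighted norms converge as well, to some \<open>a'\<close>. On
  \<open>{S \<le> m}\<close> no mass survives, since \<open>S\<close> is integrable there, so \<open>k a\<^sup>2 \<le> a'\<^sup>2\<close> for every \<open>k\<close>, and
  \<open>a = 0\<close>.\<close>

lemma L2_limit_if_H1_trivial:
  fixes f :: "'g \<Rightarrow> 'x \<Rightarrow> real" and G :: "('g, 'b) monoid_scheme" (structure)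
  assumes G: "group G" and cG: "countable (carrier G)" and iG: "infinite (carrier G)"
    and H1: "carrier (l2_H1 G) = {\<one>\<^bsub>l2_H1 G\<^esub>}"
    and L: "finite_measure L"
    and meas[measurable]: "\<And>h. h \<in> carrier G \<Longrightarrow> f h \<in> borel_measurable L"
    and unit: "\<And>h. h \<in> carrier G \<Longrightarrow> (sqnorm L (f h)) = 1"
    and diff: "\<And>g. g \<in> carrier G \<Longrightarrow>
      (\<integral>\<^sup>+h. sqnorm L (\<lambda>x. f h x - f (inv g \<otimes> h) x) \<partial>count_space (carrier G)) < \<infinity>"
  shows "\<exists>F\<in>borel_measurable L.
      (\<integral>\<^sup>+h. sqnorm L (\<lambda>x. f h x - F x) \<partial>count_space (carrier G)) < \<infinity>"
proof -
  interpret group G by fact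
  interpret L: finite_measure L by fact
  define e where "e = from_nat_into (carrier G)"
  have e: "bij_betw e UNIV (carrier G)"
    unfolding e_def by (rule bij_betw_from_nat_into[OF cG iG])
  then have eG[simp]: "e n \<in> carrier G" for n by (auto simp: bij_betw_def)
  note enum = nn_integral_count_space_enum[OF e]
  define Q where "Q g x = (\<Sum>n. ennreal ((f (e n) x - f (inv g \<otimes> e n) x)\<^sup>2))" for g x
  have Q_meas[measurable]: "Q g \<in> borel_measurable L" if "g \<in> carrier G" for g
  proof -
    have [simp]: "inv g \<otimes> e n \<in> carrier G" for n using that by simp
    show ?thesis unfolding Q_def by measurable
  qed
  have Q_fin: "(\<integral>\<^sup>+x. Q g x \<partial>L) < \<infinity>" if g: "g \<in> carrier G" for g
    using diff[OF g] g unfolding enum Q_def by (subst nn_integral_suminf) auto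
  have "AE x in L. Q g x < \<infinity>" if "g \<in> carrier G" for g
    using nn_integral_PInf_AE[OF Q_meas[OF that]] Q_fin[OF that] by (auto simp: less_top)
  then have "AE x in L. \<forall>g\<in>carrier G. Q g x < \<infinity>"
    by (simp add: AE_ball_countable[OF cG])
  define F where "F x = lim (\<lambda>n. f (e n) x)" for x
  have F_meas[measurable]: "F \<in> borel_measurable L"
    unfolding F_def by measurable
  define D where "D h x = ennreal ((f h x - F x)\<^sup>2)" for h x
  have D_meas[measurable]: "D h \<in> borel_measurable L" if "h \<in> carrier G" for h
    unfolding D_def using that by measurable
  define S where "S x = (\<Sum>n. D (e n) x)" for x
  have [measurable]: "S \<in> borel_measurable L"
    unfolding S_def by measurable
  have conv: "AE x in L. S x < \<infinity> \<and> (\<lambda>n. f (e n) x) \<longlonglongrightarrow> F x"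
    using \<open>AE x in L. \<forall>g\<in>carrier G. Q g x < \<infinity>\<close>
  proof eventually_elim
    fix x assume x: "\<forall>g\<in>carrier G. Q g x < \<infinity>"
    have "\<exists>a. sqnorm (count_space (carrier G)) (\<lambda>h. f h x - a) < \<infinity>"
      by (rule l2_potential_const_if_H1_trivial[OF G H1]) (use x in \<open>simp add: Q_def enum\<close>)
    then obtain a where a: "(\<Sum>n. ennreal ((f (e n) x - a)\<^sup>2)) < \<infinity>"
      unfolding enum by blast
    then have "(\<lambda>n. (f (e n) x - a)\<^sup>2) \<longlonglongrightarrow> 0"
      by (rule tendsto_zero_if_suminf_ennreal_finite[rotated]) simp
    then have lim: "(\<lambda>n. f (e n) x) \<longlonglongrightarrow> a"
      by (rule tendsto_if_square_diff_tendsto_zero)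
    then have "F x = a" unfolding F_def by (rule limI)
    then show "S x < \<infinity> \<and> (\<lambda>n. f (e n) x) \<longlonglongrightarrow> F x"
      using a lim by (simp add: S_def D_def)
  qed
  have D1: "(\<integral>\<^sup>+x. D \<one> x \<partial>L) < \<infinity>"
  proof -
    \<comment> \<open>Fatou's lemma: the vectors have norm 1, so distances between them are at most 2.\<close>
    have "(\<integral>\<^sup>+x. D \<one> x \<partial>L) \<le> (\<integral>\<^sup>+x. liminf (\<lambda>n. ennreal ((f \<one> x - f (e n) x)\<^sup>2)) \<partial>L)"
    proof (rule nn_integral_mono_AE)
      show "AE x in L. D \<one> x \<le> liminf (\<lambda>n. ennreal ((f \<one> x - f (e n) x)\<^sup>2))"
        using conv
      proof eventually_elim
        fix x assume "S x < \<infinity> \<and> (\<lambda>n. f (e n) x) \<longlonglongrightarrow> F x"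
        then have "(\<lambda>n. ennreal ((f \<one> x - f (e n) x)\<^sup>2)) \<longlonglongrightarrow> D \<one> x"
          unfolding D_def by (intro tendsto_intros tendsto_ennrealI) auto
        then show "D \<one> x \<le> liminf (\<lambda>n. ennreal ((f \<one> x - f (e n) x)\<^sup>2))"
          by (simp add: lim_imp_Liminf)
      qed
    qed
    also have "\<dots> \<le> liminf (\<lambda>n. sqnorm L (\<lambda>x. f \<one> x - f (e n) x))"
      by (intro nn_integral_liminf) measurable
    also have "\<dots> \<le> liminf (\<lambda>n. 4 :: ennreal)"
    proof (intro Liminf_mono always_eventually allI)
      fix n
      show "sqnorm L (\<lambda>x. f \<one> x - f (e n) x) \<le> 4"
        using sqnorm_add_le[of "f \<one>" L "\<lambda>x. - f (e n) x"] by (simp add: unit)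
    qed
    also have "\<dots> < \<infinity>" by (simp add: Liminf_const)
    finally show ?thesis .
  qed
  \<comment> \<open>The weight must keep finite the starting norm and the sum of squares for each \<open>g\<close>.\<close>
  define QQ where "QQ i = (case i of 0 \<Rightarrow> D \<one> | Suc n \<Rightarrow> Q (e n))" for i
  have "QQ i \<in> borel_measurable L" "(\<integral>\<^sup>+x. QQ i x \<partial>L) < \<infinity>" for i
    using D1 Q_fin by (auto simp: QQ_def split: nat.split)
  then obtain w where w[measurable]: "w \<in> borel_measurable L"
    and wQQ: "\<And>i. (\<integral>\<^sup>+x. w x * QQ i x \<partial>L) < \<infinity>"
    and w_big: "\<And>k::nat. \<exists>n::nat. \<forall>x. of_nat n < S x \<longrightarrow> of_nat k \<le> w x"
    using exists_unbounded_weight[of S L QQ] conv by auto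
  have wD1: "(\<integral>\<^sup>+x. w x * D \<one> x \<partial>L) < \<infinity>"
    using wQQ[of 0] by (simp add: QQ_def)
  have wQ: "(\<integral>\<^sup>+x. w x * Q g x \<partial>L) < \<infinity>" if g: "g \<in> carrier G" for g
  proof -
    obtain n where "g = e n" using g e by (auto simp: bij_betw_def)
    then show ?thesis using wQQ[of "Suc n"] by (simp add: QQ_def)
  qed
  define r r' where "r n = enn2real (\<integral>\<^sup>+x. D (e n) x \<partial>L)"
    and "r' n = enn2real (\<integral>\<^sup>+x. w x * D (e n) x \<partial>L)" for n
  have diff1: "(\<integral>\<^sup>+h. sqnorm L (\<lambda>x. (f h x - F x) - (f (inv g \<otimes> h) x - F x)) \<partial>count_space (carrier G)) < \<infinity>"
    if "g \<in> carrier G" for g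
    using diff[OF that] by simp
  have one1: "sqnorm L (\<lambda>x. f \<one> x - F x) < \<infinity>"
    using D1 by (simp add: D_def)
  have fF: "(\<lambda>x. f h x - F x) \<in> borel_measurable L" if "h \<in> carrier G" for h
    using that by measurable
  note L2_u = L2_norms_converge_if_H1_trivial[where u="\<lambda>h x. f h x - F x", OF G H1 fF one1 diff1]
  have L2_1: "\<forall>h\<in>carrier G. (\<integral>\<^sup>+x. D h x \<partial>L) < \<infinity>"
    unfolding D_def by (rule L2_u(1))
  have "\<exists>a. (\<Sum>n. ennreal ((sqrt (r n) - a)\<^sup>2)) < \<infinity>"
    using L2_u(2) unfolding enum D_def r_def .
  then obtain a where a: "(\<Sum>n. ennreal ((sqrt (r n) - a)\<^sup>2)) < \<infinity>" by blast
  have diff2: "(\<integral>\<^sup>+h. sqnorm (density L w) (\<lambda>x. (f h x - F x) - (f (inv g \<otimes> h) x - F x)) \<partial>count_space (carrier G)) < \<infinity>"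
    if g[simp]: "g \<in> carrier G" for g
  proof -
    have [simp]: "inv g \<otimes> e n \<in> carrier G" for n by simp
    have "(\<integral>\<^sup>+h. sqnorm (density L w) (\<lambda>x. (f h x - F x) - (f (inv g \<otimes> h) x - F x)) \<partial>count_space (carrier G))
      = (\<Sum>n. \<integral>\<^sup>+x. w x * ennreal ((f (e n) x - f (inv g \<otimes> e n) x)\<^sup>2) \<partial>L)"
      unfolding enum by (simp add: nn_integral_density)
    also have "\<dots> = (\<integral>\<^sup>+x. (\<Sum>n. w x * ennreal ((f (e n) x - f (inv g \<otimes> e n) x)\<^sup>2)) \<partial>L)"
      by (rule nn_integral_suminf[symmetric]) measurable
    also have "\<dots> = (\<integral>\<^sup>+x. w x * Q g x \<partial>L)"
      unfolding Q_def by (simp only: ennreal_suminf_cmult)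
    finally show ?thesis using wQ[OF g] by simp
  qed
  have one2: "sqnorm (density L w) (\<lambda>x. f \<one> x - F x) < \<infinity>"
    using wD1 by (simp add: nn_integral_density D_def)
  have fFw: "(\<lambda>x. f h x - F x) \<in> borel_measurable (density L w)" if "h \<in> carrier G" for h
    using fF[OF that] by simp
  note L2_w = L2_norms_converge_if_H1_trivial[where u="\<lambda>h x. f h x - F x", OF G H1 fFw one2 diff2]
  have nd: "sqnorm (density L w) (\<lambda>x. f h x - F x) = (\<integral>\<^sup>+x. w x * D h x \<partial>L)"
    if "h \<in> carrier G" for h
    unfolding D_def using fF[OF that] by (intro nn_integral_density) auto
  have L2_2: "(\<integral>\<^sup>+x. w x * D h x \<partial>L) < \<infinity>" if h[simp]: "h \<in> carrier G" for h
    using bspec[OF L2_w(1) h] unfolding nd[OF h] .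
  have "\<exists>a. (\<Sum>n. ennreal ((sqrt (r' n) - a)\<^sup>2)) < \<infinity>"
    using L2_w(2) unfolding enum r'_def nd[OF eG] .
  then obtain a' where a': "(\<Sum>n. ennreal ((sqrt (r' n) - a')\<^sup>2)) < \<infinity>" by blast
  have to_a: "s \<longlonglongrightarrow> b\<^sup>2" if "(\<Sum>n. ennreal ((sqrt (s n) - b)\<^sup>2)) < \<infinity>" "\<And>n. 0 \<le> s n" for s b
  proof -
    have "(\<lambda>n. (sqrt (s n) - b)\<^sup>2) \<longlonglongrightarrow> 0"
      by (rule tendsto_zero_if_suminf_ennreal_finite[rotated, OF that(1)]) simp
    then have "(\<lambda>n. sqrt (s n)) \<longlonglongrightarrow> b"
      by (rule tendsto_if_square_diff_tendsto_zero)
    then have "(\<lambda>n. (sqrt (s n))\<^sup>2) \<longlonglongrightarrow> b\<^sup>2"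
      by (intro tendsto_intros)
    then show ?thesis using that(2) by simp
  qed
  have r_lim: "r \<longlonglongrightarrow> a\<^sup>2" and r'_lim: "r' \<longlonglongrightarrow> a'\<^sup>2"
    by (rule to_a[OF a], simp add: r_def) (rule to_a[OF a'], simp add: r'_def)
  have key: "real k * a\<^sup>2 \<le> a'\<^sup>2" for k :: nat
  proof -
    obtain m :: nat where m: "\<And>x. of_nat m < S x \<Longrightarrow> of_nat k \<le> w x"
      using w_big[of k] by blast
    define B where "B = {x. S x \<le> of_nat m}"
    define z where "z n = enn2real (\<integral>\<^sup>+x. indicator B x * D (e n) x \<partial>L)" for n
    have [measurable]: "(\<lambda>x. indicator B x :: ennreal) \<in> borel_measurable L"
      unfolding B_def by measurable
    have zfin: "(\<integral>\<^sup>+x. indicator B x * D (e n) x \<partial>L) < \<infinity>" for n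
    proof -
      have "(\<integral>\<^sup>+x. indicator B x * D (e n) x \<partial>L) \<le> (\<integral>\<^sup>+x. D (e n) x \<partial>L)"
        by (intro nn_integral_mono) (auto simp: indicator_def)
      also have "\<dots> < \<infinity>" using L2_1 by simp
      finally show ?thesis .
    qed
    have "(\<Sum>n. \<integral>\<^sup>+x. indicator B x * D (e n) x \<partial>L) = (\<integral>\<^sup>+x. (\<Sum>n. indicator B x * D (e n) x) \<partial>L)"
      by (rule nn_integral_suminf[symmetric]) measurable
    also have "\<dots> = (\<integral>\<^sup>+x. indicator B x * S x \<partial>L)"
      unfolding S_def by (simp only: ennreal_suminf_cmult)
    also have "\<dots> \<le> (\<integral>\<^sup>+x. of_nat m \<partial>L)"
      by (intro nn_integral_mono) (auto simp: B_def indicator_def)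
    also have "\<dots> < \<infinity>"
      using L.emeasure_finite[of "space L"]
      by (simp add: ennreal_mult_eq_top_iff less_top[symmetric])
    finally have "(\<Sum>n. ennreal (z n)) < \<infinity>"
      using zfin by (simp add: z_def)
    then have z: "z \<longlonglongrightarrow> 0"
      by (intro tendsto_zero_if_suminf_ennreal_finite) (auto simp: z_def)
    have "real k * r n \<le> r' n + real k * z n" for n
    proof -
      have "of_nat k * (\<integral>\<^sup>+x. D (e n) x \<partial>L) = (\<integral>\<^sup>+x. of_nat k * D (e n) x \<partial>L)"
        by (simp add: nn_integral_cmult)
      also have "\<dots> \<le> (\<integral>\<^sup>+x. w x * D (e n) x + of_nat k * (indicator B x * D (e n) x) \<partial>L)"
      proof (rule nn_integral_mono)
        fix x
        show "of_nat k * D (e n) x \<le> w x * D (e n) x + of_nat k * (indicator B x * D (e n) x)"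
        proof (cases "x \<in> B")
          case False
          then have "of_nat k \<le> w x" using m by (auto simp: B_def not_le)
          then show ?thesis using False by (simp add: mult_right_mono)
        qed simp
      qed
      also have "\<dots> = (\<integral>\<^sup>+x. w x * D (e n) x \<partial>L) + of_nat k * (\<integral>\<^sup>+x. indicator B x * D (e n) x \<partial>L)"
        by (simp add: nn_integral_add nn_integral_cmult)
      finally have "of_nat k * ennreal (r n) \<le> ennreal (r' n) + of_nat k * ennreal (z n)"
        using zfin[of n] L2_1 L2_2[of "e n"] by (simp add: r_def r'_def z_def)
      then have "ennreal (real k * r n) \<le> ennreal (r' n + real k * z n)"
        by (simp add: ennreal_mult ennreal_of_nat_eq_real_of_nat r_def r'_def z_def)
      then show ?thesis
        by (subst (asm) ennreal_le_iff) (auto simp: r'_def z_def)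
    qed
    then have "real k * a\<^sup>2 \<le> a'\<^sup>2 + real k * 0"
      by (intro LIMSEQ_le[OF tendsto_mult[OF tendsto_const r_lim]
            tendsto_add[OF r'_lim tendsto_mult[OF tendsto_const z]]]) auto
    then show ?thesis by simp
  qed
  have "a = 0"
  proof (rule ccontr)
    assume "a \<noteq> 0"
    then obtain k :: nat where "a'\<^sup>2 < real k * a\<^sup>2"
      using ex_less_of_nat_mult[of "a\<^sup>2" "a'\<^sup>2"] by (auto simp del: power2_eq_square)
    with key[of k] show False by simp
  qed
  then have "(\<Sum>n. ennreal (r n)) < \<infinity>"
    using a by (simp add: r_def)
  then have "(\<integral>\<^sup>+h. sqnorm L (\<lambda>x. f h x - F x) \<partial>count_space (carrier G)) < \<infinity>"
    using L2_1 unfolding enum r_def D_def by simp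
  then show ?thesis using F_meas by blast
qed

section \<open>Kakutani's criterion for infinite products\<close>

lemma nn_integral_PiM_prod:
  fixes f :: "'i \<Rightarrow> 'a \<Rightarrow> ennreal"
  assumes prob: "\<And>i. i \<in> I \<Longrightarrow> prob_space (M i)" and J: "finite J" "J \<subseteq> I"
    and f[measurable]: "\<And>i. i \<in> J \<Longrightarrow> f i \<in> borel_measurable (M i)"
  shows "(\<integral>\<^sup>+x. (\<Prod>i\<in>J. f i (x i)) \<partial>PiM I M) = (\<Prod>i\<in>J. \<integral>\<^sup>+y. f i y \<partial>M i)"
proof -
  let ?M = "\<lambda>i. if i \<in> J then M i else count_space {undefined}"
  interpret prob_space "?M i" for i
  proof (cases "i \<in> J")
    case True
    then show "prob_space (?M i)" using prob J by auto
  next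
    case False
    then show "prob_space (?M i)" by (simp, intro prob_spaceI) simp
  qed
  interpret product_sigma_finite ?M ..
  have MM: "PiM J ?M = PiM J M" by (intro PiM_cong) auto
  have "(\<lambda>x. \<Prod>i\<in>J. f i (x i)) \<in> borel_measurable (PiM J M)" by measurable
  then have "(\<integral>\<^sup>+x. (\<Prod>i\<in>J. f i (x i)) \<partial>distr (PiM I M) (PiM J M) (\<lambda>x. \<lambda>i\<in>J. x i)) =
      (\<integral>\<^sup>+x. (\<Prod>i\<in>J. f i ((\<lambda>i\<in>J. x i) i)) \<partial>PiM I M)"
    using J by (intro nn_integral_distr) (auto intro!: measurable_restrict measurable_component_singleton)
  moreover have "distr (PiM I M) (PiM J M) (\<lambda>x. \<lambda>i\<in>J. x i) = PiM J M"
    using distr_PiM_reindex[of I M "\<lambda>i. i" J] prob J by auto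
  ultimately have "(\<integral>\<^sup>+x. (\<Prod>i\<in>J. f i (x i)) \<partial>PiM I M) = (\<integral>\<^sup>+x. (\<Prod>i\<in>J. f i (x i)) \<partial>PiM J ?M)"
    by (simp add: MM cong: prod.cong)
  also have "\<dots> = (\<Prod>i\<in>J. \<integral>\<^sup>+y. f i y \<partial>?M i)"
    using J(1) f by (intro product_nn_integral_prod) auto
  also have "\<dots> = (\<Prod>i\<in>J. \<integral>\<^sup>+y. f i y \<partial>M i)"
    by (intro prod.cong) auto
  finally show ?thesis .
qed

lemma finite_subset_enumeration:
  assumes e: "bij_betw e (UNIV :: nat set) I" and K: "finite K" "K \<subseteq> I"
  shows "\<exists>m. K \<subseteq> e ` {..<m}"
proof -
  have "\<forall>i\<in>K. \<exists>n. i = e n" using K e by (auto simp: bij_betw_def)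
  then obtain r where r: "\<And>i. i \<in> K \<Longrightarrow> i = e (r i)" by metis
  have "r i < Suc (\<Sum>i\<in>K. r i)" if "i \<in> K" for i
    using member_le_sum[of i K r] that K(1) by (simp add: le_imp_less_Suc)
  then have "K \<subseteq> e ` {..<Suc (\<Sum>i\<in>K. r i)}" using r by blast
  then show ?thesis by blast
qed

lemma one_minus_prod_le_sum:
  fixes a :: "'i \<Rightarrow> real"
  assumes "finite J" "\<And>i. i \<in> J \<Longrightarrow> 0 \<le> a i \<and> a i \<le> 1"
  shows "1 - (\<Prod>i\<in>J. a i) \<le> (\<Sum>i\<in>J. 1 - a i)"
  using assms
proof (induction J rule: finite_induct)
  case (insert j J)
  have p: "0 \<le> (\<Prod>i\<in>J. a i)" "(\<Prod>i\<in>J. a i) \<le> 1"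
    using insert.prems by (auto intro: prod_nonneg prod_le_1)
  have "(1 - a j) * (\<Prod>i\<in>J. a i) \<le> 1 - a j"
    using p insert.prems[of j] by (simp add: mult_left_le)
  moreover have "1 - (\<Prod>i\<in>J. a i) \<le> (\<Sum>i\<in>J. 1 - a i)"
    using insert by auto
  ultimately show ?case using insert(1,2) by (simp add: algebra_simps)
qed simp

text \<open>The density of \<open>N i\<close> with respect to \<open>M i\<close> is given by its square root \<open>\<rho> i\<close>, so that
  Hellinger affinities are plain integrals and products of densities are squares.\<close>

locale square_root_densities =
  fixes I :: "'i set" and M :: "'i \<Rightarrow> 'a measure" and \<rho> :: "'i \<Rightarrow> 'a \<Rightarrow> real" and e :: "nat \<Rightarrow> 'i"
  assumes prob: "\<And>i. i \<in> I \<Longrightarrow> prob_space (M i)"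
    and \<rho>_meas: "\<And>i. i \<in> I \<Longrightarrow> \<rho> i \<in> borel_measurable (M i)"
    and \<rho>_nonneg: "\<And>i x. i \<in> I \<Longrightarrow> 0 \<le> \<rho> i x"
    and \<rho>_norm: "\<And>i. i \<in> I \<Longrightarrow> (\<integral>\<^sup>+x. ennreal ((\<rho> i x)\<^sup>2) \<partial>M i) = 1"
    and e: "bij_betw e UNIV I"
begin

definition "N i = density (M i) (\<lambda>x. ennreal ((\<rho> i x)\<^sup>2))"

definition "affinity i = (\<integral>x. \<rho> i x \<partial>M i)"

definition "J n = e ` {..<n}"

text \<open>The square root of the density of \<open>PiM I N\<close> with respect to \<open>PiM I M\<close> on the
  \<open>\<sigma>\<close>-algebra of the first \<open>n\<close> coordinates.\<close>

definition "\<Delta> n x = (\<Prod>i\<in>J n. \<rho> i (x i))"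

lemma J: "finite (J n)" "J n \<subseteq> I" and J_mono: "m \<le> n \<Longrightarrow> J m \<subseteq> J n"
  using e by (auto simp: J_def bij_betw_def)

lemma J_I[simp]: "i \<in> J n \<Longrightarrow> i \<in> I"
  using J by auto

lemma prod_J_diff:
  fixes h :: "'i \<Rightarrow> 'z :: comm_monoid_mult"
  assumes "m \<le> n"
  shows "(\<Prod>i\<in>J n - J m. h i) = (\<Prod>k\<in>{m..<n}. h (e k))"
proof -
  have "inj e" using e by (simp add: bij_betw_def)
  then have "J n - J m = e ` ({..<n} - {..<m})"
    unfolding J_def by (rule image_set_diff[symmetric])
  moreover have "{..<n} - {..<m} = {m..<n}" using assms by auto
  moreover have "inj_on e {m..<n}" using e by (auto simp: bij_betw_def inj_on_def)
  ultimately show ?thesis by (simp add: prod.reindex)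
qed

lemma prob_N: "i \<in> I \<Longrightarrow> prob_space (N i)"
  using \<rho>_norm[of i] \<rho>_meas[of i]
  by (intro prob_spaceI) (simp add: N_def emeasure_density cong: nn_integral_cong)

lemma sets_N[simp]: "sets (N i) = sets (M i)" and space_N[simp]: "space (N i) = space (M i)"
  by (auto simp: N_def)

lemma sets_PiM_N: "sets (PiM I N) = sets (PiM I M)"
  by (intro sets_PiM_cong) auto

lemma nn_integral_\<rho>: "i \<in> I \<Longrightarrow> (\<integral>\<^sup>+x. ennreal (\<rho> i x) \<partial>M i) = ennreal (affinity i)"
  and affinity_bounds: "i \<in> I \<Longrightarrow> 0 \<le> affinity i \<and> affinity i \<le> 1"
proof -
  assume i: "i \<in> I"
  interpret prob_space "M i" by (rule prob[OF i])
  note [measurable] = \<rho>_meas[OF i]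
  have sq: "integrable (M i) (\<lambda>x. (\<rho> i x)\<^sup>2)" "(\<integral>x. (\<rho> i x)\<^sup>2 \<partial>M i) = 1"
    using nn_integral_eq_integrable[of "\<lambda>x. (\<rho> i x)\<^sup>2" "M i" 1] \<rho>_norm[OF i] by auto
  have le: "\<rho> i x \<le> (1 + (\<rho> i x)\<^sup>2) / 2" for x
    using sum_squares_bound[of "\<rho> i x" 1] by simp
  have le_int: "integrable (M i) (\<lambda>x. (1 + (\<rho> i x)\<^sup>2) / 2)" using sq by simp
  have int: "integrable (M i) (\<rho> i)"
    by (rule Bochner_Integration.integrable_bound[OF le_int])
      (use le \<rho>_nonneg[OF i] in \<open>auto intro!: AE_I2\<close>)
  show "(\<integral>\<^sup>+x. ennreal (\<rho> i x) \<partial>M i) = ennreal (affinity i)"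
    unfolding affinity_def using int \<rho>_nonneg[OF i] by (intro nn_integral_eq_integral) auto
  have "affinity i \<le> (\<integral>x. (1 + (\<rho> i x)\<^sup>2) / 2 \<partial>M i)"
    unfolding affinity_def using int le_int le by (rule integral_mono)
  also have "\<dots> = 1" using sq by (simp add: prob_space)
  finally show "0 \<le> affinity i \<and> affinity i \<le> 1"
    using \<rho>_nonneg[OF i] by (simp add: affinity_def integral_nonneg_AE)
qed

lemma \<Delta>_meas[measurable]: "\<Delta> n \<in> borel_measurable (PiM I M)"
proof -
  have "(\<lambda>x. \<rho> i (x i)) \<in> borel_measurable (PiM I M)" if "i \<in> J n" for i
    using that J \<rho>_meas[of i] by (intro measurable_compose[OF measurable_component_singleton]) auto
  then show ?thesis
    unfolding \<Delta>_def by (intro borel_measurable_prod)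
qed

lemma \<Delta>_nonneg: "0 \<le> \<Delta> n x"
  unfolding \<Delta>_def using J \<rho>_nonneg by (intro prod_nonneg) auto

lemma nn_integral_\<Delta>: "(\<integral>\<^sup>+x. ennreal (\<Delta> n x) \<partial>PiM I M) = ennreal (\<Prod>k<n. affinity (e k))"
proof -
  have "(\<integral>\<^sup>+x. ennreal (\<Delta> n x) \<partial>PiM I M) = (\<integral>\<^sup>+x. (\<Prod>i\<in>J n. ennreal (\<rho> i (x i))) \<partial>PiM I M)"
    unfolding \<Delta>_def using J \<rho>_nonneg by (intro nn_integral_cong prod_ennreal[symmetric]) auto
  also have "\<dots> = (\<Prod>i\<in>J n. \<integral>\<^sup>+y. ennreal (\<rho> i y) \<partial>M i)"
    using J \<rho>_meas by (intro nn_integral_PiM_prod prob) auto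
  also have "\<dots> = (\<Prod>i\<in>J n. ennreal (affinity i))"
    using J by (intro prod.cong refl nn_integral_\<rho>) auto
  also have "\<dots> = ennreal (\<Prod>i\<in>J n. affinity i)"
    using J affinity_bounds by (intro prod_ennreal) auto
  also have "(\<Prod>i\<in>J n. affinity i) = (\<Prod>k<n. affinity (e k))"
    unfolding J_def using e by (subst prod.reindex) (auto simp: bij_betw_def inj_on_def)
  finally show ?thesis .
qed

text \<open>Each coordinate below \<open>m\<close> contributes the unit norm of its \<open>\<rho> i\<close>, each coordinate between
  \<open>m\<close> and \<open>n\<close> its affinity.\<close>

lemma nn_integral_\<Delta>_\<Delta>:
  assumes "m \<le> n"
  shows "(\<integral>\<^sup>+x. ennreal (\<Delta> m x * \<Delta> n x) \<partial>PiM I M) = ennreal (\<Prod>k\<in>{m..<n}. affinity (e k))"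
proof -
  have "\<Delta> m x * \<Delta> n x = (\<Prod>i\<in>J n. if i \<in> J m then (\<rho> i (x i))\<^sup>2 else \<rho> i (x i))" for x
  proof -
    have "(\<Prod>i\<in>J n. if i \<in> J m then (\<rho> i (x i))\<^sup>2 else \<rho> i (x i)) =
      (\<Prod>i\<in>J n - J m. \<rho> i (x i)) * (\<Prod>i\<in>J m. (\<rho> i (x i))\<^sup>2)"
      using prod.subset_diff[OF J_mono[OF assms] J(1), of "\<lambda>i. if i \<in> J m then (\<rho> i (x i))\<^sup>2 else \<rho> i (x i)"]
      by simp
    moreover have "\<Delta> n x = (\<Prod>i\<in>J n - J m. \<rho> i (x i)) * \<Delta> m x"
      unfolding \<Delta>_def by (rule prod.subset_diff[OF J_mono[OF assms] J(1)])
    ultimately show ?thesis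
      by (simp add: \<Delta>_def prod_power_distrib power2_eq_square prod.distrib ac_simps)
  qed
  then have "(\<integral>\<^sup>+x. ennreal (\<Delta> m x * \<Delta> n x) \<partial>PiM I M) =
      (\<integral>\<^sup>+x. (\<Prod>i\<in>J n. ennreal (if i \<in> J m then (\<rho> i (x i))\<^sup>2 else \<rho> i (x i))) \<partial>PiM I M)"
    using J \<rho>_nonneg by (auto intro!: nn_integral_cong prod_ennreal[symmetric])
  also have "\<dots> = (\<Prod>i\<in>J n. \<integral>\<^sup>+y. ennreal (if i \<in> J m then (\<rho> i y)\<^sup>2 else \<rho> i y) \<partial>M i)"
  proof (intro nn_integral_PiM_prod prob J)
    fix i assume "i \<in> J n"
    then have [measurable]: "\<rho> i \<in> borel_measurable (M i)" using J \<rho>_meas by auto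
    show "(\<lambda>y. ennreal (if i \<in> J m then (\<rho> i y)\<^sup>2 else \<rho> i y)) \<in> borel_measurable (M i)"
      by (cases "i \<in> J m") auto
  qed
  also have "\<dots> = (\<Prod>i\<in>J n. if i \<in> J m then 1 else ennreal (affinity i))"
    using J(2)[of n] by (intro prod.cong refl) (auto simp: \<rho>_norm nn_integral_\<rho>)
  also have "\<dots> = (\<Prod>i\<in>J n - J m. ennreal (affinity i))"
    using prod.subset_diff[OF J_mono[OF assms] J(1), of "\<lambda>i. if i \<in> J m then 1 else ennreal (affinity i)"]
    by simp
  also have "\<dots> = ennreal (\<Prod>i\<in>J n - J m. affinity i)"
    using J(2)[of n] affinity_bounds by (intro prod_ennreal) auto
  also have "\<dots> = ennreal (\<Prod>k\<in>{m..<n}. affinity (e k))"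
    by (simp add: prod_J_diff[OF assms])
  finally show ?thesis .
qed

lemma integrable_\<Delta>_\<Delta>: "m \<le> n \<Longrightarrow> integrable (PiM I M) (\<lambda>x. \<Delta> m x * \<Delta> n x)"
  and integral_\<Delta>_\<Delta>: "m \<le> n \<Longrightarrow> (\<integral>x. \<Delta> m x * \<Delta> n x \<partial>PiM I M) = (\<Prod>k\<in>{m..<n}. affinity (e k))"
proof -
  assume mn: "m \<le> n"
  have "0 \<le> (\<Prod>k\<in>{m..<n}. affinity (e k))"
    using affinity_bounds e by (intro prod_nonneg) (auto simp: bij_betw_def)
  then show "integrable (PiM I M) (\<lambda>x. \<Delta> m x * \<Delta> n x)"
    "(\<integral>x. \<Delta> m x * \<Delta> n x \<partial>PiM I M) = (\<Prod>k\<in>{m..<n}. affinity (e k))"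
    using nn_integral_eq_integrable[of "\<lambda>x. \<Delta> m x * \<Delta> n x" "PiM I M"] nn_integral_\<Delta>_\<Delta>[OF mn] \<Delta>_nonneg
    by auto
qed

text \<open>The densities \<open>\<Delta>\<^sup>2\<close> are Cauchy in \<open>L\<^sup>1\<close> because the roots \<open>\<Delta>\<close> are Cauchy in \<open>L\<^sup>2\<close>:
  their distance is controlled by the affinities of the new coordinates.\<close>

lemma integral_\<Delta>_square_diff_le:
  assumes mn: "m \<le> n" and t: "0 < t" and le: "(\<Sum>k\<in>{m..<n}. 1 - affinity (e k)) \<le> t\<^sup>2"
  shows "(\<integral>x. \<bar>(\<Delta> n x)\<^sup>2 - (\<Delta> m x)\<^sup>2\<bar> \<partial>PiM I M) \<le> 3 * t"
proof -
  define p where "p = (\<Prod>k\<in>{m..<n}. affinity (e k))"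
  have aff: "0 \<le> affinity (e k) \<and> affinity (e k) \<le> 1" for k
    using affinity_bounds e by (auto simp: bij_betw_def)
  have p1: "p \<le> 1" unfolding p_def using aff by (intro prod_le_1) auto
  have p: "1 - p \<le> t\<^sup>2"
    unfolding p_def using one_minus_prod_le_sum[of "{m..<n}" "\<lambda>k. affinity (e k)"] aff le by auto
  note int = integrable_\<Delta>_\<Delta>[OF order_refl[of n]] integrable_\<Delta>_\<Delta>[OF order_refl[of m]] integrable_\<Delta>_\<Delta>[OF mn]
  note val = integral_\<Delta>_\<Delta>[OF order_refl[of n]] integral_\<Delta>_\<Delta>[OF order_refl[of m]] integral_\<Delta>_\<Delta>[OF mn, folded p_def]
  \<comment> \<open>The arithmetic--geometric mean inequality with parameter \<open>t\<close> for the product of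
    \<open>\<bar>\<Delta> n - \<Delta> m\<bar>\<close>, which is small in \<open>L\<^sup>2\<close>, and \<open>\<Delta> n + \<Delta> m\<close>, which is bounded there.\<close>
  have bound: "\<bar>(\<Delta> n x)\<^sup>2 - (\<Delta> m x)\<^sup>2\<bar> \<le>
      (\<Delta> n x * \<Delta> n x + \<Delta> m x * \<Delta> m x - 2 * (\<Delta> m x * \<Delta> n x)) / (2 * t)
      + (\<Delta> n x * \<Delta> n x + \<Delta> m x * \<Delta> m x + 2 * (\<Delta> m x * \<Delta> n x)) * (t / 2)" for x
  proof -
    define u v where "u = \<bar>\<Delta> n x - \<Delta> m x\<bar>" and "v = \<Delta> n x + \<Delta> m x"
    have v: "0 \<le> v" unfolding v_def using \<Delta>_nonneg[of n x] \<Delta>_nonneg[of m x] by simp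
    have "\<bar>(\<Delta> n x)\<^sup>2 - (\<Delta> m x)\<^sup>2\<bar> = u * v"
      using v by (simp add: u_def v_def power2_eq_square square_diff_square_factored abs_mult mult.commute)
    moreover have "2 * u * (t * v) \<le> u\<^sup>2 + (t * v)\<^sup>2" by (rule sum_squares_bound)
    then have "u * v \<le> u\<^sup>2 / (2 * t) + v\<^sup>2 * (t / 2)"
      using t by (simp add: field_simps power2_eq_square)
    moreover have "u\<^sup>2 = \<Delta> n x * \<Delta> n x + \<Delta> m x * \<Delta> m x - 2 * (\<Delta> m x * \<Delta> n x)"
      "v\<^sup>2 = \<Delta> n x * \<Delta> n x + \<Delta> m x * \<Delta> m x + 2 * (\<Delta> m x * \<Delta> n x)"
      by (simp_all add: u_def v_def power2_eq_square algebra_simps)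
    ultimately show ?thesis by simp
  qed
  have int2: "integrable (PiM I M) (\<lambda>x. \<bar>(\<Delta> n x)\<^sup>2 - (\<Delta> m x)\<^sup>2\<bar>)"
    using int by (simp add: power2_eq_square)
  have "(\<integral>x. \<bar>(\<Delta> n x)\<^sup>2 - (\<Delta> m x)\<^sup>2\<bar> \<partial>PiM I M) \<le> (\<integral>x.
      (\<Delta> n x * \<Delta> n x + \<Delta> m x * \<Delta> m x - 2 * (\<Delta> m x * \<Delta> n x)) / (2 * t)
      + (\<Delta> n x * \<Delta> n x + \<Delta> m x * \<Delta> m x + 2 * (\<Delta> m x * \<Delta> n x)) * (t / 2) \<partial>PiM I M)"
    using int2 int bound by (intro integral_mono) auto
  also have "\<dots> = (2 - 2 * p) / (2 * t) + (2 + 2 * p) * (t / 2)"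
    using int by (simp add: val)
  also have "\<dots> = (1 - p) / t + (1 + p) * t"
    using t by (simp add: field_simps)
  also have "\<dots> \<le> t\<^sup>2 / t + 2 * t"
    using t p p1 by (intro add_mono divide_right_mono mult_right_mono) auto
  also have "\<dots> = 3 * t"
    using t by (simp add: power2_eq_square)
  finally show ?thesis .
qed

lemma integral_\<Delta>_square_rectangle:
  assumes K: "finite K" "K \<subseteq> J n" and E: "\<And>i. i \<in> K \<Longrightarrow> E i \<in> sets (M i)"
  shows "(\<integral>\<^sup>+x. indicator (prod_emb I M K (Pi\<^sub>E K E)) x * ennreal ((\<Delta> n x)\<^sup>2) \<partial>PiM I M) =
    emeasure (PiM I N) (prod_emb I M K (Pi\<^sub>E K E))"
proof -
  let ?E = "\<lambda>i. if i \<in> K then E i else space (M i)"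
  have KI: "K \<subseteq> I" using K J by auto
  have E_sets: "?E i \<in> sets (M i)" for i using E by auto
  have "(\<integral>\<^sup>+x. indicator (prod_emb I M K (Pi\<^sub>E K E)) x * ennreal ((\<Delta> n x)\<^sup>2) \<partial>PiM I M) =
     (\<integral>\<^sup>+x. (\<Prod>i\<in>J n. ennreal ((\<rho> i (x i))\<^sup>2) * indicator (?E i) (x i)) \<partial>PiM I M)"
  proof (rule nn_integral_cong)
    fix x assume x: "x \<in> space (PiM I M)"
    have "ennreal ((\<Delta> n x)\<^sup>2) = (\<Prod>i\<in>J n. ennreal ((\<rho> i (x i))\<^sup>2))"
      unfolding \<Delta>_def prod_power_distrib by (rule prod_ennreal[symmetric]) simp
    moreover have "(indicator (prod_emb I M K (Pi\<^sub>E K E)) x :: ennreal) = (\<Prod>i\<in>J n. indicator (?E i) (x i))"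
    proof (cases "x \<in> prod_emb I M K (Pi\<^sub>E K E)")
      case True
      then have "(\<Prod>i\<in>J n. indicator (?E i) (x i) :: ennreal) = 1"
        using J(2)[of n] x by (intro prod.neutral) (auto simp: prod_emb_def PiE_iff space_PiM)
      then show ?thesis using True by simp
    next
      case False
      then obtain i where "i \<in> K" "x i \<notin> E i"
        using x by (auto simp: prod_emb_def PiE_iff space_PiM)
      then have "(\<Prod>i\<in>J n. indicator (?E i) (x i) :: ennreal) = 0"
        using K J(1) by (intro prod_zero bexI[of _ i]) auto
      then show ?thesis using False by simp
    qed
    ultimately show "indicator (prod_emb I M K (Pi\<^sub>E K E)) x * ennreal ((\<Delta> n x)\<^sup>2) =
        (\<Prod>i\<in>J n. ennreal ((\<rho> i (x i))\<^sup>2) * indicator (?E i) (x i))"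
      by (simp only: prod.distrib mult.commute)
  qed
  also have "\<dots> = (\<Prod>i\<in>J n. \<integral>\<^sup>+y. ennreal ((\<rho> i y)\<^sup>2) * indicator (?E i) y \<partial>M i)"
  proof (intro nn_integral_PiM_prod prob J)
    fix i assume "i \<in> J n"
    then have [measurable]: "\<rho> i \<in> borel_measurable (M i)" "?E i \<in> sets (M i)"
      using J \<rho>_meas E_sets by auto
    show "(\<lambda>y. ennreal ((\<rho> i y)\<^sup>2) * indicator (?E i) y) \<in> borel_measurable (M i)"
      by measurable
  qed
  also have "\<dots> = (\<Prod>i\<in>J n. emeasure (N i) (?E i))"
    unfolding N_def using J(2)[of n] \<rho>_meas E_sets
    by (intro prod.cong refl emeasure_density[symmetric]) auto
  also have "\<dots> = (\<Prod>i\<in>K. emeasure (N i) (?E i))"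
  proof (rule prod.mono_neutral_right)
    show "\<forall>i\<in>J n - K. emeasure (N i) (?E i) = 1"
    proof
      fix i assume i: "i \<in> J n - K"
      then interpret prob_space "N i" using J prob_N by auto
      show "emeasure (N i) (?E i) = 1" using i emeasure_space_1 by simp
    qed
  qed (use K J in auto)
  also have "\<dots> = (\<Prod>i\<in>K. emeasure (N i) (E i))" by simp
  also have "\<dots> = emeasure (PiM I N) (prod_emb I N K (Pi\<^sub>E K E))"
    using K KI E by (intro emeasure_PiM_emb[symmetric] prob_N) auto
  also have "prod_emb I N K (Pi\<^sub>E K E) = prod_emb I M K (Pi\<^sub>E K E)"
    by (simp add: prod_emb_def)
  finally show ?thesis .
qed

text \<open>Along a subsequence the densities \<open>\<Delta>\<^sup>2\<close> converge in \<open>L\<^sup>1\<close> geometrically fast, hence almost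
  everywhere. On a rectangle their integrals are eventually constant, equal to
  the measure of the rectangle under \<open>PiM I N\<close>; so the limit is a density of \<open>PiM I N\<close>.\<close>

lemma kakutani_absolutely_continuous:
  assumes summable: "summable (\<lambda>n. 1 - affinity (e n))"
  shows "absolutely_continuous (PiM I M) (PiM I N)"
proof -
  let ?P = "PiM I M"
  interpret P: prob_space ?P by (intro prob_space_PiM prob)
  interpret Q: prob_space "PiM I N" by (intro prob_space_PiM prob_N)
  have aff: "0 \<le> affinity (e k) \<and> affinity (e k) \<le> 1" for k
    using affinity_bounds e by (auto simp: bij_betw_def)
  have "\<exists>b. \<forall>m\<ge>b. \<forall>n. (\<Sum>i\<in>{m..<n}. 1 - affinity (e i)) \<le> ((1/2) ^ k)\<^sup>2" for k :: nat
  proof -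
    have "0 < ((1/2 :: real) ^ k)\<^sup>2" by simp
    then obtain b where b: "\<And>m n. b \<le> m \<Longrightarrow> norm (\<Sum>i\<in>{m..<n}. 1 - affinity (e i)) < ((1/2) ^ k)\<^sup>2"
      using summable[unfolded summable_Cauchy] by blast
    have "(\<Sum>i\<in>{m..<n}. 1 - affinity (e i)) \<le> ((1/2) ^ k)\<^sup>2" if "b \<le> m" for m n
      using b[OF that, of n] unfolding real_norm_def by linarith
    then show ?thesis by (intro exI[of _ b]) simp
  qed
  then obtain b where b: "\<And>k m n. b k \<le> m \<Longrightarrow> (\<Sum>i\<in>{m..<n}. 1 - affinity (e i)) \<le> ((1/2) ^ k)\<^sup>2"
    by metis
  \<comment> \<open>Summing the \<open>b j\<close> makes the indices monotone; the term \<open>k\<close> makes them unbounded, so every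
    rectangle is eventually covered.\<close>
  define c where "c k = k + (\<Sum>j\<le>k. b j)" for k
  have c_b: "b k \<le> c k" for k
    unfolding c_def by (intro trans_le_add2 member_le_sum) auto
  have c_mono: "c k \<le> c (Suc k)" for k by (simp add: c_def)
  have c_ge: "k \<le> c k" for k by (simp add: c_def)
  define d where "d k x = (\<Delta> (c k) x)\<^sup>2" for k x
  have d_meas[measurable]: "d k \<in> borel_measurable ?P" for k
    unfolding d_def by measurable
  have d_int: "integrable ?P (d k)" for k
    using integrable_\<Delta>_\<Delta>[OF order_refl] unfolding d_def power2_eq_square .
  define f where "f k x = d (Suc k) x - d k x" for k x
  have f_meas[measurable]: "f k \<in> borel_measurable ?P" for k unfolding f_def by measurable
  have f_int: "integrable ?P (f k)" for k unfolding f_def using d_int by simp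
  have f_le: "(\<integral>x. norm (f k x) \<partial>?P) \<le> 3 * (1/2) ^ k" for k
    unfolding f_def d_def real_norm_def
    by (rule integral_\<Delta>_square_diff_le[OF c_mono]) (use b[OF c_b] in auto)
  have geom: "summable (\<lambda>k. 3 * (1/2 :: real) ^ k)"
    by (intro summable_mult summable_geometric) simp
  have f_sum: "summable (\<lambda>k. \<integral>x. norm (f k x) \<partial>?P)"
    by (rule summable_comparison_test'[OF geom, of 0]) (use f_le in simp)
  have f_AE: "AE x in ?P. summable (\<lambda>k. norm (f k x))"
  proof -
    have "(\<integral>\<^sup>+x. (\<Sum>k. ennreal (norm (f k x))) \<partial>?P) = (\<Sum>k. \<integral>\<^sup>+x. ennreal (norm (f k x)) \<partial>?P)"
      by (rule nn_integral_suminf) measurable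
    also have "\<dots> = (\<Sum>k. ennreal (\<integral>x. norm (f k x) \<partial>?P))"
      using f_int by (intro suminf_cong nn_integral_eq_integral) auto
    also have "\<dots> \<noteq> \<infinity>"
      using f_sum by (subst suminf_ennreal2) auto
    finally have "AE x in ?P. (\<Sum>k. ennreal (norm (f k x))) \<noteq> \<infinity>"
      by (intro nn_integral_PInf_AE) auto
    then show ?thesis
      by eventually_elim (auto intro!: summable_suminf_not_top)
  qed
  define D where "D x = d 0 x + (\<Sum>k. f k x)" for x
  have D_meas[measurable]: "D \<in> borel_measurable ?P" unfolding D_def by measurable
  have D_int: "integrable ?P D"
    unfolding D_def by (intro Bochner_Integration.integrable_add d_int integrable_suminf f_int f_AE f_sum)
  have tele: "(\<Sum>k<n. f k x) = d n x - d 0 x" for n x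
    unfolding f_def by (rule sum_lessThan_telescope)
  have D_nonneg: "AE x in ?P. 0 \<le> D x"
    using f_AE
  proof eventually_elim
    fix x assume "summable (\<lambda>k. norm (f k x))"
    then have "(\<lambda>k. f k x) sums (\<Sum>k. f k x)"
      by (rule summable_sums[OF summable_norm_cancel])
    then have "(\<lambda>n. d n x - d 0 x) \<longlonglongrightarrow> (\<Sum>k. f k x)"
      by (simp add: sums_def tele)
    from tendsto_add[OF tendsto_const[of "d 0 x"] this]
    have "(\<lambda>n. d n x) \<longlonglongrightarrow> D x" by (simp add: D_def)
    then show "0 \<le> D x"
      by (rule LIMSEQ_le_const) (auto simp: d_def)
  qed
  have D_lim: "(\<lambda>n. \<integral>x. indicator B x * d n x \<partial>?P) \<longlonglongrightarrow> (\<integral>x. indicator B x * D x \<partial>?P)"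
    if B[measurable]: "B \<in> sets ?P" for B
  proof -
    have ind_int: "integrable ?P (\<lambda>x. indicator B x * h x)" if "integrable ?P h" for h :: "_ \<Rightarrow> real"
      using integrable_real_mult_indicator[OF B that] by (simp add: mult.commute)
    have le: "(\<integral>x. norm (indicator B x * f k x) \<partial>?P) \<le> (\<integral>x. norm (f k x) \<partial>?P)" for k
      by (intro integral_mono integrable_norm ind_int f_int) (auto simp: indicator_def)
    have AEB: "AE x in ?P. summable (\<lambda>k. norm (indicator B x * f k x))"
      using f_AE
    proof eventually_elim
      fix x assume "summable (\<lambda>k. norm (f k x))"
      then show "summable (\<lambda>k. norm (indicator B x * f k x))"
        by (rule summable_comparison_test'[of _ 0]) (auto simp: indicator_def)
    qed
    have "(\<lambda>k. \<integral>x. indicator B x * f k x \<partial>?P) sums (\<integral>x. (\<Sum>k. indicator B x * f k x) \<partial>?P)"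
    proof (intro sums_integral ind_int f_int AEB)
      show "summable (\<lambda>k. \<integral>x. norm (indicator B x * f k x) \<partial>?P)"
        by (rule summable_comparison_test'[OF f_sum, of 0]) (use le in auto)
    qed
    moreover have "(\<integral>x. (\<Sum>k. indicator B x * f k x) \<partial>?P) = (\<integral>x. indicator B x * (\<Sum>k. f k x) \<partial>?P)"
    proof (rule Bochner_Integration.integral_cong[OF refl])
      fix x show "(\<Sum>k. indicator B x * f k x) = indicator B x * (\<Sum>k. f k x)"
        by (cases "x \<in> B") auto
    qed
    ultimately have "(\<lambda>n. \<Sum>k<n. \<integral>x. indicator B x * f k x \<partial>?P) \<longlonglongrightarrow> (\<integral>x. indicator B x * (\<Sum>k. f k x) \<partial>?P)"
      by (simp add: sums_def)
    moreover have "(\<Sum>k<n. \<integral>x. indicator B x * f k x \<partial>?P) =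
        (\<integral>x. indicator B x * d n x \<partial>?P) - (\<integral>x. indicator B x * d 0 x \<partial>?P)" for n
    proof -
      have "(\<Sum>k<n. \<integral>x. indicator B x * f k x \<partial>?P) = (\<Sum>k<n. (\<integral>x. indicator B x * d (Suc k) x \<partial>?P) - (\<integral>x. indicator B x * d k x \<partial>?P))"
      proof (rule sum.cong[OF refl])
        fix k
        have "(\<integral>x. indicator B x * f k x \<partial>?P) = (\<integral>x. indicator B x * d (Suc k) x - indicator B x * d k x \<partial>?P)"
          by (simp add: f_def right_diff_distrib)
        then show "(\<integral>x. indicator B x * f k x \<partial>?P) = (\<integral>x. indicator B x * d (Suc k) x \<partial>?P) - (\<integral>x. indicator B x * d k x \<partial>?P)"
          by (simp only: Bochner_Integration.integral_diff[OF ind_int[OF d_int] ind_int[OF d_int]])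
      qed
      then show ?thesis
        using sum_lessThan_telescope[of "\<lambda>k. \<integral>x. indicator B x * d k x \<partial>?P" n] by simp
    qed
    ultimately have "(\<lambda>n. (\<integral>x. indicator B x * d n x \<partial>?P) - (\<integral>x. indicator B x * d 0 x \<partial>?P))
        \<longlonglongrightarrow> (\<integral>x. indicator B x * (\<Sum>k. f k x) \<partial>?P)" by simp
    from tendsto_add[OF tendsto_const[of "\<integral>x. indicator B x * d 0 x \<partial>?P"] this]
    have "(\<lambda>n. \<integral>x. indicator B x * d n x \<partial>?P) \<longlonglongrightarrow>
        (\<integral>x. indicator B x * d 0 x \<partial>?P) + (\<integral>x. indicator B x * (\<Sum>k. f k x) \<partial>?P)" by simp
    also have "(\<integral>x. indicator B x * d 0 x \<partial>?P) + (\<integral>x. indicator B x * (\<Sum>k. f k x) \<partial>?P) = (\<integral>x. indicator B x * D x \<partial>?P)"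
      unfolding D_def distrib_left
      by (intro Bochner_Integration.integral_add[symmetric] ind_int d_int integrable_suminf f_int f_AE f_sum)
    finally show ?thesis .
  qed
  have "PiM I N = density ?P (\<lambda>x. ennreal (D x))"
  proof (rule measure_eqI_PiM_infinite[where I=I and M=M])
    show "sets (PiM I N) = sets ?P" by (rule sets_PiM_N)
    show "finite_measure (PiM I N)" by (rule Q.finite_measure_axioms)
    fix E K assume K: "finite K" "K \<subseteq> I" and E: "\<And>i. i \<in> K \<Longrightarrow> E i \<in> sets (M i)"
    let ?B = "prod_emb I M K (Pi\<^sub>E K E)"
    have B[measurable]: "?B \<in> sets ?P" using K E by (intro sets_PiM_I) auto
    have "\<exists>m. K \<subseteq> J m" unfolding J_def by (rule finite_subset_enumeration[OF e K])
    then obtain m where m: "K \<subseteq> J m" by blast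
    have "(\<integral>x. indicator ?B x * d n x \<partial>?P) = measure (PiM I N) ?B" if "m \<le> n" for n
    proof -
      have "K \<subseteq> J (c n)" using m J_mono[of m "c n"] c_ge[of n] that by (meson order_trans)
      from integral_\<Delta>_square_rectangle[OF K(1) this E]
      have "(\<integral>\<^sup>+x. ennreal (indicator ?B x * d n x) \<partial>?P) = emeasure (PiM I N) ?B"
        by (simp add: d_def ennreal_mult' ennreal_indicator)
      then show ?thesis
        by (subst integral_eq_nn_integral) (auto simp: d_def measure_def)
    qed
    then have "(\<lambda>n. \<integral>x. indicator ?B x * d n x \<partial>?P) \<longlonglongrightarrow> measure (PiM I N) ?B"
      by (intro tendsto_eventually) (auto simp: eventually_sequentially)
    from LIMSEQ_unique[OF D_lim[OF B] this]
    have D_B: "(\<integral>x. indicator ?B x * D x \<partial>?P) = measure (PiM I N) ?B" .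
    have "emeasure (density ?P (\<lambda>x. ennreal (D x))) ?B = (\<integral>\<^sup>+x. ennreal (indicator ?B x * D x) \<partial>?P)"
      by (subst emeasure_density) (auto intro!: nn_integral_cong simp: indicator_def)
    also have "\<dots> = ennreal (\<integral>x. indicator ?B x * D x \<partial>?P)"
    proof (rule nn_integral_eq_integral)
      show "integrable ?P (\<lambda>x. indicator ?B x * D x)"
        using integrable_real_mult_indicator[OF B D_int] by (simp add: mult.commute)
      show "AE x in ?P. 0 \<le> indicator ?B x * D x"
        using D_nonneg by eventually_elim (simp add: indicator_def)
    qed
    finally show "emeasure (PiM I N) ?B = emeasure (density ?P (\<lambda>x. ennreal (D x))) ?B"
      by (simp add: D_B Q.emeasure_eq_measure)
  qed simp
  then show ?thesis
    by (auto simp: absolutely_continuousI_density)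
qed

text \<open>If the affinities are not summably close to 1, their products tend to 0, and the product
  bounds both \<open>P(\<Delta> \<ge> 1)\<close> and \<open>Q(\<Delta> < 1)\<close>. By Borel--Cantelli the two measures then live on
  disjoint sets.\<close>

lemma kakutani_summable:
  assumes pos: "\<And>i x. i \<in> I \<Longrightarrow> 0 < \<rho> i x"
    and ac: "absolutely_continuous (PiM I M) (PiM I N)"
  shows "summable (\<lambda>n. 1 - affinity (e n))"
proof (rule ccontr)
  assume ns: "\<not> summable (\<lambda>n. 1 - affinity (e n))"
  interpret P: prob_space "PiM I M" by (intro prob_space_PiM prob)
  interpret Q: prob_space "PiM I N" by (intro prob_space_PiM prob_N)
  have aff: "0 \<le> affinity (e k) \<and> affinity (e k) \<le> 1" for k
    using affinity_bounds e by (auto simp: bij_betw_def)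
  have small: "\<exists>n. (\<Prod>i<n. affinity (e i)) \<le> (1/2) ^ k" for k :: nat
  proof -
    have "\<exists>n. real k < (\<Sum>i<n. 1 - affinity (e i))"
    proof (rule ccontr)
      assume "\<nexists>n. real k < (\<Sum>i<n. 1 - affinity (e i))"
      then have "summable (\<lambda>n. 1 - affinity (e n))"
        using aff by (intro summableI_nonneg_bounded[of _ "real k"]) (auto simp: not_less)
      with ns show False by simp
    qed
    then obtain n where n: "real k < (\<Sum>i<n. 1 - affinity (e i))" by blast
    have "(\<Prod>i<n. affinity (e i)) \<le> (\<Prod>i<n. exp (- (1 - affinity (e i))))"
    proof (intro prod_mono conjI)
      fix i show "affinity (e i) \<le> exp (- (1 - affinity (e i)))"
        using exp_ge_add_one_self[of "- (1 - affinity (e i))"] by simp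
    qed (use aff in auto)
    also have "\<dots> = exp (- (\<Sum>i<n. 1 - affinity (e i)))"
      by (simp only: exp_sum[OF finite_lessThan, symmetric] sum_negf)
    also have "\<dots> \<le> exp (- real k)" using n by simp
    also have "\<dots> = exp (- 1) ^ k" by (simp add: exp_of_nat_mult[symmetric])
    also have "\<dots> \<le> (1/2) ^ k"
    proof (rule power_mono)
      have "2 \<le> exp (1::real)" using exp_ge_add_one_self[of 1] by simp
      then show "exp (- 1) \<le> (1/2 :: real)" by (simp add: exp_minus field_simps)
    qed simp
    finally show ?thesis by blast
  qed
  then obtain n where n: "\<And>k. (\<Prod>i<n k. affinity (e i)) \<le> (1/2) ^ k" by metis
  have geom: "summable (\<lambda>k. (1/2 :: real) ^ k)" by (rule summable_geometric) simp
  define E where "E k = {x \<in> space (PiM I M). 1 \<le> \<Delta> (n k) x}" for k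
  have E_sets[measurable]: "E k \<in> sets (PiM I M)" for k unfolding E_def by measurable
  have sp: "space (PiM I N) = space (PiM I M)"
    by (rule sets_eq_imp_space_eq[OF sets_PiM_N])
  have \<Delta>_pos: "0 < \<Delta> m x" for m x
    unfolding \<Delta>_def using J pos by (intro prod_pos) auto
  have PE: "P.prob (E k) \<le> (1/2) ^ k" for k
  proof -
    have "emeasure (PiM I M) (E k) = (\<integral>\<^sup>+x. indicator (E k) x \<partial>PiM I M)" by simp
    also have "\<dots> \<le> (\<integral>\<^sup>+x. ennreal (\<Delta> (n k) x) \<partial>PiM I M)"
      by (intro nn_integral_mono) (auto simp: E_def indicator_def)
    also have "\<dots> \<le> ennreal ((1/2) ^ k)"
      unfolding nn_integral_\<Delta> by (intro ennreal_leI n)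
    finally show ?thesis by (simp add: P.emeasure_eq_measure)
  qed
  have QE: "Q.prob (space (PiM I N) - E k) \<le> (1/2) ^ k" for k
  proof -
    have [measurable]: "E k \<in> sets (PiM I N)" unfolding sets_PiM_N by (rule E_sets)
    have "emeasure (PiM I N) (space (PiM I N) - E k) = (\<integral>\<^sup>+x. indicator (space (PiM I N) - E k) x \<partial>PiM I N)" by simp
    also have "\<dots> \<le> (\<integral>\<^sup>+x. (\<Prod>i\<in>J (n k). ennreal (inverse (\<rho> i (x i)))) \<partial>PiM I N)"
    proof (intro nn_integral_mono)
      fix x
      have "(\<Prod>i\<in>J (n k). ennreal (inverse (\<rho> i (x i)))) = ennreal (inverse (\<Delta> (n k) x))"
        unfolding \<Delta>_def using J pos prod_inversef[of "\<lambda>i. \<rho> i (x i)" "J (n k)"]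
        by (subst prod_ennreal) (auto simp: comp_def less_imp_le)
      moreover have "1 \<le> ennreal (inverse (\<Delta> (n k) x))" if "\<Delta> (n k) x < 1"
        using that \<Delta>_pos[of "n k" x] by (simp add: one_le_inverse)
      ultimately show "indicator (space (PiM I N) - E k) x \<le> (\<Prod>i\<in>J (n k). ennreal (inverse (\<rho> i (x i))))"
        by (auto simp: indicator_def E_def sp)
    qed
    also have "\<dots> = (\<Prod>i\<in>J (n k). \<integral>\<^sup>+y. ennreal (inverse (\<rho> i y)) \<partial>N i)"
      using J \<rho>_meas by (intro nn_integral_PiM_prod prob_N) (auto simp: N_def)
    also have "\<dots> = (\<Prod>i\<in>J (n k). \<integral>\<^sup>+y. ennreal (\<rho> i y) \<partial>M i)"
    proof (rule prod.cong[OF refl])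
      fix i assume "i \<in> J (n k)"
      then have i: "i \<in> I" using J by auto
      note [measurable] = \<rho>_meas[OF i]
      have "(\<integral>\<^sup>+y. ennreal (inverse (\<rho> i y)) \<partial>N i) = (\<integral>\<^sup>+y. ennreal ((\<rho> i y)\<^sup>2) * ennreal (inverse (\<rho> i y)) \<partial>M i)"
        unfolding N_def by (rule nn_integral_density) auto
      also have "\<dots> = (\<integral>\<^sup>+y. ennreal (\<rho> i y) \<partial>M i)"
        using pos[OF i] by (intro nn_integral_cong)
          (simp add: ennreal_mult[symmetric] less_imp_le power2_eq_square less_imp_neq[THEN not_sym])
      finally show "(\<integral>\<^sup>+y. ennreal (inverse (\<rho> i y)) \<partial>N i) = (\<integral>\<^sup>+y. ennreal (\<rho> i y) \<partial>M i)" .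
    qed
    also have "\<dots> = (\<integral>\<^sup>+x. (\<Prod>i\<in>J (n k). ennreal (\<rho> i (x i))) \<partial>PiM I M)"
      using J \<rho>_meas by (intro nn_integral_PiM_prod[symmetric] prob) auto
    also have "\<dots> = (\<integral>\<^sup>+x. ennreal (\<Delta> (n k) x) \<partial>PiM I M)"
      unfolding \<Delta>_def using J \<rho>_nonneg by (intro nn_integral_cong prod_ennreal) auto
    also have "\<dots> \<le> ennreal ((1/2) ^ k)"
      unfolding nn_integral_\<Delta> by (intro ennreal_leI n)
    finally show ?thesis by (simp add: Q.emeasure_eq_measure)
  qed
  have "AE x in PiM I M. eventually (\<lambda>k. x \<in> space (PiM I M) - E k) sequentially"
    using PE by (intro borel_cantelli_AE1 summable_comparison_test'[OF geom, of 0])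
      (auto simp: P.emeasure_eq_measure)
  then have 1: "AE x in PiM I N. eventually (\<lambda>k. x \<in> space (PiM I M) - E k) sequentially"
    by (rule absolutely_continuous_AE[OF sets_PiM_N ac])
  have 2: "AE x in PiM I N. eventually (\<lambda>k. x \<in> space (PiM I N) - (space (PiM I N) - E k)) sequentially"
    using QE E_sets sets_PiM_N by (intro borel_cantelli_AE1 summable_comparison_test'[OF geom, of 0])
      (auto simp: Q.emeasure_eq_measure)
  have "AE x in PiM I N. False"
    using 1 2
  proof eventually_elim
    fix x
    assume "eventually (\<lambda>k. x \<in> space (PiM I M) - E k) sequentially"
      "eventually (\<lambda>k. x \<in> space (PiM I N) - (space (PiM I N) - E k)) sequentially"
    then have "eventually (\<lambda>k :: nat. False) sequentially"
      by eventually_elim auto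
    then show False by simp
  qed
  then show False by simp
qed

end

section \<open>Bernoulli actions as measurable actions\<close>

lemma group_action_restrictI:
  fixes G (structure)
  assumes G: "group G"
    and closed: "\<And>g x. g \<in> carrier G \<Longrightarrow> x \<in> V \<Longrightarrow> a g x \<in> V"
    and one: "\<And>x. x \<in> V \<Longrightarrow> a \<one> x = x"
    and mult: "\<And>g h x. g \<in> carrier G \<Longrightarrow> h \<in> carrier G \<Longrightarrow> x \<in> V \<Longrightarrow> a (g \<otimes> h) x = a g (a h x)"
  shows "group_action G V (\<lambda>g. restrict (a g) V)"
proof -
  interpret group G by fact
  have bij: "restrict (a g) V \<in> Bij V" if g: "g \<in> carrier G" for g
  proof -
    have "bij_betw (a g) V V"
    proof (rule bij_betw_byWitness[of _ "a (inv g)"])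
      show "\<forall>x\<in>V. a (inv g) (a g x) = x"
        using g one by (auto simp: mult[symmetric])
      show "\<forall>x\<in>V. a g (a (inv g) x) = x"
        using g one by (auto simp: mult[symmetric])
    qed (use closed g in auto)
    then show ?thesis by (simp add: Bij_def bij_betw_restrict_eq)
  qed
  show ?thesis
    unfolding group_action_def group_hom_def group_hom_axioms_def
  proof (intro conjI G group_BijGroup homI)
    fix g assume "g \<in> carrier G" then show "restrict (a g) V \<in> carrier (BijGroup V)"
      using bij by (simp add: BijGroup_def)
  next
    fix g h assume gh: "g \<in> carrier G" "h \<in> carrier G"
    then show "restrict (a (g \<otimes> h)) V = restrict (a g) V \<otimes>\<^bsub>BijGroup V\<^esub> restrict (a h) V"
      using bij closed mult by (auto simp: BijGroup_def compose_def fun_eq_iff)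
  qed
qed

lemma measurable_actionD:
  fixes G (structure)
  assumes "group G" and "measurable_action G M a"
  shows "g \<in> carrier G \<Longrightarrow> x \<in> space M \<Longrightarrow> a g x \<in> space M"
    and "x \<in> space M \<Longrightarrow> a \<one> x = x"
    and "g \<in> carrier G \<Longrightarrow> h \<in> carrier G \<Longrightarrow> x \<in> space M \<Longrightarrow> a (g \<otimes> h) x = a g (a h x)"
    and "g \<in> carrier G \<Longrightarrow> a g \<in> M \<rightarrow>\<^sub>M M"
proof -
  interpret group G by fact
  interpret A: group_action G "space M" "\<lambda>g. restrict (a g) (space M)"
    using assms(2) by (simp add: measurable_action_def)
  show meas: "a g \<in> M \<rightarrow>\<^sub>M M" if "g \<in> carrier G" for g
    using assms(2) that by (simp add: measurable_action_def)
  show closed: "a g x \<in> space M" if "g \<in> carrier G" "x \<in> space M" for g x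
    using measurable_space[OF meas] that by blast
  show "a \<one> x = x" if "x \<in> space M" for x
    using fun_cong[OF A.id_eq_one, of x] that by simp
  show "a (g \<otimes> h) x = a g (a h x)" if "g \<in> carrier G" "h \<in> carrier G" "x \<in> space M" for g h x
    using A.composition_rule[OF that(3,1,2)] that closed by simp
qed

lemma nonsingular_action_restrict_space:
  fixes G (structure)
  assumes G: "group G" and ns: "nonsingular_action G M a" and V: "V \<in> sets M"
    and inv: "\<And>g x. g \<in> carrier G \<Longrightarrow> x \<in> V \<Longrightarrow> a g x \<in> V"
  shows "nonsingular_action G (restrict_space M V) a"
proof -
  interpret group G by fact
  have ma: "measurable_action G M a" using ns by (simp add: nonsingular_action_def)
  note act = measurable_actionD[OF G ma]
  have VM: "V \<subseteq> space M" using V by (rule sets.sets_into_space)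
  then have sp: "space (restrict_space M V) = V" by (auto simp: space_restrict_space)
  have meas: "a g \<in> restrict_space M V \<rightarrow>\<^sub>M restrict_space M V" if "g \<in> carrier G" for g
    using act(4)[OF that] inv that
    by (intro measurable_restrict_space2 measurable_restrict_space1) (auto simp: sp)
  have "measurable_action G (restrict_space M V) a"
    unfolding measurable_action_def sp
    using meas inv VM act by (intro conjI group_action_restrictI G) auto
  moreover have "measure_equiv (distr (restrict_space M V) (restrict_space M V) (a g)) (restrict_space M V)"
    if g: "g \<in> carrier G" for g
  proof -
    have null: "null_sets (distr M M (a g)) = null_sets M"
      using ns g by (simp add: nonsingular_action_def measure_equiv_def)
    have pre: "a g -` A \<inter> V = a g -` A \<inter> space M" if "A \<subseteq> V" for A
    proof
      show "a g -` A \<inter> space M \<subseteq> a g -` A \<inter> V"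
      proof
        fix x assume x: "x \<in> a g -` A \<inter> space M"
        then have "a (inv g) (a g x) \<in> V" using that g x by (intro inv[of "inv g" "a g x"]) auto
        moreover have "a (inv g) (a g x) = x"
          using act(3)[of "inv g" g x] act(2)[of x] x g by simp
        ultimately have "x \<in> V" by simp
        then show "x \<in> a g -` A \<inter> V" using x by auto
      qed
    qed (use VM in auto)
    have "A \<in> null_sets (distr (restrict_space M V) (restrict_space M V) (a g)) \<longleftrightarrow>
        A \<in> null_sets (restrict_space M V)" for A
    proof -
    have "A \<in> null_sets (distr (restrict_space M V) (restrict_space M V) (a g)) \<longleftrightarrow>
        A \<in> sets (restrict_space M V) \<and> a g -` A \<inter> V \<in> null_sets M"
      using V meas[OF g] by (auto simp: null_sets_distr_iff null_sets_restrict_space sp)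
    also have "\<dots> \<longleftrightarrow> A \<subseteq> V \<and> A \<in> sets M \<and> a g -` A \<inter> space M \<in> null_sets M"
      using V pre by (auto simp: sets_restrict_space_iff)
    also have "\<dots> \<longleftrightarrow> A \<subseteq> V \<and> A \<in> null_sets (distr M M (a g))"
      using act(4)[OF g] by (auto simp: null_sets_distr_iff)
    also have "\<dots> \<longleftrightarrow> A \<in> null_sets (restrict_space M V)"
      using V by (simp add: null null_sets_restrict_space)
    finally show ?thesis .
    qed
    then show ?thesis unfolding measure_equiv_def by auto
  qed
  ultimately show ?thesis by (simp add: nonsingular_action_def)
qed

lemma bernoulli_in_PiE:
  assumes "group G" "g \<in> carrier G" "x \<in> carrier G \<rightarrow>\<^sub>E S"
  shows "bernoulli G g x \<in> carrier G \<rightarrow>\<^sub>E S"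
proof -
  interpret group G by fact
  show ?thesis using assms(2,3) by (auto simp: bernoulli_def PiE_iff)
qed

lemma bernoulli_one:
  fixes G (structure)
  assumes "group G" "x \<in> extensional (carrier G)"
  shows "bernoulli G \<one> x = x"
proof -
  interpret group G by fact
  show ?thesis using assms(2) by (auto simp: bernoulli_def fun_eq_iff extensional_def)
qed

lemma bernoulli_mult:
  fixes G (structure)
  assumes "group G" "g \<in> carrier G" "h \<in> carrier G"
  shows "bernoulli G (g \<otimes> h) x = bernoulli G g (bernoulli G h x)"
proof -
  interpret group G by fact
  show ?thesis using assms(2,3) by (auto simp: bernoulli_def fun_eq_iff inv_mult_group m_assoc)
qed

lemma measurable_bernoulli:
  fixes G (structure)
  assumes "group G" "g \<in> carrier G" and sets: "\<And>h. h \<in> carrier G \<Longrightarrow> sets (M h) = sets X"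
  shows "bernoulli G g \<in> PiM (carrier G) M \<rightarrow>\<^sub>M PiM (carrier G) M"
proof -
  interpret group G by fact
  have "(\<lambda>x. x (inv g \<otimes> h)) \<in> PiM (carrier G) M \<rightarrow>\<^sub>M M h" if "h \<in> carrier G" for h
  proof -
    have "(\<lambda>x. x (inv g \<otimes> h)) \<in> PiM (carrier G) M \<rightarrow>\<^sub>M M (inv g \<otimes> h)"
      using assms(2) that by (intro measurable_component_singleton) auto
    moreover have "sets (M (inv g \<otimes> h)) = sets (M h)"
      using assms(2) that by (simp add: sets)
    ultimately show ?thesis using measurable_cong_sets[OF refl] by blast
  qed
  then show ?thesis
    unfolding bernoulli_def by (rule measurable_restrict)
qed

lemma distr_bernoulli:
  fixes G (structure)
  assumes "group G" "g \<in> carrier G" and sets: "\<And>h. h \<in> carrier G \<Longrightarrow> sets (M h) = sets X"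
    and prob: "\<And>h. h \<in> carrier G \<Longrightarrow> prob_space (M h)"
  shows "distr (PiM (carrier G) M) (PiM (carrier G) M) (bernoulli G g)
    = PiM (carrier G) (\<lambda>h. M (inv g \<otimes> h))"
proof -
  interpret group G by fact
  have "distr (PiM (carrier G) M) (PiM (carrier G) M) (bernoulli G g) =
    distr (PiM (carrier G) M) (PiM (carrier G) (\<lambda>h. M (inv g \<otimes> h))) (\<lambda>x. \<lambda>h\<in>carrier G. x (inv g \<otimes> h))"
    using assms(2) by (intro distr_cong sets_PiM_cong) (auto simp: sets bernoulli_def)
  also have "\<dots> = PiM (carrier G) (\<lambda>h. M (inv g \<otimes> h))"
    using assms(2) by (intro distr_PiM_reindex prob) (auto intro!: inj_onI)
  finally show ?thesis .
qed

lemma measurable_action_bernoulli: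
  assumes "group G" and sets: "\<And>h. h \<in> carrier G \<Longrightarrow> sets (M h) = sets X"
  shows "measurable_action G (PiM (carrier G) M) (bernoulli G)"
proof -
  have "space (PiM (carrier G) M) = (carrier G \<rightarrow>\<^sub>E space X)"
    using sets_eq_imp_space_eq[OF sets] by (auto simp: space_PiM PiE_iff)
  then show ?thesis
    unfolding measurable_action_def using measurable_bernoulli[OF assms(1) _ sets]
    by (intro conjI ballI group_action_restrictI)
      (auto simp: assms(1) bernoulli_mult PiE_iff intro!: bernoulli_one intro: bernoulli_in_PiE[OF assms(1), unfolded PiE_iff, THEN conjunct1, THEN bspec] bernoulli_in_PiE[OF assms(1), unfolded PiE_iff, THEN conjunct2])
qed

lemma pmp_action_bernoulli:
  assumes "group G" and "prob_space \<nu>"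
  shows "pmp_action G (PiM (carrier G) (\<lambda>_. \<nu>)) (bernoulli G)"
  unfolding pmp_action_def
  using measurable_action_bernoulli[OF assms(1) refl] assms
  by (auto intro!: prob_space_PiM simp: distr_bernoulli[OF assms(1) _ refl])

section \<open>Independence of far translates: ergodicity and freeness\<close>

text \<open>The variance of \<open>\<Sum>i<n. 1\<^bsub>E i\<^esub>\<close> is at most \<open>n\<close>, whereas a correlation of size \<open>\<delta>\<close> of \<open>A\<close> with
  every \<open>E i\<close> would force it to be at least \<open>(n \<delta>)\<^sup>2\<close>.\<close>

lemma (in prob_space) pairwise_indep_decorrelation:
  fixes E :: "nat \<Rightarrow> 'a set"
  assumes A[measurable]: "A \<in> events" and E[measurable]: "\<And>i. E i \<in> events"
    and indep: "\<And>i j. i \<noteq> j \<Longrightarrow> prob (E i \<inter> E j) = prob (E i) * prob (E j)"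
    and \<delta>: "\<And>i. \<delta> \<le> prob A * prob (E i) - prob (A \<inter> E i)"
  shows "\<delta> \<le> 0"
proof (rule ccontr)
  assume "\<not> \<delta> \<le> 0" then have \<delta>0: "0 < \<delta>" by simp
  define Z where "Z i x = prob (E i) - indicator (E i) x" for i x
  have Z_meas[measurable]: "Z i \<in> borel_measurable M" for i
    unfolding Z_def by measurable
  have int_ind[simp]: "integrable M (indicator B :: 'a \<Rightarrow> real)" if "B \<in> events" for B
    using that by (simp add: integrable_indicator_iff less_top[symmetric])
  have ZZ: "Z i x * Z j x = prob (E i) * prob (E j) - prob (E i) * indicator (E j) x
      - prob (E j) * indicator (E i) x + indicator (E i \<inter> E j) x" for i j x
    by (simp add: Z_def algebra_simps indicator_inter_arith)
  have ZZ_int: "integrable M (\<lambda>x. Z i x * Z j x)" for i j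
    unfolding ZZ by simp
  have ZZ_eq: "(\<integral>x. Z i x * Z j x \<partial>M) = prob (E i \<inter> E j) - prob (E i) * prob (E j)" for i j
    unfolding ZZ by (simp add: prob_space)
  have ZA_int: "integrable M (\<lambda>x. indicator A x * Z i x)" for i
  proof -
    have "indicator A x * Z i x = prob (E i) * indicator A x - indicator (A \<inter> E i) x" for x
      by (simp add: Z_def algebra_simps indicator_inter_arith)
    then show ?thesis by simp
  qed
  have ZA: "\<delta> \<le> (\<integral>x. indicator A x * Z i x \<partial>M)" for i
  proof -
    have "(\<integral>x. indicator A x * Z i x \<partial>M) = (\<integral>x. prob (E i) * indicator A x - indicator (A \<inter> E i) x \<partial>M)"
      by (simp add: Z_def algebra_simps indicator_inter_arith)
    also have "\<dots> = prob A * prob (E i) - prob (A \<inter> E i)"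
      by simp
    finally show ?thesis using \<delta>[of i] by simp
  qed
  have bound: "(real n * \<delta>)\<^sup>2 \<le> real n" for n
  proof -
    define s where "s x = (\<Sum>i<n. Z i x)" for x
    define c where "c = real n * \<delta>"
    have c0: "0 \<le> c" using \<delta>0 by (simp add: c_def)
    have s2: "(s x)\<^sup>2 = (\<Sum>i<n. \<Sum>j<n. Z i x * Z j x)" for x
      by (simp add: s_def power2_eq_square sum_product)
    have s2_int: "integrable M (\<lambda>x. (s x)\<^sup>2)"
      unfolding s2 using ZZ_int by simp
    have "(\<integral>x. (s x)\<^sup>2 \<partial>M) = (\<Sum>i<n. \<Sum>j<n. prob (E i \<inter> E j) - prob (E i) * prob (E j))"
      unfolding s2 using ZZ_int by (simp add: ZZ_eq)
    also have "\<dots> \<le> (\<Sum>i<n. \<Sum>j<n. if i = j then 1 else 0)"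
    proof (intro sum_mono)
      fix i j
      show "prob (E i \<inter> E j) - prob (E i) * prob (E j) \<le> (if i = j then 1 else 0)"
      proof (cases "i = j")
        case True
        have "0 \<le> prob (E j) * prob (E j)" by simp
        then have "prob (E j) - prob (E j) * prob (E j) \<le> 1"
          using prob_le_1[of "E j"] by linarith
        then show ?thesis using True by simp
      qed (simp add: indep)
    qed
    also have "\<dots> = real n" by simp
    finally have s2_le: "(\<integral>x. (s x)\<^sup>2 \<partial>M) \<le> real n" .
    have As_int: "integrable M (\<lambda>x. indicator A x * s x)"
      unfolding s_def sum_distrib_left by (intro Bochner_Integration.integrable_sum ZA_int)
    have "c \<le> (\<Sum>i<n. (\<integral>x. indicator A x * Z i x \<partial>M))"
      using sum_mono[of "{..<n}" "\<lambda>_. \<delta>"] ZA by (simp add: c_def)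
    also have "\<dots> = (\<integral>x. indicator A x * s x \<partial>M)"
      unfolding s_def sum_distrib_left by (intro Bochner_Integration.integral_sum[symmetric] ZA_int)
    finally have "c * (2 * c) \<le> (\<integral>x. indicator A x * s x \<partial>M) * (2 * c)"
      using c0 by (intro mult_right_mono) auto
    also have "\<dots> = (\<integral>x. indicator A x * s x * (2 * c) \<partial>M)"
      by simp
    \<comment> \<open>Young's inequality; as \<open>c = n \<delta>\<close>, the left-hand side is at least \<open>2 c\<^sup>2\<close> and absorbs \<open>c\<^sup>2\<close>.\<close>
    also have "\<dots> \<le> (\<integral>x. (s x)\<^sup>2 + c\<^sup>2 \<partial>M)"
    proof (rule integral_mono)
      fix x
      show "indicator A x * s x * (2 * c) \<le> (s x)\<^sup>2 + c\<^sup>2"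
        using sum_squares_bound[of "s x" c] by (auto simp: indicator_def ac_simps)
    qed (use As_int s2_int in auto)
    also have "\<dots> \<le> real n + c\<^sup>2"
      using s2_int s2_le by (simp add: prob_space)
    finally have "c\<^sup>2 \<le> real n" by (simp add: power2_eq_square)
    then show ?thesis by (simp only: c_def)
  qed
  obtain n :: nat where n: "1 / \<delta>\<^sup>2 < real n" using reals_Archimedean2 by blast
  have "0 < 1 / \<delta>\<^sup>2" using \<delta>0 by simp
  then have n0: "0 < real n" using n by linarith
  have "real n * (real n * \<delta>\<^sup>2) \<le> real n * 1"
    using bound[of n] by (simp add: power2_eq_square ac_simps)
  then have "real n * \<delta>\<^sup>2 \<le> 1" using n0 by simp
  then show False using n \<delta>0 by (simp add: divide_less_eq)
qed

lemma prob_rectangles_disjoint_coordinates: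
  assumes prob: "\<And>i. i \<in> I \<Longrightarrow> prob_space (M i)"
    and J: "finite J" "J \<subseteq> I" and K: "finite K" "K \<subseteq> I" and JK: "J \<inter> K = {}"
    and E: "\<And>i. i \<in> J \<Longrightarrow> E i \<in> sets (M i)" and F: "\<And>i. i \<in> K \<Longrightarrow> F i \<in> sets (M i)"
  shows "measure (PiM I M) (prod_emb I M J (Pi\<^sub>E J E) \<inter> prod_emb I M K (Pi\<^sub>E K F)) =
    measure (PiM I M) (prod_emb I M J (Pi\<^sub>E J E)) * measure (PiM I M) (prod_emb I M K (Pi\<^sub>E K F))"
proof -
  let ?H = "\<lambda>i. if i \<in> J then E i else F i"
  have "prod_emb I M J (Pi\<^sub>E J E) \<inter> prod_emb I M K (Pi\<^sub>E K F) = prod_emb I M (J \<union> K) (Pi\<^sub>E (J \<union> K) ?H)"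
  proof -
    have "(\<forall>i\<in>J \<union> K. x i \<in> ?H i) \<longleftrightarrow> (\<forall>i\<in>J. x i \<in> E i) \<and> (\<forall>i\<in>K. x i \<in> F i)" for x
      using JK by (simp add: ball_Un) (metis disjoint_iff)
    then show ?thesis
      by (auto simp: prod_emb_def PiE_iff simp del: ball_Un)
  qed
  then have "emeasure (PiM I M) (prod_emb I M J (Pi\<^sub>E J E) \<inter> prod_emb I M K (Pi\<^sub>E K F)) =
      (\<Prod>i\<in>J \<union> K. emeasure (M i) (?H i))"
    using J K E F by (simp only:) (intro emeasure_PiM_emb prob, auto)
  also have "\<dots> = (\<Prod>i\<in>J. emeasure (M i) (E i)) * (\<Prod>i\<in>K. emeasure (M i) (F i))"
    using J K JK by (subst prod.union_disjoint) (auto intro!: arg_cong2[where f="(*)"] prod.cong)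
  also have "\<dots> = emeasure (PiM I M) (prod_emb I M J (Pi\<^sub>E J E)) * emeasure (PiM I M) (prod_emb I M K (Pi\<^sub>E K F))"
    using J K E F by (simp add: emeasure_PiM_emb[OF prob])
  finally show ?thesis
    by (simp add: measure_def enn2real_mult)
qed

lemma disjoint_finite_sets_sequence:
  fixes C :: "'c set" and \<phi> :: "'c \<Rightarrow> 'd set"
  assumes step: "\<And>K. finite K \<Longrightarrow> \<exists>g\<in>C. \<phi> g \<inter> K = {}" and fin: "\<And>g. g \<in> C \<Longrightarrow> finite (\<phi> g)"
  shows "\<exists>s :: nat \<Rightarrow> 'c. (\<forall>n. s n \<in> C) \<and> (\<forall>m n. m \<noteq> n \<longrightarrow> \<phi> (s m) \<inter> \<phi> (s n) = {})"
proof -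
  define P where "P p \<longleftrightarrow> fst p \<in> C \<and> finite (snd p) \<and> \<phi> (fst p) \<subseteq> snd p"
    for p :: "'c \<times> 'd set"
  define R where "R p q \<longleftrightarrow> \<phi> (fst q) \<inter> snd p = {} \<and> snd p \<subseteq> snd q"
    for p q :: "'c \<times> 'd set"
  have 1: "\<exists>p. P p"
  proof -
    obtain g where "g \<in> C" using step[of "{}"] by auto
    then show ?thesis using fin by (auto simp: P_def intro!: exI[of _ "(g, \<phi> g)"])
  qed
  have 2: "\<exists>q. P q \<and> R p q" if p: "P p" for p
  proof -
    obtain g where g: "g \<in> C" "\<phi> g \<inter> snd p = {}" using step[of "snd p"] p by (auto simp: P_def)
    then show ?thesis using fin p
      by (intro exI[of _ "(g, snd p \<union> \<phi> g)"]) (auto simp: P_def R_def)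
  qed
  obtain t where t: "\<And>n. P (t n)" "\<And>n. R (t n) (t (Suc n))"
    using dependent_nat_choice[of "\<lambda>_. P" "\<lambda>_. R"] 1 2 by auto
  have mono: "snd (t m) \<subseteq> snd (t n)" if "m \<le> n" for m n
    using that by (rule lift_Suc_mono_le[of "\<lambda>n. snd (t n)", rotated]) (use t(2) in \<open>auto simp: R_def\<close>)
  have less: "\<phi> (fst (t m)) \<inter> \<phi> (fst (t n)) = {}" if mn: "m < n" for m n
  proof -
    obtain k where k: "n = Suc k" "m \<le> k" using mn by (cases n) auto
    then show ?thesis
      using t(1)[of m] t(2)[of k] mono[of m k] by (auto simp: P_def R_def)
  qed
  have "\<phi> (fst (t m)) \<inter> \<phi> (fst (t n)) = {}" if "m \<noteq> n" for m n
    using that less[of m n] less[of n m] by (cases m n rule: linorder_cases) auto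
  then show ?thesis
    using t(1) by (intro exI[of _ "\<lambda>n. fst (t n)"]) (auto simp: P_def)
qed

lemma exists_translate_disjoint:
  fixes G (structure)
  assumes "group G" "infinite (carrier G)" "finite J" "J \<subseteq> carrier G" "finite K"
  shows "\<exists>g\<in>carrier G. (\<lambda>j. g \<otimes> j) ` J \<inter> K = {}"
proof -
  interpret group G by fact
  let ?B = "(\<lambda>(k, j). k \<otimes> inv j) ` (K \<times> J)"
  have "finite ?B" using assms by simp
  then obtain g where g: "g \<in> carrier G" "g \<notin> ?B"
    using assms(2) by (meson finite_subset subsetI)
  have "g \<otimes> j \<notin> K" if j: "j \<in> J" for j
  proof
    assume "g \<otimes> j \<in> K"
    moreover have "g = (g \<otimes> j) \<otimes> inv j"
      using g j assms(4) by (auto simp: m_assoc)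
    ultimately show False using g j by (auto intro: image_eqI[of _ _ "(g \<otimes> j, j)"])
  qed
  then show ?thesis using g by auto
qed

text \<open>Infinitely many translates of a rectangle depend on disjoint coordinates and are pairwise
  independent, while an invariant set has the same correlation with each of them. So an
  invariant set is independent of every rectangle, hence of itself.\<close>

lemma ergodic_action_bernoulli:
  fixes G (structure)
  assumes G: "group G" and iG: "infinite (carrier G)" and \<nu>: "prob_space \<nu>"
  shows "ergodic_action G (PiM (carrier G) (\<lambda>_. \<nu>)) (bernoulli G)"
  unfolding ergodic_action_def
proof (intro conjI ballI impI)
  interpret group G by fact
  let ?I = "carrier G" and ?M = "\<lambda>_ :: 'a. \<nu>"
  let ?P = "PiM ?I ?M"
  interpret P: prob_space ?P by (intro prob_space_PiM \<nu>)
  have pmp: "pmp_action G ?P (bernoulli G)" by (rule pmp_action_bernoulli[OF G \<nu>])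
  then show "nonsingular_action G ?P (bernoulli G)"
    by (auto simp: pmp_action_def nonsingular_action_def measure_equiv_def)
  have meas[measurable]: "bernoulli G g \<in> ?P \<rightarrow>\<^sub>M ?P" if "g \<in> ?I" for g
    using measurable_bernoulli[OF G that refl] .
  have pres: "P.prob (bernoulli G g -` B \<inter> space ?P) = P.prob B" if "g \<in> ?I" "B \<in> sets ?P" for g B
  proof -
    have "measure (distr ?P ?P (bernoulli G g)) B = P.prob (bernoulli G g -` B \<inter> space ?P)"
      by (rule measure_distr[OF meas[OF that(1)] that(2)])
    then show ?thesis using pmp that by (simp add: pmp_action_def)
  qed
  fix A assume A: "A \<in> sets ?P" and A_inv: "\<forall>g\<in>?I. bernoulli G g ` A = A"
  have A_sp: "A \<subseteq> space ?P" using A by (rule sets.sets_into_space)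
  have cancel: "bernoulli G g (bernoulli G (inv g) x) = x" if "g \<in> ?I" "x \<in> space ?P" for g x
    using that bernoulli_one[OF G, of x]
    by (simp add: bernoulli_mult[OF G, symmetric] space_PiM PiE_iff)
  have A_iff: "bernoulli G g x \<in> A \<longleftrightarrow> x \<in> A" if g: "g \<in> ?I" and x: "x \<in> space ?P" for g x
  proof
    assume "bernoulli G g x \<in> A"
    then have "bernoulli G (inv g) (bernoulli G g x) \<in> A" using A_inv g by blast
    then show "x \<in> A" using cancel[of "inv g" x] g x by simp
  qed (use A_inv g in blast)
  have rect: "P.prob (A \<inter> B) = P.prob A * P.prob B"
    if J: "finite J" "J \<subseteq> ?I" and E: "\<And>j. j \<in> J \<Longrightarrow> E j \<in> sets \<nu>"
      and B: "B = prod_emb ?I ?M J (Pi\<^sub>E J E)" for J E B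
  proof -
    have B_sets[measurable]: "B \<in> sets ?P"
      unfolding B using J E by (intro sets_PiM_I) auto
    obtain s :: "nat \<Rightarrow> 'a" where s: "\<And>n. s n \<in> ?I"
      and disj: "\<And>m n. m \<noteq> n \<Longrightarrow> (\<lambda>j. s m \<otimes> j) ` J \<inter> (\<lambda>j. s n \<otimes> j) ` J = {}"
      using disjoint_finite_sets_sequence[of ?I "\<lambda>g. (\<lambda>j. g \<otimes> j) ` J"]
        exists_translate_disjoint[OF G iG J] J(1) by (metis finite_imageI)
    define T where "T n = bernoulli G (inv (s n)) -` B \<inter> space ?P" for n
    have T_sets: "T n \<in> sets ?P" for n
      unfolding T_def using s by (intro measurable_sets[OF meas]) auto
    have T_rect: "T n = prod_emb ?I ?M ((\<lambda>j. s n \<otimes> j) ` J)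
        (Pi\<^sub>E ((\<lambda>j. s n \<otimes> j) ` J) (\<lambda>k. E (inv (s n) \<otimes> k)))" (is "_ = ?R") for n
    proof -
      have J': "j \<in> ?I" if "j \<in> J" for j using J that by auto
      have 1: "inv (s n) \<otimes> (s n \<otimes> j) = j" if "j \<in> J" for j
        using s[of n] J'[OF that] by (simp add: m_assoc[symmetric])
      have "x \<in> T n \<longleftrightarrow> x \<in> space ?P \<and> (\<forall>j\<in>J. x (s n \<otimes> j) \<in> E j)" for x
        using J' s[of n] bernoulli_in_PiE[OF G, of "inv (s n)" x "space \<nu>"]
        by (auto simp: T_def B prod_emb_def space_PiM PiE_iff bernoulli_def)
      moreover have "x \<in> ?R \<longleftrightarrow> x \<in> space ?P \<and> (\<forall>j\<in>J. x (s n \<otimes> j) \<in> E j)" for x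
        using 1 by (auto simp: prod_emb_def space_PiM PiE_iff)
      ultimately show ?thesis by blast
    qed
    have T_indep: "P.prob (T m \<inter> T n) = P.prob (T m) * P.prob (T n)" if "m \<noteq> n" for m n
    proof -
      have sub: "(\<lambda>j. s k \<otimes> j) ` J \<subseteq> ?I" for k using J s by auto
      have EE: "E (inv (s k) \<otimes> i) \<in> sets \<nu>" if "i \<in> (\<lambda>j. s k \<otimes> j) ` J" for k i
      proof -
        obtain j where j: "j \<in> J" "i = s k \<otimes> j" using \<open>i \<in> _\<close> by auto
        moreover have "j \<in> ?I" using j J by auto
        ultimately have "inv (s k) \<otimes> i = j"
          using s[of k] by (simp add: m_assoc[symmetric])
        then show ?thesis using E j by simp
      qed
      show ?thesis unfolding T_rect
        using J(1) by (intro prob_rectangles_disjoint_coordinates \<nu> sub disj[OF that] EE) auto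
    qed
    have PT: "P.prob (T n) = P.prob B" for n
      unfolding T_def using s by (intro pres) auto
    have PAT: "P.prob (A \<inter> T n) = P.prob (A \<inter> B)" for n
    proof -
      have "A \<inter> T n = bernoulli G (inv (s n)) -` (A \<inter> B) \<inter> space ?P"
        using A_sp A_iff[of "inv (s n)"] s[of n] by (auto simp: T_def)
      then show ?thesis
        using s A B_sets by (simp only:) (intro pres, auto)
    qed
    have PcT: "P.prob ((space ?P - A) \<inter> T n) = P.prob B - P.prob (A \<inter> B)" for n
    proof -
      have "(space ?P - A) \<inter> T n = T n - A \<inter> T n"
        using sets.sets_into_space[OF T_sets[of n]] by auto
      then show ?thesis
        using A T_sets by (simp add: P.finite_measure_Diff PT PAT)
    qed
    have "P.prob A * P.prob B - P.prob (A \<inter> B) \<le> 0"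
      by (rule P.pairwise_indep_decorrelation[OF A T_sets T_indep]) (auto simp: PT PAT)
    moreover have "P.prob (A \<inter> B) - P.prob A * P.prob B \<le> 0"
      using A by (intro P.pairwise_indep_decorrelation[OF _ T_sets T_indep, of "space ?P - A"])
        (auto simp: PT PcT P.prob_compl algebra_simps)
    ultimately show ?thesis by simp
  qed
  have "density ?P (indicator A) = density ?P (\<lambda>_. ennreal (P.prob A))"
  proof (rule measure_eqI_PiM_infinite[where I="?I" and M="?M"])
    fix E J assume JE: "finite J" "J \<subseteq> ?I" "\<And>i. i \<in> J \<Longrightarrow> E i \<in> sets \<nu>"
    let ?B = "prod_emb ?I ?M J (Pi\<^sub>E J E)"
    have B: "?B \<in> sets ?P" using JE by (intro sets_PiM_I) auto
    show "emeasure (density ?P (indicator A)) ?B = emeasure (density ?P (\<lambda>_. ennreal (P.prob A))) ?B"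
      using A B rect[OF JE refl]
      by (simp add: emeasure_density P.emeasure_eq_measure nn_integral_cmult ennreal_mult
          flip: indicator_inter_arith)
  next
    show "finite_measure (density ?P (indicator A))"
      using A by (intro finite_measureI) (simp add: emeasure_density P.emeasure_eq_measure flip: indicator_inter_arith)
  qed auto
  then have "emeasure (density ?P (indicator A)) A = emeasure (density ?P (\<lambda>_. ennreal (P.prob A))) A"
    by simp
  then have "ennreal (P.prob A) = ennreal (P.prob A * P.prob A)"
    using A by (simp add: emeasure_density P.emeasure_eq_measure nn_integral_cmult ennreal_mult
        flip: indicator_inter_arith)
  then have "P.prob A = P.prob A * P.prob A"
    by (subst (asm) ennreal_inj) auto
  then have "P.prob A = 0 \<or> P.prob A = 1" by auto
  then show "A \<in> null_sets ?P \<or> space ?P - A \<in> null_sets ?P"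
    using A P.prob_compl[OF A] by (auto simp: null_sets_def P.emeasure_eq_measure)
qed

text \<open>A fixed point \<open>x\<close> of \<open>g\<close> has \<open>x h = x (g\<^sup>-\<^sup>1 h)\<close> for all \<open>h\<close>, so it avoids every event
  \<open>x h \<in> D \<and> x (g\<^sup>-\<^sup>1 h) \<notin> D\<close>. Infinitely many of these are pairwise independent
  and have probability at least \<open>\<epsilon>\<^sup>2\<close>, so avoiding them all is a null event.\<close>

lemma bernoulli_AE_free:
  fixes G (structure)
  assumes G: "group G" and iG: "infinite (carrier G)"
    and sets: "\<And>h. h \<in> carrier G \<Longrightarrow> sets (M h) = sets X"
    and prob: "\<And>h. h \<in> carrier G \<Longrightarrow> prob_space (M h)"
    and D: "D \<in> sets X" and K: "finite K" and \<epsilon>: "0 < \<epsilon>"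
    and mid: "\<And>h. h \<in> carrier G - K \<Longrightarrow> \<epsilon> \<le> measure (M h) D \<and> measure (M h) D \<le> 1 - \<epsilon>"
    and g: "g \<in> carrier G" "g \<noteq> \<one>"
  shows "AE x in PiM (carrier G) M. bernoulli G g x \<noteq> x"
proof -
  interpret group G by fact
  let ?I = "carrier G"
  let ?P = "PiM ?I M"
  interpret P: prob_space ?P by (intro prob_space_PiM prob)
  define \<phi> where "\<phi> h = {h, inv g \<otimes> h}" for h
  have step: "\<exists>h\<in>{h \<in> ?I. \<phi> h \<inter> K = {}}. \<phi> h \<inter> L = {}" if L: "finite L" for L
  proof -
    have "finite ((K \<union> L) \<union> (\<lambda>k. g \<otimes> k) ` (K \<union> L))" using K L by simp
    then obtain h where h: "h \<in> ?I" "h \<notin> (K \<union> L) \<union> (\<lambda>k. g \<otimes> k) ` (K \<union> L)"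
      using iG by (meson finite_subset subsetI)
    have "g \<otimes> (inv g \<otimes> h) = h" using g h by (simp add: m_assoc[symmetric])
    then have "inv g \<otimes> h \<notin> K \<union> L" using h(2) by (metis UnCI imageI)
    then show ?thesis using h by (auto simp: \<phi>_def)
  qed
  obtain s :: "nat \<Rightarrow> 'a" where s: "\<And>n. s n \<in> ?I" "\<And>n. \<phi> (s n) \<inter> K = {}"
    and disj: "\<And>m n. m \<noteq> n \<Longrightarrow> \<phi> (s m) \<inter> \<phi> (s n) = {}"
    using disjoint_finite_sets_sequence[of "{h \<in> ?I. \<phi> h \<inter> K = {}}" \<phi>, OF step] by (auto simp: \<phi>_def)
  define F where "F n k = (if k = s n then D else space X - D)" for n k
  define T where "T n = prod_emb ?I M (\<phi> (s n)) (Pi\<^sub>E (\<phi> (s n)) (F n))" for n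
  have \<phi>I: "\<phi> (s n) \<subseteq> ?I" "finite (\<phi> (s n))" for n using s(1) g by (auto simp: \<phi>_def)
  have F_sets: "F n i \<in> sets (M i)" if "i \<in> \<phi> (s m)" for n m i
  proof -
    have "i \<in> ?I" using that \<phi>I by blast
    then show ?thesis unfolding F_def sets[OF \<open>i \<in> ?I\<close>] using D by simp
  qed
  have T_sets: "T n \<in> sets ?P" for n
    unfolding T_def using \<phi>I by (intro sets_PiM_I) (auto intro: F_sets)
  have ne: "inv g \<otimes> s n \<noteq> s n" for n
  proof
    assume "inv g \<otimes> s n = s n"
    then have "inv g = \<one>" using s(1)[of n] g by simp
    then show False using g by simp
  qed
  have PT: "\<epsilon>\<^sup>2 \<le> P.prob (T n)" for n
  proof -
    let ?k = "inv g \<otimes> s n"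
    have I: "s n \<in> ?I - K" "?k \<in> ?I - K" using s[of n] g by (auto simp: \<phi>_def)
    interpret k: prob_space "M ?k" using prob I by simp
    have "emeasure ?P (T n) = (\<Prod>i\<in>\<phi> (s n). emeasure (M i) (F n i))"
      unfolding T_def using \<phi>I by (intro emeasure_PiM_emb prob) (auto intro: F_sets)
    also have "\<dots> = emeasure (M (s n)) D * emeasure (M ?k) (space X - D)"
      using ne[of n] ne[of n, symmetric] by (simp add: \<phi>_def F_def)
    finally have "P.prob (T n) = measure (M (s n)) D * measure (M ?k) (space X - D)"
      by (simp add: measure_def enn2real_mult)
    moreover have "measure (M ?k) (space X - D) = 1 - measure (M ?k) D"
      using k.prob_compl[of D] sets[of ?k] D I sets_eq_imp_space_eq[OF sets[of ?k]] by simp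
    ultimately show ?thesis
      using mid[OF I(1)] mid[OF I(2)] \<epsilon> by (simp add: power2_eq_square mult_mono)
  qed
  define A where "A = space ?P - (\<Union>n. T n)"
  have A_sets: "A \<in> sets ?P" unfolding A_def using T_sets by auto
  have AT: "A \<inter> T n = {}" for n by (auto simp: A_def)
  have "P.prob A * \<epsilon>\<^sup>2 \<le> 0"
  proof (rule P.pairwise_indep_decorrelation[OF A_sets T_sets])
    show "P.prob (T m \<inter> T n) = P.prob (T m) * P.prob (T n)" if "m \<noteq> n" for m n
      unfolding T_def using \<phi>I
      by (intro prob_rectangles_disjoint_coordinates prob disj[OF that]) (auto intro: F_sets)
    show "P.prob A * \<epsilon>\<^sup>2 \<le> P.prob A * P.prob (T n) - P.prob (A \<inter> T n)" for n
      using PT by (simp add: AT mult_left_mono)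
  qed
  then have "P.prob A = 0"
    using \<epsilon> by (simp add: mult_le_0_iff measure_le_0_iff)
  then have notA: "AE x in ?P. x \<notin> A"
    using A_sets by (intro AE_not_in) (simp add: null_sets_def P.emeasure_eq_measure)
  have "bernoulli G g x \<noteq> x" if x: "x \<in> space ?P" "x \<notin> A" for x
  proof
    assume fix_x: "bernoulli G g x = x"
    obtain n where n: "x \<in> T n" using x by (auto simp: A_def)
    have "x (s n) = x (inv g \<otimes> s n)"
      using fun_cong[OF fix_x, of "s n"] s(1)[of n] by (simp add: bernoulli_def)
    moreover have "x (s n) \<in> D" "x (inv g \<otimes> s n) \<notin> D"
      using n ne[of n] by (auto simp: T_def prod_emb_def \<phi>_def F_def PiE_iff)
    ultimately show False by simp
  qed
  with notA AE_space show ?thesis by (auto elim: eventually_elim2)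
qed

section \<open>Fundamental domains\<close>

lemma standard_borel_separating_sequence:
  assumes "standard_borel X"
  shows "\<exists>B :: nat \<Rightarrow> 'a set. (\<forall>n. B n \<in> sets X) \<and>
    (\<forall>x\<in>space X. \<forall>y\<in>space X. (\<forall>n. x \<in> B n \<longleftrightarrow> y \<in> B n) \<longrightarrow> x = y)"
proof -
  obtain T where T: "completely_metrizable_space T" "second_countable T"
    and X: "space X = topspace T" "sets X = sigma_sets (topspace T) {U. openin T U}"
    using assms by (auto simp: standard_borel_def)
  obtain \<B> where \<B>: "countable \<B>" "\<And>V. V \<in> \<B> \<Longrightarrow> openin T V"
    and base: "\<And>U x. openin T U \<Longrightarrow> x \<in> U \<Longrightarrow> \<exists>V\<in>\<B>. x \<in> V \<and> V \<subseteq> U"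
    using T(2) unfolding second_countable_def by (metis (no_types, lifting))
  define B where "B = from_nat_into (insert {} \<B>)"
  have range: "range B = insert {} \<B>"
    unfolding B_def using \<B>(1) by (intro range_from_nat_into) auto
  have t1: "t1_space T"
    using T(1) by (intro metrizable_imp_t1_space completely_metrizable_imp_metrizable_space)
  have "B n \<in> sets X" for n
  proof -
    have "B n \<in> insert {} \<B>" using range by blast
    then show ?thesis using \<B>(2) unfolding X by (auto intro: sigma_sets.Empty sigma_sets.Basic)
  qed
  moreover have "x = y" if xy: "x \<in> space X" "y \<in> space X" "\<forall>n. x \<in> B n \<longleftrightarrow> y \<in> B n" for x y
  proof (rule ccontr)
    assume "x \<noteq> y"
    then obtain U where "openin T U" "x \<in> U" "y \<notin> U"
      using t1 xy X unfolding t1_space_def by metis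
    then obtain V where V: "V \<in> \<B>" "x \<in> V" "y \<notin> V" using base by blast
    then have "V \<in> range B" using range by blast
    then obtain n where "V = B n" by auto
    then show False using V xy by auto
  qed
  ultimately show ?thesis by blast
qed

text \<open>Ternary expansions: the first index at which two points are separated outweighs
  all later ones.\<close>

lemma separating_sequence_injection:
  fixes C :: "nat \<Rightarrow> 'x set"
  assumes C[measurable]: "\<And>n. C n \<in> sets M"
    and sep: "\<And>x y. x \<in> space M \<Longrightarrow> y \<in> space M \<Longrightarrow> (\<And>n. x \<in> C n \<longleftrightarrow> y \<in> C n) \<Longrightarrow> x = y"
  shows "\<exists>\<phi> :: 'x \<Rightarrow> real. \<phi> \<in> borel_measurable M \<and> inj_on \<phi> (space M) \<and> (\<forall>x. 0 \<le> \<phi> x \<and> \<phi> x < 1)"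
proof -
  define q :: "nat \<Rightarrow> real" where "q n = (1/3) * (1/3) ^ n" for n
  have q_pos: "0 < q n" for n by (simp add: q_def)
  have q_sums: "(\<lambda>k. q (k + m)) sums (3 * q m / 2)" for m
    using sums_mult[OF geometric_sums[of "1/3 :: real"], of "q m"]
    by (simp add: q_def power_add ac_simps)
  define b where "b x n = indicator (C n) x * q n" for x n
  have b: "0 \<le> b x n" "b x n \<le> q n" for x n
    using q_pos[of n] by (auto simp: b_def indicator_def)
  have q_summ: "summable q" using q_sums[of 0] by (simp add: sums_iff)
  have b_summ: "summable (b x)" for x
    by (rule summable_comparison_test'[OF q_summ, of 0]) (use b in auto)
  define \<phi> where "\<phi> x = (\<Sum>n. b x n)" for x
  have [measurable]: "\<phi> \<in> borel_measurable M" unfolding \<phi>_def b_def by measurable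
  have "0 \<le> \<phi> x" for x unfolding \<phi>_def using b b_summ by (intro suminf_nonneg) auto
  moreover have "\<phi> x < 1" for x
  proof -
    have "\<phi> x \<le> (\<Sum>n. q n)" unfolding \<phi>_def using b b_summ q_summ by (intro suminf_le) auto
    also have "\<dots> = 1/2" using q_sums[of 0] by (simp add: sums_iff q_def)
    finally show ?thesis by simp
  qed
  moreover have less: "\<phi> y < \<phi> x"
    if n: "x \<in> C n" "y \<notin> C n" and eq: "\<And>k. k < n \<Longrightarrow> x \<in> C k \<longleftrightarrow> y \<in> C k" for x y n
  proof -
    have pre: "(\<Sum>k<n. b y k) = (\<Sum>k<n. b x k)"
      using eq by (intro sum.cong) (auto simp: b_def indicator_def)
    have "\<phi> y = (\<Sum>k. b y (k + Suc n)) + (\<Sum>k<Suc n. b y k)"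
      unfolding \<phi>_def by (rule suminf_split_initial_segment[OF b_summ])
    also have "\<dots> = (\<Sum>k. b y (k + Suc n)) + (\<Sum>k<n. b x k)"
      using n pre by (simp add: b_def)
    also have "(\<Sum>k. b y (k + Suc n)) \<le> (\<Sum>k. q (k + Suc n))"
      using b q_sums[of "Suc n"] summable_ignore_initial_segment[OF b_summ, of y "Suc n"]
      by (intro suminf_le) (auto simp: sums_iff)
    also have "(\<Sum>k. q (k + Suc n)) = q n / 2"
      using q_sums[of "Suc n"] by (simp add: sums_iff q_def)
    also have "q n / 2 + (\<Sum>k<n. b x k) < (\<Sum>k<Suc n. b x k)"
      using n q_pos[of n] by (simp add: b_def)
    also have "\<dots> \<le> \<phi> x"
      unfolding \<phi>_def using b b_summ by (intro sum_le_suminf) auto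
    finally show ?thesis by simp
  qed
  moreover have "inj_on \<phi> (space M)"
  proof (rule inj_onI, rule ccontr)
    fix x y assume xy: "x \<in> space M" "y \<in> space M" "\<phi> x = \<phi> y" "x \<noteq> y"
    define n where "n = (LEAST n. (x \<in> C n) \<noteq> (y \<in> C n))"
    have "\<exists>n. (x \<in> C n) \<noteq> (y \<in> C n)" using sep xy by blast
    then have n: "(x \<in> C n) \<noteq> (y \<in> C n)" unfolding n_def by (rule LeastI_ex)
    have eq: "x \<in> C k \<longleftrightarrow> y \<in> C k" if "k < n" for k
      using not_less_Least[OF that[unfolded n_def]] by simp
    show False
      using n less[of x n y] less[of y n x] eq xy(3) by (cases "x \<in> C n") auto
  qed
  ultimately show ?thesis by (intro exI[of _ \<phi>]) auto
qed

lemma PiM_real_injection: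
  assumes X: "standard_borel X" and I: "countable I"
    and sets: "\<And>i. i \<in> I \<Longrightarrow> sets (M i) = sets X"
  shows "\<exists>\<phi> :: ('i \<Rightarrow> 'a) \<Rightarrow> real. \<phi> \<in> borel_measurable (PiM I M) \<and>
    inj_on \<phi> (space (PiM I M)) \<and> (\<forall>x. 0 \<le> \<phi> x \<and> \<phi> x < 1)"
proof (cases "I = {}")
  case True
  then show ?thesis
    by (intro exI[of _ "\<lambda>_. 0"]) (auto simp: space_PiM)
next
  case False
  obtain B :: "nat \<Rightarrow> 'a set" where B: "\<And>n. B n \<in> sets X"
    and sep: "\<And>x y. x \<in> space X \<Longrightarrow> y \<in> space X \<Longrightarrow> (\<And>n. x \<in> B n \<longleftrightarrow> y \<in> B n) \<Longrightarrow> x = y"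
    using standard_borel_separating_sequence[OF X] by blast
  define e where "e = from_nat_into I"
  have e: "range e = I" unfolding e_def using False I by (rule range_from_nat_into)
  then have eI: "e n \<in> I" for n by auto
  define C where "C n = {x \<in> space (PiM I M). x (e (fst (prod_decode n))) \<in> B (snd (prod_decode n))}" for n
  show ?thesis
  proof (rule separating_sequence_injection)
    show "C n \<in> sets (PiM I M)" for n
      unfolding C_def using B sets eI by (intro sets_Collect_single) auto
    fix x y assume xy: "x \<in> space (PiM I M)" "y \<in> space (PiM I M)" "\<And>n. x \<in> C n \<longleftrightarrow> y \<in> C n"
    have "x i = y i" if i: "i \<in> I" for i
    proof (rule sep)
      show "x i \<in> space X" "y i \<in> space X"
        using xy i sets_eq_imp_space_eq[OF sets[OF i]] by (auto simp: space_PiM PiE_iff)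
      fix m
      obtain k where "i = e k" using i e by auto
      then show "x i \<in> B m \<longleftrightarrow> y i \<in> B m"
        using xy(3)[of "prod_encode (k, m)"] xy(1,2) by (auto simp: C_def)
    qed
    then show "x = y" using xy(1,2) by (intro PiE_ext[of x I _ y]) (auto simp: space_PiM)
  qed
qed

text \<open>Properness provides a minimum of \<open>\<psi>\<close> on the orbit, and injectivity together with freeness makes
  its location unique; the strict inequality in the definition of the domain gives disjoint
  translates everywhere, not only almost everywhere.\<close>

lemma dissipative_action_if_free_proper:
  fixes G (structure)
  assumes G: "group G" and cG: "countable (carrier G)" and ns: "nonsingular_action G M a"
    and \<psi>[measurable]: "\<psi> \<in> borel_measurable M" and inj: "inj_on \<psi> (space M)"
    and free: "\<And>g. g \<in> carrier G \<Longrightarrow> g \<noteq> \<one> \<Longrightarrow> AE x in M. a g x \<noteq> x"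
    and proper: "AE x in M. \<forall>c :: real. finite {g \<in> carrier G. \<psi> (a g x) \<le> c}"
  shows "dissipative_action G M a"
proof -
  interpret group G by fact
  have ma: "measurable_action G M a" using ns by (simp add: nonsingular_action_def)
  note act = measurable_actionD[OF G ma]
  note act_meas[measurable] = act(4)
  define U where "U = {x \<in> space M. \<forall>g\<in>carrier G - {\<one>}. \<psi> x < \<psi> (a g x)}"
  have U_sets: "U \<in> sets M"
  proof -
    have "U = space M - (\<Union>g\<in>carrier G - {\<one>}. {x \<in> space M. \<psi> (a g x) \<le> \<psi> x})"
      by (auto simp: U_def simp flip: not_le)
    moreover have "{x \<in> space M. \<psi> (a g x) \<le> \<psi> x} \<in> sets M" if "g \<in> carrier G" for g
      using that by measurable
    ultimately show ?thesis using cG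
      by (auto intro!: sets.countable_UN')
  qed
  have U_sp: "U \<subseteq> space M" by (auto simp: U_def)
  have cancel: "a (inv g) (a g x) = x" "a g (a (inv g) x) = x" if "g \<in> carrier G" "x \<in> space M" for g x
    using that act(2)[of x] by (simp_all flip: act(3))
  have img: "a g ` U = {x \<in> space M. a (inv g) x \<in> U}" if g: "g \<in> carrier G" for g
  proof (rule equalityI; rule subsetI)
    fix x assume "x \<in> {x \<in> space M. a (inv g) x \<in> U}"
    then show "x \<in> a g ` U" using cancel(2)[OF g, of x] by (metis (no_types, lifting) image_eqI mem_Collect_eq)
  qed (use g act(1) cancel U_sp in auto)
  have disj: "disjoint_family_on (\<lambda>g. a g ` U) (carrier G)"
    unfolding disjoint_family_on_def
  proof (intro ballI impI, rule ccontr)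
    fix g h assume gh: "g \<in> carrier G" "h \<in> carrier G" "g \<noteq> h" "a g ` U \<inter> a h ` U \<noteq> {}"
    then obtain u v where uv: "u \<in> U" "v \<in> U" "a g u = a h v" by blast
    have lt: "\<psi> y < \<psi> x"
      if kl: "k \<in> carrier G" "l \<in> carrier G" "k \<noteq> l" and xy: "x \<in> U" "y \<in> U" "a k x = a l y" for k l x y
    proof -
      have "a (inv k \<otimes> l) y = a (inv k) (a k x)"
        using kl xy U_sp by (subst act(3)) auto
      also have "\<dots> = x" using kl xy U_sp cancel by blast
      finally have "a (inv k \<otimes> l) y = x" .
      moreover have "inv k \<otimes> l \<noteq> \<one>"
        using kl by (metis inv_equality inv_closed inv_inv)
      ultimately show ?thesis using xy kl by (auto simp: U_def)
    qed
    show False using lt[of g h u v] lt[of h g v u] gh uv by auto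
  qed
  have cover: "AE x in M. x \<in> (\<Union>g\<in>carrier G. a g ` U)"
  proof -
    have "AE x in M. \<forall>g\<in>carrier G. g \<noteq> \<one> \<longrightarrow> a g x \<noteq> x"
      using free by (auto simp: AE_ball_countable[OF cG])
    with proper AE_space show ?thesis
    proof eventually_elim
      fix x assume x: "x \<in> space M" and fin: "\<forall>c. finite {g \<in> carrier G. \<psi> (a g x) \<le> c}"
        and fr: "\<forall>g\<in>carrier G. g \<noteq> \<one> \<longrightarrow> a g x \<noteq> x"
      define S where "S = {g \<in> carrier G. \<psi> (a g x) \<le> \<psi> x}"
      have S: "finite S" "\<one> \<in> S" using fin x act(2) by (auto simp: S_def)
      obtain g where g: "g \<in> S" and min: "\<And>h. h \<in> S \<Longrightarrow> \<psi> (a g x) \<le> \<psi> (a h x)"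
        using arg_min_if_finite[of S "\<lambda>g. \<psi> (a g x)"] S
        by (metis empty_iff linorder_not_le)
      have gG: "g \<in> carrier G" and gx: "\<psi> (a g x) \<le> \<psi> x" using g by (auto simp: S_def)
      have min': "\<psi> (a g x) \<le> \<psi> (a h x)" if "h \<in> carrier G" for h
        using min[of h] gx that by (cases "h \<in> S") (auto simp: S_def)
      have "\<psi> (a g x) < \<psi> (a k (a g x))" if k: "k \<in> carrier G" "k \<noteq> \<one>" for k
      proof -
        have "a k (a g x) = a (k \<otimes> g) x" using k gG x by (simp add: act(3))
        then have le: "\<psi> (a g x) \<le> \<psi> (a k (a g x))" using min' k gG by simp
        have "a k (a g x) \<noteq> a g x"
        proof
          assume eq: "a k (a g x) = a g x"
          have "a (inv g \<otimes> (k \<otimes> g)) x = a (inv g) (a k (a g x))"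
            using k gG x act(1) by (simp add: act(3))
          also have "\<dots> = x" using eq cancel gG x by simp
          finally have "inv g \<otimes> (k \<otimes> g) = \<one>" using fr k gG by blast
          then have "k \<otimes> g = g"
            using k gG by (metis inv_closed inv_equality inv_inv m_closed inv_comm r_inv)
          then show False using k gG by simp
        qed
        then have "\<psi> (a k (a g x)) \<noteq> \<psi> (a g x)"
          using inj k gG x act(1) by (auto dest: inj_onD)
        then show ?thesis using le by simp
      qed
      then have "a g x \<in> U" using gG x act(1) by (auto simp: U_def)
      then have "x \<in> a (inv g) ` U" using cancel(1)[OF gG x] by (metis image_eqI)
      then show "x \<in> (\<Union>g\<in>carrier G. a g ` U)" using gG by (intro UN_I[of "inv g"]) auto
    qed
  qed
  have img_sets: "a g ` U \<in> sets M" if g: "g \<in> carrier G" for g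
  proof -
    have "a (inv g) -` U \<inter> space M \<in> sets M"
      using U_sets g by (intro measurable_sets[OF act(4)]) auto
    moreover have "a (inv g) -` U \<inter> space M = a g ` U" unfolding img[OF g] by auto
    ultimately show ?thesis by simp
  qed
  have "(\<Union>g\<in>carrier G. a g ` U) \<in> sets M"
    using img_sets cG by (intro sets.countable_UN') auto
  then have "space M - (\<Union>g\<in>carrier G. a g ` U) \<in> null_sets M"
    using cover by (subst AE_iff_null_sets) (auto elim: eventually_mono)
  then show ?thesis
    unfolding dissipative_action_def using ns U_sets disj by blast
qed

text \<open>The function \<open>\<psi>\<close> is the position, in an enumeration of \<open>G\<close>, of the first coordinate of \<open>x\<close> in \<open>Z\<close>,
  plus a fractional part \<open>\<phi> x\<close> that identifies \<open>x\<close>. If \<open>x\<close> has finitely many coordinates in \<open>Z\<close>,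
  only finitely many translations carry one of them to a bounded position, so \<open>\<psi>\<close> is proper.\<close>

lemma dissipative_bernoulli_finitely_many_visits:
  fixes G :: "('g, 'b) monoid_scheme" (structure) and M :: "'g \<Rightarrow> 'a measure"
  assumes G: "group G" and cG: "countable (carrier G)" and iG: "infinite (carrier G)"
    and X: "standard_borel X"
    and sets: "\<And>h. h \<in> carrier G \<Longrightarrow> sets (M h) = sets X"
    and prob: "\<And>h. h \<in> carrier G \<Longrightarrow> prob_space (M h)"
    and ns: "nonsingular_action G (PiM (carrier G) M) (bernoulli G)"
    and free: "\<And>g. g \<in> carrier G \<Longrightarrow> g \<noteq> \<one> \<Longrightarrow> AE x in PiM (carrier G) M. bernoulli G g x \<noteq> x"
    and Z: "Z \<in> sets X" and summ: "(\<lambda>h. measure (M h) Z) summable_on carrier G"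
    and V: "V = {x \<in> space (PiM (carrier G) M). \<exists>h\<in>carrier G. x h \<in> Z}"
  shows "dissipative_action G (restrict_space (PiM (carrier G) M) V) (bernoulli G)"
proof -
  interpret group G by fact
  let ?P = "PiM (carrier G) M"
  interpret P: prob_space ?P by (intro prob_space_PiM prob)
  have ma: "measurable_action G ?P (bernoulli G)" using ns by (simp add: nonsingular_action_def)
  note act = measurable_actionD[OF G ma]
  define e where "e = from_nat_into (carrier G)"
  have e: "bij_betw e UNIV (carrier G)"
    unfolding e_def by (rule bij_betw_from_nat_into[OF cG iG])
  then have eG[simp]: "e n \<in> carrier G" for n by (auto simp: bij_betw_def)
  have e_surj: "\<exists>n. h = e n" if "h \<in> carrier G" for h using e that by (auto simp: bij_betw_def)
  have vis_sets[measurable]: "{x \<in> space ?P. x h \<in> Z} \<in> sets ?P" if "h \<in> carrier G" for h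
    using that Z sets by (intro sets_Collect_single) auto
  have V_sets: "V \<in> sets ?P"
  proof -
    have "V = (\<Union>h\<in>carrier G. {x \<in> space ?P. x h \<in> Z})" by (auto simp: V)
    then show ?thesis using vis_sets cG by (auto intro!: sets.countable_UN')
  qed
  have bern: "bernoulli G g x h = x (inv g \<otimes> h)" if "h \<in> carrier G" for g h x
    using that by (simp add: bernoulli_def)
  have V_inv: "bernoulli G g x \<in> V" if gx: "g \<in> carrier G" "x \<in> V" for g x
  proof -
    obtain h where h: "h \<in> carrier G" "x h \<in> Z" "x \<in> space ?P" using gx by (auto simp: V)
    have "bernoulli G g x (g \<otimes> h) = x h"
      using gx h by (simp add: bern m_assoc[symmetric])
    then show ?thesis using gx h act(1) by (auto simp: V intro!: bexI[of _ "g \<otimes> h"])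
  qed
  have sp: "space (restrict_space ?P V) = V"
    using sets.sets_into_space[OF V_sets] by (auto simp: space_restrict_space)
  have V_int: "V \<inter> space ?P \<in> sets ?P" using V_sets by simp
  have "\<exists>\<phi> :: ('g \<Rightarrow> 'a) \<Rightarrow> real. \<phi> \<in> borel_measurable ?P \<and>
      inj_on \<phi> (space ?P) \<and> (\<forall>x. 0 \<le> \<phi> x \<and> \<phi> x < 1)"
    by (rule PiM_real_injection[OF X cG sets])
  then obtain \<phi> :: "('g \<Rightarrow> 'a) \<Rightarrow> real" where \<phi>: "\<phi> \<in> borel_measurable ?P" "inj_on \<phi> (space ?P)"
    and \<phi>_bounds: "\<And>x. 0 \<le> \<phi> x" "\<And>x. \<phi> x < 1"
    by (elim exE conjE) simp
  define \<kappa> where "\<kappa> x = (LEAST n. x (e n) \<in> Z)" for x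
  define \<psi> where "\<psi> x = real (\<kappa> x) + \<phi> x" for x
  have \<kappa>: "x (e (\<kappa> x)) \<in> Z" if x: "x \<in> V" for x
  proof -
    obtain h where "h \<in> carrier G" "x h \<in> Z" using x by (auto simp: V)
    then have "\<exists>n. x (e n) \<in> Z" using e_surj by metis
    then show ?thesis unfolding \<kappa>_def by (rule LeastI_ex)
  qed
  have [measurable]: "Measurable.pred ?P (\<lambda>x. x (e n) \<in> Z)" for n
    using vis_sets[of "e n"] by (simp add: pred_def)
  have \<psi>_meas: "\<psi> \<in> borel_measurable ?P"
  proof -
    have "\<kappa> \<in> ?P \<rightarrow>\<^sub>M count_space UNIV" unfolding \<kappa>_def by measurable
    then show ?thesis unfolding \<psi>_def using \<phi>(1) by measurable
  qed
  show ?thesis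
  proof (rule dissipative_action_if_free_proper[OF G cG, where \<psi>=\<psi>])
    show "nonsingular_action G (restrict_space ?P V) (bernoulli G)"
      by (rule nonsingular_action_restrict_space[OF G ns V_sets V_inv])
    show "\<psi> \<in> borel_measurable (restrict_space ?P V)"
      using \<psi>_meas by (rule measurable_restrict_space1)
    show "inj_on \<psi> (space (restrict_space ?P V))"
    proof (rule inj_onI)
      fix x y assume xy: "x \<in> space (restrict_space ?P V)" "y \<in> space (restrict_space ?P V)" "\<psi> x = \<psi> y"
      have "\<kappa> x = \<kappa> y"
        using xy(3) \<phi>_bounds[of x] \<phi>_bounds[of y] unfolding \<psi>_def by linarith
      then have "\<phi> x = \<phi> y" using xy(3) by (simp add: \<psi>_def)
      moreover have "x \<in> space ?P" "y \<in> space ?P" using xy(1,2) unfolding sp by (auto simp: V)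
      ultimately show "x = y" using \<phi>(2) by (auto dest: inj_onD)
    qed
    show "AE x in restrict_space ?P V. bernoulli G g x \<noteq> x" if "g \<in> carrier G" "g \<noteq> \<one>" for g
      unfolding AE_restrict_space_iff[OF V_int] using free[OF that] by eventually_elim simp
    have "summable (\<lambda>n. measure (M (e n)) Z)"
    proof -
      have "(\<lambda>n. measure (M (e n)) Z) summable_on UNIV"
        using summ by (subst summable_on_reindex_bij_betw[OF e])
      then show ?thesis by (rule summable_on_imp_summable)
    qed
    moreover have PZ: "P.prob {x \<in> space ?P. x (e n) \<in> Z} = measure (M (e n)) Z" for n
    proof -
      have "measure (distr ?P (M (e n)) (\<lambda>x. x (e n))) Z = P.prob {x \<in> space ?P. x (e n) \<in> Z}"
        using Z sets by (subst measure_distr) (auto intro!: arg_cong[where f="P.prob"])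
      then show ?thesis by (simp add: distr_PiM_component prob)
    qed
    ultimately have "AE x in ?P. eventually (\<lambda>n. x \<in> space ?P - {x \<in> space ?P. x (e n) \<in> Z}) sequentially"
      using vis_sets by (intro borel_cantelli_AE1) (auto simp: P.emeasure_eq_measure)
    then have "AE x in ?P. x \<in> V \<longrightarrow> (\<forall>c. finite {g \<in> carrier G. \<psi> (bernoulli G g x) \<le> c})"
    proof eventually_elim
      fix x assume "eventually (\<lambda>n. x \<in> space ?P - {x \<in> space ?P. x (e n) \<in> Z}) sequentially"
      then obtain N where N: "\<And>n. N \<le> n \<Longrightarrow> x (e n) \<notin> Z"
        by (auto simp: eventually_sequentially)
      show "x \<in> V \<longrightarrow> (\<forall>c. finite {g \<in> carrier G. \<psi> (bernoulli G g x) \<le> c})"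
      proof (intro impI allI)
        fix c assume x: "x \<in> V"
        \<comment> \<open>If the first coordinate of the translate in \<open>Z\<close> is \<open>e n\<close>, then \<open>n \<le> c\<close>, and it comes
          from one of the finitely many such coordinates \<open>e m\<close> of \<open>x\<close>.\<close>
        have "{g \<in> carrier G. \<psi> (bernoulli G g x) \<le> c} \<subseteq>
            (\<lambda>(n, m). e n \<otimes> inv (e m)) ` ({..nat \<lfloor>c\<rfloor>} \<times> {..<N})"
        proof
          fix g assume "g \<in> {g \<in> carrier G. \<psi> (bernoulli G g x) \<le> c}"
          then have g: "g \<in> carrier G" and c: "\<psi> (bernoulli G g x) \<le> c" by auto
          define n where "n = \<kappa> (bernoulli G g x)"
          have "x (inv g \<otimes> e n) \<in> Z"
            using \<kappa>[OF V_inv[OF g x]] by (simp add: n_def bern)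
          moreover obtain m where m: "inv g \<otimes> e n = e m"
            using e_surj[of "inv g \<otimes> e n"] g by auto
          ultimately have "m < N" using N[of m] by (auto simp: not_le[symmetric])
          moreover have "real n \<le> c"
            using c \<phi>_bounds(1)[of "bernoulli G g x"] by (simp add: \<psi>_def n_def)
          then have "n \<le> nat \<lfloor>c\<rfloor>" by (simp add: le_nat_floor)
          moreover have "g = e n \<otimes> inv (e m)"
            unfolding m[symmetric] using g by (simp add: inv_mult_group m_assoc[symmetric])
          ultimately show "g \<in> (\<lambda>(n, m). e n \<otimes> inv (e m)) ` ({..nat \<lfloor>c\<rfloor>} \<times> {..<N})"
            by (intro image_eqI[of _ _ "(n, m)"]) auto
        qed
        then show "finite {g \<in> carrier G. \<psi> (bernoulli G g x) \<le> c}"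
          by (rule finite_subset) simp
      qed
    qed
    then show "AE x in restrict_space ?P V. \<forall>c. finite {g \<in> carrier G. \<psi> (bernoulli G g x) \<le> c}"
      unfolding AE_restrict_space_iff[OF V_int] .
  qed
qed

section \<open>Equivalence of products and of their restrictions\<close>

abbreviation sqdensity :: "'x measure \<Rightarrow> ('x \<Rightarrow> real) \<Rightarrow> 'x measure" where
  "sqdensity N u \<equiv> density N (\<lambda>x. ennreal ((u x)\<^sup>2))"

lemma null_sets_PiM_component:
  assumes prob: "\<And>i. i \<in> I \<Longrightarrow> prob_space (M i)" and i: "i \<in> I" and A: "A \<in> sets (M i)"
  shows "{x \<in> space (PiM I M). x i \<in> A} \<in> null_sets (PiM I M) \<longleftrightarrow> A \<in> null_sets (M i)"
proof -
  have "A \<in> null_sets (distr (PiM I M) (M i) (\<lambda>x. x i)) \<longleftrightarrow>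
      (\<lambda>x. x i) -` A \<inter> space (PiM I M) \<in> null_sets (PiM I M) \<and> A \<in> sets (M i)"
    using i by (intro null_sets_distr_iff) auto
  moreover have "(\<lambda>x. x i) -` A \<inter> space (PiM I M) = {x \<in> space (PiM I M). x i \<in> A}" by auto
  ultimately show ?thesis using A i by (simp add: distr_PiM_component prob)
qed

lemma absolutely_continuous_PiM_component:
  assumes "\<And>i. i \<in> I \<Longrightarrow> prob_space (M i)" "\<And>i. i \<in> I \<Longrightarrow> prob_space (N i)"
    and sets: "\<And>i. i \<in> I \<Longrightarrow> sets (N i) = sets (M i)"
    and ac: "absolutely_continuous (PiM I M) (PiM I N)" and i: "i \<in> I"
  shows "absolutely_continuous (M i) (N i)"
  unfolding absolutely_continuous_def
proof
  fix A assume A: "A \<in> null_sets (M i)"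
  have sp: "space (PiM I N) = space (PiM I M)"
    by (intro sets_eq_imp_space_eq sets_PiM_cong sets refl)
  have "{x \<in> space (PiM I N). x i \<in> A} \<in> null_sets (PiM I M)"
    unfolding sp using A assms(1) i by (subst null_sets_PiM_component) auto
  then have "{x \<in> space (PiM I N). x i \<in> A} \<in> null_sets (PiM I N)"
    using ac by (auto simp: absolutely_continuous_def)
  then show "A \<in> null_sets (N i)"
    using A assms(2) i sets by (subst (asm) null_sets_PiM_component) auto
qed

lemma positive_square_root_density:
  assumes L: "prob_space L" and N: "prob_space N" and sets: "sets N = sets L"
    and LN: "absolutely_continuous L N" and NL: "absolutely_continuous N L"
  shows "\<exists>f \<in> borel_measurable L. (\<forall>x. 0 < f x) \<and> N = sqdensity L f"
proof -
  interpret L: prob_space L by fact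
  interpret N: prob_space N by fact
  obtain D where D[measurable]: "D \<in> borel_measurable L" and RN: "AE x in L. RN_deriv L N x = ennreal (D x)"
    and pos: "AE x in N. 0 < D x" and "\<And>x. 0 \<le> D x"
    using L.real_RN_deriv[OF N.finite_measure_axioms LN sets] by blast
  define f where "f x = (if 0 < D x then sqrt (D x) else 1)" for x
  have [measurable]: "f \<in> borel_measurable L" unfolding f_def by measurable
  have "AE x in L. 0 < D x"
    using absolutely_continuous_AE[OF sets[symmetric] NL pos] .
  with RN have AE: "AE x in L. RN_deriv L N x = ennreal ((f x)\<^sup>2)"
    by eventually_elim (simp add: f_def)
  have "N = density L (RN_deriv L N)"
    by (rule L.density_RN_deriv[OF LN sets, symmetric])
  also have "\<dots> = sqdensity L f"
    using AE by (intro density_cong) auto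
  finally have "N = sqdensity L f" .
  moreover have "0 < f x" for x by (simp add: f_def)
  ultimately show ?thesis by (intro bexI[of _ f]) auto
qed

lemma nn_integral_square_diff_unit_vectors:
  fixes u v :: "'a \<Rightarrow> real"
  assumes [measurable]: "u \<in> borel_measurable L" "v \<in> borel_measurable L"
    and u: "sqnorm L u = 1" and v: "sqnorm L v = 1"
  shows "sqnorm L (\<lambda>x. u x - v x) = ennreal (2 * (1 - (\<integral>x. u x * v x \<partial>L)))"
proof -
  have iu: "integrable L (\<lambda>x. (u x)\<^sup>2)" "(\<integral>x. (u x)\<^sup>2 \<partial>L) = 1"
    using nn_integral_eq_integrable[of "\<lambda>x. (u x)\<^sup>2" L 1] u by auto
  have iv: "integrable L (\<lambda>x. (v x)\<^sup>2)" "(\<integral>x. (v x)\<^sup>2 \<partial>L) = 1"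
    using nn_integral_eq_integrable[of "\<lambda>x. (v x)\<^sup>2" L 1] v by auto
  have iuv: "integrable L (\<lambda>x. u x * v x)"
    by (rule integrable_mult_if_square_integrable) (use iu iv in auto)
  have "sqnorm L (\<lambda>x. u x - v x) = ennreal (\<integral>x. (u x - v x)\<^sup>2 \<partial>L)"
  proof (rule nn_integral_eq_integral)
    show "integrable L (\<lambda>x. (u x - v x)\<^sup>2)"
      using iu iv iuv by (simp add: power2_diff mult.assoc)
  qed simp
  also have "(\<integral>x. (u x - v x)\<^sup>2 \<partial>L) = 2 * (1 - (\<integral>x. u x * v x \<partial>L))"
    using iu iv iuv by (simp add: power2_diff mult.assoc)
  finally show ?thesis .
qed

lemma prob_space_density_unit_vector:
  assumes [measurable]: "u \<in> borel_measurable L" and "sqnorm L u = 1"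
  shows "prob_space (sqdensity L u)"
  using assms(2) by (intro prob_spaceI) (simp add: emeasure_density cong: nn_integral_cong)

lemma unit_vector_if_prob_space_density:
  fixes u :: "'a \<Rightarrow> real"
  assumes [measurable]: "u \<in> borel_measurable L" and "prob_space (sqdensity L u)"
  shows "sqnorm L u = 1"
proof -
  have "sqnorm L u = emeasure (sqdensity L u) (space L)"
    by (subst emeasure_density) (auto intro!: nn_integral_cong)
  then show ?thesis using prob_space.emeasure_space_1[OF assms(2)] by simp
qed

lemma density_square_quotient:
  fixes u v :: "'a \<Rightarrow> real"
  assumes [measurable]: "u \<in> borel_measurable L" "v \<in> borel_measurable L"
    and zero: "\<And>x. u x = 0 \<Longrightarrow> v x = 0"
  shows "density (sqdensity L u) (\<lambda>x. ennreal ((v x / u x)\<^sup>2)) = sqdensity L v"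
    and "(\<integral>x. v x / u x \<partial>sqdensity L u) = (\<integral>x. u x * v x \<partial>L)"
proof -
  have "ennreal ((u x)\<^sup>2) * ennreal ((v x / u x)\<^sup>2) = ennreal ((v x)\<^sup>2)" for x
    using zero[of x] by (cases "u x = 0") (simp_all add: ennreal_mult[symmetric] power_divide)
  then show "density (sqdensity L u) (\<lambda>x. ennreal ((v x / u x)\<^sup>2)) = sqdensity L v"
    by (subst density_density_eq) auto
  have "(u x)\<^sup>2 * (v x / u x) = u x * v x" for x
    by (cases "u x = 0") (simp_all add: power2_eq_square)
  then show "(\<integral>x. v x / u x \<partial>sqdensity L u) = (\<integral>x. u x * v x \<partial>L)"
    by (subst integral_real_density) auto
qed

text \<open>Kakutani's criterion in the form used below: both families of measures have square-root
  densities \<open>u\<close> and \<open>v\<close> with respect to one base measure, and the affinities become inner products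
  in \<open>L\<^sup>2(L)\<close>.\<close>

locale unit_vector_pair =
  fixes I :: "'i set" and L :: "'a measure" and u v :: "'i \<Rightarrow> 'a \<Rightarrow> real" and e :: "nat \<Rightarrow> 'i"
  assumes u_meas: "\<And>i. i \<in> I \<Longrightarrow> u i \<in> borel_measurable L"
    and v_meas: "\<And>i. i \<in> I \<Longrightarrow> v i \<in> borel_measurable L"
    and u_nonneg: "\<And>i x. i \<in> I \<Longrightarrow> 0 \<le> u i x" and v_nonneg: "\<And>i x. i \<in> I \<Longrightarrow> 0 \<le> v i x"
    and u_unit: "\<And>i. i \<in> I \<Longrightarrow> (sqnorm L (u i)) = 1"
    and v_unit: "\<And>i. i \<in> I \<Longrightarrow> (sqnorm L (v i)) = 1"
    and support: "\<And>i x. i \<in> I \<Longrightarrow> u i x = 0 \<Longrightarrow> v i x = 0"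
    and enum: "bij_betw e UNIV I"
begin

lemma densities: "square_root_densities I (\<lambda>i. sqdensity L (u i)) (\<lambda>i x. v i x / u i x) e"
proof (rule square_root_densities.intro)
  fix i assume i: "i \<in> I"
  note [measurable] = u_meas[OF i] v_meas[OF i]
  show "prob_space (sqdensity L (u i))"
    by (rule prob_space_density_unit_vector) (use u_unit[OF i] in auto)
  show "(\<lambda>x. v i x / u i x) \<in> borel_measurable (sqdensity L (u i))"
    by simp
  show "0 \<le> v i x / u i x" for x
    using u_nonneg[OF i] v_nonneg[OF i] by simp
  have "density (sqdensity L (u i)) (\<lambda>x. ennreal ((v i x / u i x)\<^sup>2)) =
      sqdensity L (v i)"
    by (intro density_square_quotient u_meas v_meas support i)
  moreover have "prob_space (sqdensity L (v i))"
    by (rule prob_space_density_unit_vector) (use v_unit[OF i] in auto)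
  ultimately show "(\<integral>\<^sup>+x. ennreal ((v i x / u i x)\<^sup>2) \<partial>sqdensity L (u i)) = 1"
    by (intro unit_vector_if_prob_space_density) simp_all
qed (rule enum)

sublocale square_root_densities I "\<lambda>i. sqdensity L (u i)" "\<lambda>i x. v i x / u i x" e
  by (rule densities)

lemma N_eq: "i \<in> I \<Longrightarrow> N i = sqdensity L (v i)"
  unfolding N_def by (intro density_square_quotient u_meas v_meas support)

lemma affinity_eq: "i \<in> I \<Longrightarrow> affinity i = (\<integral>x. u i x * v i x \<partial>L)"
  unfolding affinity_def by (intro density_square_quotient u_meas v_meas support)

lemma PiM_N_eq: "PiM I N = PiM I (\<lambda>i. sqdensity L (v i))"
  by (intro PiM_cong N_eq refl)

lemma summable_affinity_iff:
  "summable (\<lambda>n. 1 - affinity (e n)) \<longleftrightarrow>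
    (\<integral>\<^sup>+i. sqnorm L (\<lambda>x. u i x - v i x) \<partial>count_space I) < \<infinity>"
proof -
  have eI: "e n \<in> I" for n using enum by (auto simp: bij_betw_def)
  have eq: "(\<integral>\<^sup>+i. sqnorm L (\<lambda>x. u i x - v i x) \<partial>count_space I) = (\<Sum>n. ennreal (2 * (1 - affinity (e n))))"
    unfolding nn_integral_count_space_enum[OF enum]
    using eI by (intro suminf_cong)
      (simp add: affinity_eq nn_integral_square_diff_unit_vectors[OF u_meas v_meas u_unit v_unit])
  have nn: "0 \<le> 2 * (1 - affinity (e n))" for n
    using affinity_bounds[OF eI] by simp
  have "(\<Sum>n. ennreal (2 * (1 - affinity (e n)))) < \<infinity> \<longleftrightarrow> summable (\<lambda>n. 2 * (1 - affinity (e n)))"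
  proof
    assume "summable (\<lambda>n. 2 * (1 - affinity (e n)))"
    then show "(\<Sum>n. ennreal (2 * (1 - affinity (e n)))) < \<infinity>"
      using nn by (subst suminf_ennreal2) auto
  next
    assume "(\<Sum>n. ennreal (2 * (1 - affinity (e n)))) < \<infinity>"
    then show "summable (\<lambda>n. 2 * (1 - affinity (e n)))"
      using nn by (intro summable_suminf_not_top) auto
  qed
  also have "\<dots> \<longleftrightarrow> summable (\<lambda>n. 1 - affinity (e n))"
    by (rule trans[OF summable_cmult_iff]) simp
  finally show ?thesis by (simp only: eq)
qed

lemma kakutani_unit_vectors_absolutely_continuous:
  assumes "(\<integral>\<^sup>+i. sqnorm L (\<lambda>x. u i x - v i x) \<partial>count_space I) < \<infinity>"
  shows "absolutely_continuous (PiM I (\<lambda>i. sqdensity L (u i)))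
    (PiM I (\<lambda>i. sqdensity L (v i)))"
  using kakutani_absolutely_continuous assms summable_affinity_iff PiM_N_eq by simp

lemma kakutani_unit_vectors_summable:
  assumes "\<And>i x. i \<in> I \<Longrightarrow> 0 < u i x" "\<And>i x. i \<in> I \<Longrightarrow> 0 < v i x"
    and "absolutely_continuous (PiM I (\<lambda>i. sqdensity L (u i)))
      (PiM I (\<lambda>i. sqdensity L (v i)))"
  shows "(\<integral>\<^sup>+i. sqnorm L (\<lambda>x. u i x - v i x) \<partial>count_space I) < \<infinity>"
  using kakutani_summable assms summable_affinity_iff PiM_N_eq by simp

end

lemma sets_PiE_countable:
  assumes "countable I" "\<And>i. i \<in> I \<Longrightarrow> C i \<in> sets (M i)"
  shows "Pi\<^sub>E I C \<in> sets (PiM I M)"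
  using assms by (intro sets_PiM_I_countable) auto

text \<open>Conditioning a product on a set of full product form conditions each factor. For a
  rectangle over finitely many coordinates, compare with the decreasing sequence of rectangles
  over the first \<open>n\<close> coordinates.\<close>

lemma emeasure_PiM_Int_PiE:
  fixes M :: "'i \<Rightarrow> 'a measure" and e :: "nat \<Rightarrow> 'i"
  assumes prob: "\<And>i. i \<in> I \<Longrightarrow> prob_space (M i)" and e: "bij_betw e UNIV I"
    and C: "\<And>i. i \<in> I \<Longrightarrow> C i \<in> sets (M i)" and pos: "\<And>i. i \<in> I \<Longrightarrow> emeasure (M i) (C i) \<noteq> 0"
    and A: "A \<in> sets (PiM I M)"
  shows "emeasure (PiM I M) (Pi\<^sub>E I C \<inter> A) =
    emeasure (PiM I M) (Pi\<^sub>E I C) * emeasure (PiM I (\<lambda>i. uniform_measure (M i) (C i))) A"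
proof -
  let ?P = "PiM I M" and ?N = "\<lambda>i. uniform_measure (M i) (C i)" and ?Y = "Pi\<^sub>E I C"
  let ?R = "\<lambda>K E. prod_emb I M K (Pi\<^sub>E K E)"
  interpret P: prob_space ?P by (intro prob_space_PiM prob)
  have finC: "emeasure (M i) (C i) \<noteq> \<infinity>" if "i \<in> I" for i
    using prob[OF that] finite_measure.emeasure_finite[of "M i" "C i"] by (auto simp: prob_space_def)
  have probN: "prob_space (?N i)" if "i \<in> I" for i
    using pos[OF that] finC[OF that] by (rule prob_space_uniform_measure)
  interpret N: prob_space "PiM I ?N" by (intro prob_space_PiM probN)
  have setsN: "sets (PiM I ?N) = sets ?P" by (intro sets_PiM_cong) auto
  define J where "J n = e ` {..<n}" for n
  have J: "finite (J n)" "J n \<subseteq> I" "J n \<subseteq> J (Suc n)" for n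
    using e by (auto simp: J_def bij_betw_def)
  have Jex: "\<exists>m. K \<subseteq> J m" if "finite K" "K \<subseteq> I" for K
    unfolding J_def by (rule finite_subset_enumeration[OF e that])
  have J_mono: "J m \<subseteq> J n" if "m \<le> n" for m n
    using that by (auto simp: J_def)
  have R_sets: "?R K E \<in> sets ?P" if "finite K" "K \<subseteq> I" "\<And>i. i \<in> K \<Longrightarrow> E i \<in> sets (M i)" for K E
    using that by (intro sets_PiM_I) auto
  have Y_eq: "?Y = (\<Inter>n. ?R (J n) C)"
  proof (rule equalityI; rule subsetI)
    fix x assume x: "x \<in> ?Y"
    then have "x i \<in> space (M i)" if "i \<in> I" for i
      using subsetD[OF sets.sets_into_space[OF C[OF that]], of "x i"] that by (auto simp: PiE_iff)
    then show "x \<in> (\<Inter>n. ?R (J n) C)"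
      using x J(2) by (auto simp: prod_emb_def PiE_iff)
  next
    fix x assume x: "x \<in> (\<Inter>n. ?R (J n) C)"
    have "x i \<in> C i" if i: "i \<in> I" for i
    proof -
      obtain m where "{i} \<subseteq> J m" using Jex[of "{i}"] i by auto
      then show ?thesis using x by (auto simp: prod_emb_def PiE_iff)
    qed
    then show "x \<in> ?Y" using x by (auto simp: prod_emb_def PiE_iff)
  qed
  have Y_sets: "?Y \<in> sets ?P"
    using e C by (intro sets_PiE_countable) (auto simp: bij_betw_def)
  have RJ: "?R (J n) C \<in> sets ?P" for n
    using J(2)[of n] by (intro R_sets J(1,2) C) auto
  have lim: "(\<lambda>n. emeasure ?P (?R (J n) C \<inter> B)) \<longlonglongrightarrow> emeasure ?P (?Y \<inter> B)" if B: "B \<in> sets ?P" for B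
  proof -
    have dec: "decseq (\<lambda>n. ?R (J n) C \<inter> B)"
      unfolding decseq_Suc_iff using J(3) by (fastforce simp: prod_emb_def PiE_iff)
    have "(\<lambda>n. emeasure ?P (?R (J n) C \<inter> B)) \<longlonglongrightarrow> emeasure ?P (\<Inter>n. ?R (J n) C \<inter> B)"
      using B RJ by (intro Lim_emeasure_decseq dec) auto
    then show ?thesis by (simp add: Y_eq)
  qed
  have rect: "emeasure ?P (?Y \<inter> ?R K E) = emeasure ?P ?Y * emeasure (PiM I ?N) (?R K E)"
    if K: "finite K" "K \<subseteq> I" and E: "\<And>i. i \<in> K \<Longrightarrow> E i \<in> sets (M i)" for K E
  proof (rule LIMSEQ_unique[OF lim])
    show "?R K E \<in> sets ?P" by (rule R_sets[OF K E])
    obtain m where m: "K \<subseteq> J m" using Jex[OF K] by blast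
    let ?E = "\<lambda>i. if i \<in> K then E i else space (M i)"
    have eventually_eq: "emeasure ?P (?R (J n) C \<inter> ?R K E) = emeasure ?P (?R (J n) C) * emeasure (PiM I ?N) (?R K E)"
      if n: "m \<le> n" for n
    proof -
      have KJ: "K \<subseteq> J n" using m J_mono[OF n] by simp
      have JI: "i \<in> I" if "i \<in> J n" for i using J(2) that by auto
      have E': "C i \<inter> ?E i \<in> sets (M i)" if "i \<in> J n" for i using C[OF JI[OF that]] E by auto
      have "?R (J n) C \<inter> ?R K E = ?R (J n) (\<lambda>i. C i \<inter> ?E i)"
      proof -
        have "(\<forall>i\<in>J n. x i \<in> C i \<inter> ?E i) \<longleftrightarrow> (\<forall>i\<in>J n. x i \<in> C i) \<and> (\<forall>i\<in>K. x i \<in> E i)"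
          if x: "\<forall>i\<in>I. x i \<in> space (M i)" for x
        proof
          assume *: "\<forall>i\<in>J n. x i \<in> C i \<inter> ?E i"
          have "x i \<in> E i" if "i \<in> K" for i
            using bspec[OF *, of i] KJ that by auto
          then show "(\<forall>i\<in>J n. x i \<in> C i) \<and> (\<forall>i\<in>K. x i \<in> E i)" using * by blast
        qed (use x JI in auto)
        then show ?thesis
          by (auto simp: prod_emb_def PiE_iff simp del: Int_iff)
      qed
      then have "emeasure ?P (?R (J n) C \<inter> ?R K E) = (\<Prod>i\<in>J n. emeasure (M i) (C i \<inter> ?E i))"
        using J E' by (simp only:) (intro emeasure_PiM_emb prob)
      also have "\<dots> = (\<Prod>i\<in>J n. emeasure (M i) (C i) * emeasure (?N i) (?E i))"
      proof (rule prod.cong[OF refl])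
        fix i assume i: "i \<in> J n"
        have "?E i \<in> sets (M i)" using E by auto
        then have "emeasure (?N i) (?E i) = emeasure (M i) (C i \<inter> ?E i) / emeasure (M i) (C i)"
          using C[OF JI[OF i]] by (rule emeasure_uniform_measure[rotated])
        moreover have "emeasure (M i) (C i) * (z / emeasure (M i) (C i)) = z" for z
          using pos[OF JI[OF i]] finC[OF JI[OF i]]
          by (simp add: ennreal_times_divide mult.commute[of _ z] ennreal_mult_divide_eq)
        ultimately show "emeasure (M i) (C i \<inter> ?E i) = emeasure (M i) (C i) * emeasure (?N i) (?E i)"
          by (simp only:)
      qed
      also have "\<dots> = (\<Prod>i\<in>J n. emeasure (M i) (C i)) * (\<Prod>i\<in>J n. emeasure (?N i) (?E i))"
        by (rule prod.distrib)
      also have "(\<Prod>i\<in>J n. emeasure (M i) (C i)) = emeasure ?P (?R (J n) C)"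
        using J C JI by (intro emeasure_PiM_emb[symmetric] prob) auto
      also have "(\<Prod>i\<in>J n. emeasure (?N i) (?E i)) = (\<Prod>i\<in>K. emeasure (?N i) (?E i))"
      proof (rule prod.mono_neutral_right)
        show "\<forall>i\<in>J n - K. emeasure (?N i) (?E i) = 1"
        proof
          fix i assume i: "i \<in> J n - K"
          then interpret prob_space "?N i" using JI probN by auto
          show "emeasure (?N i) (?E i) = 1" using i emeasure_space_1 by simp
        qed
      qed (use KJ J in auto)
      also have "\<dots> = (\<Prod>i\<in>K. emeasure (?N i) (E i))" by simp
      also have "\<dots> = emeasure (PiM I ?N) (prod_emb I ?N K (Pi\<^sub>E K E))"
        using K E by (intro emeasure_PiM_emb[symmetric] probN) auto
      also have "prod_emb I ?N K (Pi\<^sub>E K E) = ?R K E" by (simp add: prod_emb_def)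
      finally show ?thesis .
    qed
    have "\<forall>\<^sub>F n in sequentially. emeasure ?P (?R (J n) C) * emeasure (PiM I ?N) (?R K E)
        = emeasure ?P (?R (J n) C \<inter> ?R K E)"
      unfolding eventually_sequentially by (intro exI[of _ m] allI impI eventually_eq[symmetric])
    moreover have "(\<lambda>n. emeasure ?P (?R (J n) C) * emeasure (PiM I ?N) (?R K E)) \<longlonglongrightarrow>
        emeasure ?P ?Y * emeasure (PiM I ?N) (?R K E)"
      unfolding mult.commute[of _ "emeasure (PiM I ?N) (?R K E)"]
    proof (rule ennreal_tendsto_cmult)
      have "?R (J n) C \<inter> space ?P = ?R (J n) C" for n
        using sets.sets_into_space[OF RJ[of n]] by (rule Int_absorb2)
      moreover have "?Y \<inter> space ?P = ?Y" using sets.sets_into_space[OF Y_sets] by auto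
      ultimately show "(\<lambda>n. emeasure ?P (?R (J n) C)) \<longlonglongrightarrow> emeasure ?P ?Y"
        using lim[OF sets.top] by simp
    qed (simp add: N.emeasure_eq_measure)
    ultimately show "(\<lambda>n. emeasure ?P (?R (J n) C \<inter> ?R K E)) \<longlonglongrightarrow> emeasure ?P ?Y * emeasure (PiM I ?N) (?R K E)"
      by (rule Lim_transform_eventually[rotated])
  qed
  have "density ?P (indicator ?Y) = density (PiM I ?N) (\<lambda>_. emeasure ?P ?Y)"
  proof (rule measure_eqI_PiM_infinite[where I=I and M=M])
    fix E K assume K: "finite K" "K \<subseteq> I" "\<And>i. i \<in> K \<Longrightarrow> E i \<in> sets (M i)"
    note R = R_sets[OF K]
    have "?R K E \<in> sets (PiM I ?N)" unfolding setsN by (rule R)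
    then show "emeasure (density ?P (indicator ?Y)) (?R K E) =
        emeasure (density (PiM I ?N) (\<lambda>_. emeasure ?P ?Y)) (?R K E)"
      using R Y_sets rect[OF K]
      by (simp add: emeasure_density nn_integral_cmult flip: indicator_inter_arith)
  next
    show "finite_measure (density ?P (indicator ?Y))"
      using Y_sets by (intro finite_measureI) (simp add: emeasure_density flip: indicator_inter_arith)
  qed (simp_all add: setsN)
  then have "emeasure (density ?P (indicator ?Y)) A = emeasure (density (PiM I ?N) (\<lambda>_. emeasure ?P ?Y)) A"
    by simp
  moreover have "A \<in> sets (PiM I ?N)" unfolding setsN by (rule A)
  ultimately show ?thesis
    using A Y_sets by (simp add: emeasure_density nn_integral_cmult flip: indicator_inter_arith)
qed

lemma PiM_restrict_space_full_measure:
  assumes prob: "\<And>i. i \<in> I \<Longrightarrow> prob_space (M i)" and I: "countable I"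
    and C: "\<And>i. i \<in> I \<Longrightarrow> C i \<in> sets (M i)" and full: "\<And>i. i \<in> I \<Longrightarrow> AE x in M i. x \<in> C i"
  shows "PiM I (\<lambda>i. restrict_space (M i) (C i)) = restrict_space (PiM I M) (Pi\<^sub>E I C)"
proof -
  let ?P = "PiM I M" and ?R = "\<lambda>i. restrict_space (M i) (C i)" and ?Y = "Pi\<^sub>E I C"
  interpret P: prob_space ?P by (intro prob_space_PiM prob)
  have Y: "?Y \<in> sets ?P" by (rule sets_PiE_countable[OF I C])
  have Y_sp: "?Y \<subseteq> space ?P" using Y by (rule sets.sets_into_space)
  have C_sp: "C i \<subseteq> space (M i)" if "i \<in> I" for i using C[OF that] by (rule sets.sets_into_space)
  have spR: "space (?R i) = C i" if "i \<in> I" for i using C_sp[OF that] by (auto simp: space_restrict_space)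
  have sp: "space (PiM I ?R) = ?Y" "space (restrict_space ?P ?Y) = ?Y"
    using spR Y_sp by (auto simp: space_PiM PiE_iff space_restrict_space)
  have AEY: "AE x in ?P. x \<in> ?Y"
  proof -
    have "AE x in ?P. \<forall>i\<in>I. x i \<in> C i"
      using AE_PiM_component[OF prob _ full] by (auto simp: AE_ball_countable[OF I])
    with AE_space show ?thesis by eventually_elim (auto simp: space_PiM PiE_iff)
  qed
  have id1: "(\<lambda>x. x) \<in> restrict_space ?P ?Y \<rightarrow>\<^sub>M PiM I ?R"
  proof -
    have "(\<lambda>x. \<lambda>i\<in>I. x i) \<in> restrict_space ?P ?Y \<rightarrow>\<^sub>M PiM I ?R"
    proof (rule measurable_restrict)
      fix i assume i: "i \<in> I"
      show "(\<lambda>x. x i) \<in> restrict_space ?P ?Y \<rightarrow>\<^sub>M ?R i"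
        using i by (intro measurable_restrict_space2 measurable_restrict_space1) (auto simp: sp PiE_iff)
    qed
    then show ?thesis
      by (subst measurable_cong[where g="\<lambda>x. \<lambda>i\<in>I. x i"])
        (auto simp: sp PiE_iff extensional_restrict)
  qed
  have id2: "(\<lambda>x. x) \<in> PiM I ?R \<rightarrow>\<^sub>M restrict_space ?P ?Y"
  proof (rule measurable_restrict_space2)
    show "(\<lambda>x. x) \<in> space (PiM I ?R) \<rightarrow> ?Y" by (simp add: sp)
    have "(\<lambda>x. \<lambda>i\<in>I. x i) \<in> PiM I ?R \<rightarrow>\<^sub>M ?P"
    proof (rule measurable_restrict)
      fix i assume i: "i \<in> I"
      have "(\<lambda>x. x i) \<in> PiM I ?R \<rightarrow>\<^sub>M ?R i" using i by (rule measurable_component_singleton)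
      then show "(\<lambda>x. x i) \<in> PiM I ?R \<rightarrow>\<^sub>M M i"
        using C_sp[OF i] by (simp add: measurable_restrict_space2_iff)
    qed
    then show "(\<lambda>x. x) \<in> PiM I ?R \<rightarrow>\<^sub>M ?P"
      by (subst measurable_cong[where g="\<lambda>x. \<lambda>i\<in>I. x i"])
        (auto simp: sp PiE_iff extensional_restrict)
  qed
  have sets: "sets (restrict_space ?P ?Y) = sets (PiM I ?R)"
  proof (rule equalityI; rule subsetI)
    fix A assume A: "A \<in> sets (restrict_space ?P ?Y)"
    then have "A \<subseteq> ?Y" using sets.sets_into_space sp by blast
    then show "A \<in> sets (PiM I ?R)" using measurable_sets[OF id2 A] by (simp add: sp Int_absorb2)
  next
    fix A assume A: "A \<in> sets (PiM I ?R)"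
    then have "A \<subseteq> ?Y" using sets.sets_into_space sp by blast
    then show "A \<in> sets (restrict_space ?P ?Y)" using measurable_sets[OF id1 A] by (simp add: sp Int_absorb2)
  qed
  have probR: "prob_space (?R i)" if "i \<in> I" for i
  proof -
    interpret prob_space "M i" by (rule prob[OF that])
    show ?thesis
      using C[OF that] full[OF that] by (intro prob_spaceI)
        (simp add: spR[OF that] emeasure_restrict_space emeasure_eq_1_AE)
  qed
  interpret R: prob_space "PiM I ?R" by (intro prob_space_PiM probR)
  show ?thesis
  proof (rule measure_eqI_PiM_infinite[where I=I and M="?R"])
    show "finite_measure (PiM I ?R)" by (rule R.finite_measure_axioms)
    fix E K assume K: "finite K" "K \<subseteq> I" and E: "\<And>i. i \<in> K \<Longrightarrow> E i \<in> sets (?R i)"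
    have E': "E i \<in> sets (M i)" "E i \<subseteq> C i" if "i \<in> K" for i
    proof -
      have i: "i \<in> I" using K that by auto
      then show "E i \<in> sets (M i)" "E i \<subseteq> C i"
        using E[OF that] C[OF i] by (auto simp: sets_restrict_space_iff dest: sets.sets_into_space)
    qed
    have "emeasure (PiM I ?R) (prod_emb I ?R K (Pi\<^sub>E K E)) = (\<Prod>i\<in>K. emeasure (?R i) (E i))"
      using K E by (intro emeasure_PiM_emb probR) auto
    also have "\<dots> = (\<Prod>i\<in>K. emeasure (M i) (E i))"
      using E' C K by (intro prod.cong refl emeasure_restrict_space) auto
    also have "\<dots> = emeasure ?P (prod_emb I M K (Pi\<^sub>E K E))"
      using K E' by (intro emeasure_PiM_emb[symmetric] prob) auto
    also have "\<dots> = emeasure ?P (prod_emb I ?R K (Pi\<^sub>E K E))"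
    proof (rule emeasure_eq_AE)
      show "AE x in ?P. (x \<in> prod_emb I M K (Pi\<^sub>E K E)) = (x \<in> prod_emb I ?R K (Pi\<^sub>E K E))"
        using AEY AE_space
        by eventually_elim (use spR in \<open>auto simp: prod_emb_def PiE_iff space_PiM\<close>)
      show "prod_emb I M K (Pi\<^sub>E K E) \<in> sets ?P" using K E' by (intro sets_PiM_I) auto
      have "prod_emb I ?R K (Pi\<^sub>E K E) \<in> sets (restrict_space ?P ?Y)"
        unfolding sets using K E by (intro sets_PiM_I) auto
      then show "prod_emb I ?R K (Pi\<^sub>E K E) \<in> sets ?P"
        using Y by (simp add: sets_restrict_space_iff)
    qed
    also have "\<dots> = emeasure (restrict_space ?P ?Y) (prod_emb I ?R K (Pi\<^sub>E K E))"
    proof (rule emeasure_restrict_space[symmetric])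
      show "?Y \<inter> space ?P \<in> sets ?P" using Y by simp
      show "prod_emb I ?R K (Pi\<^sub>E K E) \<subseteq> ?Y" using sp(1) by (metis prod_emb_subset_PiM)
    qed
    finally show "emeasure (PiM I ?R) (prod_emb I ?R K (Pi\<^sub>E K E)) =
        emeasure (restrict_space ?P ?Y) (prod_emb I ?R K (Pi\<^sub>E K E))" .
  qed (simp_all add: sets)
qed

section \<open>The limit measure of a nonsingular Bernoulli action\<close>

locale nonsingular_bernoulli =
  fixes G :: "('g, 'b) monoid_scheme" (structure) and X0 :: "'a measure" and \<mu> :: "'g \<Rightarrow> 'a measure"
  assumes G: "group G" and cG: "countable (carrier G)" and iG: "infinite (carrier G)"
    and X0: "standard_borel X0"
    and prob: "\<And>g. g \<in> carrier G \<Longrightarrow> prob_space (\<mu> g)"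
    and sets: "\<And>g. g \<in> carrier G \<Longrightarrow> sets (\<mu> g) = sets X0"
    and ns: "nonsingular_action G (PiM (carrier G) \<mu>) (bernoulli G)"
begin

sublocale group G by (rule G)

abbreviation "P \<equiv> PiM (carrier G) \<mu>"
abbreviation "L \<equiv> \<mu> \<one>"

definition "e = from_nat_into (carrier G)"

lemma e: "bij_betw e UNIV (carrier G)"
  unfolding e_def by (rule bij_betw_from_nat_into[OF cG iG])

lemma e_in[simp]: "e n \<in> carrier G"
  using e by (auto simp: bij_betw_def)

lemma spaces: "g \<in> carrier G \<Longrightarrow> space (\<mu> g) = space X0"
  by (rule sets_eq_imp_space_eq[OF sets])

lemma translate_null_sets:
  assumes "g \<in> carrier G"
  shows "null_sets (PiM (carrier G) (\<lambda>h. \<mu> (inv g \<otimes> h))) = null_sets P"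
proof -
  have "distr P P (bernoulli G g) = PiM (carrier G) (\<lambda>h. \<mu> (inv g \<otimes> h))"
    by (rule distr_bernoulli[OF G assms sets prob])
  then show ?thesis using ns assms by (auto simp: nonsingular_action_def measure_equiv_def)
qed

text \<open>Translation by \<open>h\<close> puts the marginal at \<open>\<one>\<close> in position \<open>h\<close>.\<close>

lemma marginals_equivalent:
  assumes h: "h \<in> carrier G"
  shows "absolutely_continuous L (\<mu> h)" "absolutely_continuous (\<mu> h) L"
proof -
  let ?N = "\<lambda>k. \<mu> (inv h \<otimes> k)"
  have ac: "absolutely_continuous P (PiM (carrier G) ?N)" "absolutely_continuous (PiM (carrier G) ?N) P"
    using translate_null_sets[OF h] by (auto simp: absolutely_continuous_def)
  have "absolutely_continuous (\<mu> h) (?N h)"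
    by (rule absolutely_continuous_PiM_component[OF _ _ _ ac(1) h]) (use h in \<open>auto simp: prob sets\<close>)
  moreover have "absolutely_continuous (?N h) (\<mu> h)"
    by (rule absolutely_continuous_PiM_component[OF _ _ _ ac(2) h]) (use h in \<open>auto simp: prob sets\<close>)
  ultimately show "absolutely_continuous L (\<mu> h)" "absolutely_continuous (\<mu> h) L"
    using h by simp_all
qed

text \<open>That \<open>F\<close> has norm 1 follows from convergence in \<open>L\<^sup>2\<close>: almost everywhere limits alone could
  lose mass.\<close>

lemma square_root_densities_converge:
  assumes H1: "carrier (l2_H1 G) = {\<one>\<^bsub>l2_H1 G\<^esub>}"
  shows "\<exists>f F. (\<forall>h\<in>carrier G. f h \<in> borel_measurable L \<and> (\<forall>x. 0 < f h x) \<and>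
      \<mu> h = sqdensity L (f h)) \<and>
    F \<in> borel_measurable L \<and> (\<forall>x. 0 \<le> F x) \<and> sqnorm L F = 1 \<and>
    (\<integral>\<^sup>+h. sqnorm L (\<lambda>x. f h x - F x) \<partial>count_space (carrier G)) < \<infinity>"
proof -
  interpret L: prob_space L by (rule prob) simp
  have "\<forall>h\<in>carrier G. \<exists>f. f \<in> borel_measurable L \<and> (\<forall>x. 0 < f x) \<and> \<mu> h = sqdensity L f"
    using positive_square_root_density[OF L.prob_space_axioms prob _ marginals_equivalent] sets
    by (metis one_closed)
  then obtain f where f_meas: "\<And>h. h \<in> carrier G \<Longrightarrow> f h \<in> borel_measurable L"
    and f_pos: "\<And>h x. h \<in> carrier G \<Longrightarrow> 0 < f h x"
    and f: "\<And>h. h \<in> carrier G \<Longrightarrow> \<mu> h = sqdensity L (f h)"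
    by metis
  have f_unit: "sqnorm L (f h) = 1" if h: "h \<in> carrier G" for h
  proof (rule unit_vector_if_prob_space_density[OF f_meas[OF h]])
    show "prob_space (sqdensity L (f h))"
      using prob[OF h] by (simp only: f[OF h, symmetric])
  qed
  have diff: "(\<integral>\<^sup>+h. sqnorm L (\<lambda>x. f h x - f (inv g \<otimes> h) x) \<partial>count_space (carrier G)) < \<infinity>"
    if g: "g \<in> carrier G" for g
  proof -
    have gh: "inv g \<otimes> h \<in> carrier G" if "h \<in> carrier G" for h using g that by simp
    interpret unit_vector_pair "carrier G" L f "\<lambda>h. f (inv g \<otimes> h)" e
      using f_meas f_pos f_unit gh e
      by unfold_locales (auto intro: less_imp_le simp: less_imp_neq[THEN not_sym])
    show ?thesis
    proof (rule kakutani_unit_vectors_summable)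
      have "PiM (carrier G) (\<lambda>h. sqdensity L (f h)) = P"
        by (intro PiM_cong refl f[symmetric])
      moreover have "PiM (carrier G) (\<lambda>h. sqdensity L (f (inv g \<otimes> h))) =
          PiM (carrier G) (\<lambda>h. \<mu> (inv g \<otimes> h))"
        by (intro PiM_cong refl f[symmetric] gh)
      ultimately show "absolutely_continuous (PiM (carrier G) (\<lambda>h. sqdensity L (f h)))
          (PiM (carrier G) (\<lambda>h. sqdensity L (f (inv g \<otimes> h))))"
        using translate_null_sets[OF g] by (simp add: absolutely_continuous_def)
    qed (use f_pos gh in auto)
  qed
  obtain F0 where F0: "F0 \<in> borel_measurable L"
    and F0_sum: "(\<integral>\<^sup>+h. sqnorm L (\<lambda>x. f h x - F0 x) \<partial>count_space (carrier G)) < \<infinity>"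
    using L2_limit_if_H1_trivial[OF G cG iG H1 L.finite_measure_axioms f_meas f_unit diff] by blast
  \<comment> \<open>As the \<open>f h\<close> are positive, replacing the limit by its absolute value only brings it closer.\<close>
  define F where "F x = \<bar>F0 x\<bar>" for x
  have F_meas[measurable]: "F \<in> borel_measurable L" unfolding F_def using F0 by measurable
  have "(\<integral>\<^sup>+h. sqnorm L (\<lambda>x. f h x - F x) \<partial>count_space (carrier G)) \<le>
      (\<integral>\<^sup>+h. sqnorm L (\<lambda>x. f h x - F0 x) \<partial>count_space (carrier G))"
  proof (intro nn_integral_mono ennreal_leI)
    fix h x assume "h \<in> space (count_space (carrier G))"
    then have "\<bar>f h x - F x\<bar> \<le> \<bar>f h x - F0 x\<bar>"
      using f_pos[of h x] by (auto simp: F_def)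
    then show "(f h x - F x)\<^sup>2 \<le> (f h x - F0 x)\<^sup>2" by (simp only: abs_le_square_iff)
  qed
  also note F0_sum
  finally have sum: "(\<integral>\<^sup>+h. sqnorm L (\<lambda>x. f h x - F x) \<partial>count_space (carrier G)) < \<infinity>" .
  define r where "r n = enn2real (sqnorm L (\<lambda>x. f (e n) x - F x))" for n
  note fin = enn2real_tendsto_zero_if_count_space_finite(1)[OF e sum]
  have r_eq: "sqnorm L (\<lambda>x. f (e n) x - F x) = ennreal (r n)" for n
    using fin[OF e_in[of n]] by (simp add: r_def)
  have F_fin: "sqnorm L F < \<infinity>"
  proof -
    note [measurable] = f_meas[OF one_closed]
    have "sqnorm L F \<le> 2 * sqnorm L (\<lambda>x. f \<one> x - F x) + 2 * sqnorm L (f \<one>)"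
      using sqnorm_add_le[of "\<lambda>x. F x - f \<one> x" L "f \<one>"] by (simp add: power2_commute)
    also have "\<dots> < \<infinity>"
      using fin[OF one_closed] f_unit[OF one_closed] by (simp add: ennreal_mult_less_top)
    finally show ?thesis .
  qed
  define s where "s = sqrt (enn2real (sqnorm L F))"
  have "r \<longlonglongrightarrow> 0"
    unfolding r_def by (rule enn2real_tendsto_zero_if_count_space_finite(2)[OF e sum])
  moreover have "(1 - s)\<^sup>2 \<le> r n" for n
  proof -
    have "ennreal ((1 - s)\<^sup>2) \<le> ennreal (r n)"
      using L2_norm_diff_le[OF f_meas[OF e_in[of n]] F_meas] f_unit[OF e_in[of n]] F_fin
      by (simp add: s_def r_eq)
    then show ?thesis by (subst (asm) ennreal_le_iff) (simp_all add: r_def)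
  qed
  ultimately have "(1 - s)\<^sup>2 \<le> 0" by (intro LIMSEQ_le_const) auto
  then have "s = 1" by simp
  then have F_unit: "sqnorm L F = 1"
    using F_fin by (cases "sqnorm L F") (auto simp: s_def)
  have F_nonneg: "\<forall>x. 0 \<le> F x" by (simp add: F_def)
  have "\<forall>h\<in>carrier G. f h \<in> borel_measurable L \<and> (\<forall>x. 0 < f h x) \<and>
      \<mu> h = sqdensity L (f h)"
    by (intro ballI conjI allI f_meas f_pos f)
  with F_meas F_nonneg F_unit sum show ?thesis
    by (intro exI[of _ f] exI[of _ F] conjI)
qed

end

locale bernoulli_with_limit = nonsingular_bernoulli G X0 \<mu>
  for G :: "('g, 'b) monoid_scheme" (structure) and X0 :: "'a measure" and \<mu> :: "'g \<Rightarrow> 'a measure" +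
  fixes f :: "'g \<Rightarrow> 'a \<Rightarrow> real" and F :: "'a \<Rightarrow> real"
  assumes f_meas: "\<And>h. h \<in> carrier G \<Longrightarrow> f h \<in> borel_measurable L"
    and f_pos: "\<And>h x. h \<in> carrier G \<Longrightarrow> 0 < f h x"
    and \<mu>_density: "\<And>h. h \<in> carrier G \<Longrightarrow> \<mu> h = sqdensity L (f h)"
    and F_meas[measurable]: "F \<in> borel_measurable L" and F_nonneg: "\<And>x. 0 \<le> F x"
    and F_unit: "sqnorm L F = 1"
    and close: "(\<integral>\<^sup>+h. sqnorm L (\<lambda>x. f h x - F x) \<partial>count_space (carrier G)) < \<infinity>"
    and nonatomic: "nonatomic (PiM (carrier G) \<mu>)"
begin

definition "\<nu> = sqdensity L F"
definition "Y0 = {x \<in> space X0. F x \<noteq> 0}"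
abbreviation "Y \<equiv> Pi\<^sub>E (carrier G) (\<lambda>_. Y0)"
abbreviation "Q \<equiv> PiM (carrier G) (\<lambda>_. \<nu>)"

sublocale P: prob_space P by (intro prob_space_PiM prob)

lemma sets_L[simp]: "sets L = sets X0" and space_L[simp]: "space L = space X0"
  by (auto simp: sets spaces)

lemma prob_\<nu>: "prob_space \<nu>"
  unfolding \<nu>_def by (rule prob_space_density_unit_vector) (simp_all add: F_unit)

lemma sets_\<nu>[simp]: "sets \<nu> = sets X0" and space_\<nu>[simp]: "space \<nu> = space X0"
  by (auto simp: \<nu>_def)

sublocale Q: prob_space Q by (intro prob_space_PiM prob_\<nu>)

lemma sets_Q: "sets Q = sets P"
  by (intro sets_PiM_cong) (auto simp: sets)

lemma space_P: "space P = carrier G \<rightarrow>\<^sub>E space X0"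
  by (auto simp: space_PiM PiE_iff spaces)

lemma Y0_sets: "Y0 \<in> sets X0"
proof -
  have "{x \<in> space L. F x \<noteq> 0} \<in> sets L" by measurable
  then show ?thesis by (simp add: Y0_def)
qed

lemma Y_sets: "Y \<in> sets P"
  using cG Y0_sets by (intro sets_PiE_countable) (auto simp: sets)

lemma f_unit:
  assumes h: "h \<in> carrier G"
  shows "sqnorm L (f h) = 1"
proof -
  have "prob_space (sqdensity L (f h))"
    using prob[OF h] by (simp only: \<mu>_density[OF h, symmetric])
  then show ?thesis by (rule unit_vector_if_prob_space_density[OF f_meas[OF h]])
qed

lemma emeasure_\<mu>: "h \<in> carrier G \<Longrightarrow> A \<in> sets X0 \<Longrightarrow>
    emeasure (\<mu> h) A = (\<integral>\<^sup>+x. ennreal ((f h x)\<^sup>2) * indicator A x \<partial>L)"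
  using f_meas by (subst \<mu>_density, simp, subst emeasure_density) auto

lemma emeasure_\<nu>: "A \<in> sets X0 \<Longrightarrow> emeasure \<nu> A = (\<integral>\<^sup>+x. ennreal ((F x)\<^sup>2) * indicator A x \<partial>L)"
  unfolding \<nu>_def by (rule emeasure_density) auto

lemma AE_\<nu>_Y0: "AE x in \<nu>. x \<in> Y0"
  unfolding \<nu>_def by (subst AE_density) (auto simp: Y0_def intro!: AE_I2)

lemma P_Q_absolutely_continuous: "absolutely_continuous P Q"
proof -
  interpret unit_vector_pair "carrier G" L f "\<lambda>_. F" e
    using f_meas f_pos f_unit F_meas F_nonneg F_unit e
    by unfold_locales (auto intro: less_imp_le simp: less_imp_neq[THEN not_sym])
  have "PiM (carrier G) (\<lambda>h. sqdensity L (f h)) = P"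
    by (intro PiM_cong refl \<mu>_density[symmetric])
  then show ?thesis
    using kakutani_unit_vectors_absolutely_continuous[OF close] by (simp add: \<nu>_def)
qed

lemma AE_Q_Y: "AE x in Q. x \<in> Y"
proof -
  have "AE x in Q. \<forall>i\<in>carrier G. x i \<in> Y0"
    using AE_PiM_component[OF prob_\<nu> _ AE_\<nu>_Y0] by (auto simp: AE_ball_countable[OF cG])
  with AE_space show ?thesis by eventually_elim (auto simp: space_PiM PiE_iff)
qed

lemma emeasure_P_pos:
  assumes "A \<in> sets P" "AE x in Q. x \<in> A"
  shows "0 < emeasure P A"
proof (rule ccontr)
  assume "\<not> 0 < emeasure P A"
  then have "A \<in> null_sets P" using assms(1) by (simp add: null_sets_def)
  then have "A \<in> null_sets Q"
    using P_Q_absolutely_continuous by (auto simp: absolutely_continuous_def)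
  then have "AE x in Q. x \<notin> A" by (rule AE_not_in)
  with assms(2) have "AE x in Q. False" by eventually_elim simp
  then show False by simp
qed

lemma \<mu>_Y0_pos: "h \<in> carrier G \<Longrightarrow> emeasure (\<mu> h) Y0 \<noteq> 0"
proof
  assume h: "h \<in> carrier G" and 0: "emeasure (\<mu> h) Y0 = 0"
  then have "Y0 \<in> null_sets (\<mu> h)" using Y0_sets by (simp add: null_sets_def sets)
  then have null: "{x \<in> space P. x h \<in> Y0} \<in> null_sets P"
    using h Y0_sets by (subst null_sets_PiM_component) (auto simp: prob sets)
  have "AE x in Q. x \<in> {x \<in> space P. x h \<in> Y0}"
    using AE_Q_Y AE_space by eventually_elim (use h in \<open>auto simp: PiE_iff space_PiM spaces\<close>)
  from emeasure_P_pos[OF null_setsD2[OF null] this] null_setsD1[OF null] show False by simp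
qed

text \<open>Compare \<open>\<nu>\<close> with the conditioned marginals \<open>\<mu> h (\<cdot> | Y0)\<close>, with roots \<open>v h\<close>. Conditioning divides
  by \<open>\<mu> h Y0 \<le> 1\<close> on the support of \<open>F\<close>, so it increases the inner product with \<open>F\<close>, and Kakutani's
  sum can only decrease.\<close>

lemma Q_null_imp_P_null_on_Y:
  assumes A: "A \<in> null_sets Q"
  shows "Y \<inter> A \<in> null_sets P"
proof -
  have PY: "emeasure P (Y \<inter> A) = emeasure P Y * emeasure (PiM (carrier G) (\<lambda>h. uniform_measure (\<mu> h) Y0)) A"
    by (rule emeasure_PiM_Int_PiE[where C="\<lambda>_. Y0", OF prob e])
      (use A sets_Q Y0_sets \<mu>_Y0_pos in \<open>auto simp: sets\<close>)
  define c where "c h = measure (\<mu> h) Y0" for h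
  have c_eq: "emeasure (\<mu> h) Y0 = ennreal (c h)" and c_pos: "0 < c h" and c_le: "c h \<le> 1"
    if h: "h \<in> carrier G" for h
  proof -
    interpret prob_space "\<mu> h" by (rule prob[OF h])
    show "emeasure (\<mu> h) Y0 = ennreal (c h)" by (simp add: c_def emeasure_eq_measure)
    then show "0 < c h" using \<mu>_Y0_pos[OF h] by (simp add: c_def zero_less_measure_iff)
    show "c h \<le> 1" unfolding c_def by (rule prob_le_1)
  qed
  \<comment> \<open>Off \<open>Y0\<close> the root vanishes, as conditioning requires.\<close>
  define v where "v h x = (if F x = 0 then 0 else f h x / sqrt (c h))" for h x
  have v_meas: "v h \<in> borel_measurable L" if h: "h \<in> carrier G" for h
  proof -
    note [measurable] = f_meas[OF h]
    show ?thesis unfolding v_def by measurable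
  qed
  have v_sq: "ennreal ((v h x)\<^sup>2) = ennreal ((f h x)\<^sup>2) * (indicator Y0 x / emeasure (\<mu> h) Y0)"
    if h: "h \<in> carrier G" and x: "x \<in> space L" for h x
    using x c_pos[OF h] unfolding c_eq[OF h]
    by (auto simp: v_def Y0_def power_divide less_imp_le divide_ennreal_def inverse_ennreal ennreal_mult[symmetric] divide_inverse power_mult_distrib power_inverse)
  have v_density: "sqdensity L (v h) = uniform_measure (\<mu> h) Y0" if h: "h \<in> carrier G" for h
  proof -
    note [measurable] = f_meas[OF h] v_meas[OF h]
    have [measurable]: "Y0 \<in> sets L" using Y0_sets by simp
    have "sqdensity L (v h) =
      density L (\<lambda>x. ennreal ((f h x)\<^sup>2) * (indicator Y0 x / emeasure (\<mu> h) Y0))"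
      using v_sq[OF h] by (intro density_cong AE_I2) auto
    also have "\<dots> = density (sqdensity L (f h)) (\<lambda>x. indicator Y0 x / emeasure (\<mu> h) Y0)"
      by (rule density_density_eq[symmetric]) auto
    finally show ?thesis
      unfolding uniform_measure_def \<mu>_density[OF h, symmetric] .
  qed
  have v_unit: "sqnorm L (v h) = 1" if h: "h \<in> carrier G" for h
  proof -
    have "emeasure (\<mu> h) Y0 \<noteq> \<infinity>" using c_eq[OF h] by simp
    then have "prob_space (sqdensity L (v h))"
      unfolding v_density[OF h] using \<mu>_Y0_pos[OF h] by (intro prob_space_uniform_measure)
    then show ?thesis by (rule unit_vector_if_prob_space_density[OF v_meas[OF h]])
  qed
  have v_nonneg: "0 \<le> v h x" if "h \<in> carrier G" for h x
    using f_pos[OF that, of x] c_pos[OF that] by (simp add: v_def)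
  interpret unit_vector_pair "carrier G" L "\<lambda>_. F" v e
    using v_meas v_nonneg v_unit F_meas F_nonneg F_unit e by unfold_locales (auto simp: v_def)
  have le: "sqnorm L (\<lambda>x. F x - v h x) \<le> sqnorm L (\<lambda>x. f h x - F x)"
    if h: "h \<in> carrier G" for h
  proof -
    note [measurable] = f_meas[OF h] v_meas[OF h]
    have sq: "integrable L (\<lambda>x. (w x)\<^sup>2)" if "w \<in> borel_measurable L" "sqnorm L w = 1"
      for w :: "'a \<Rightarrow> real"
      using that by (auto simp: integrable_iff_bounded)
    have "(\<integral>x. f h x * F x \<partial>L) \<le> (\<integral>x. F x * v h x \<partial>L)"
    proof (rule integral_mono)
      show "integrable L (\<lambda>x. f h x * F x)" "integrable L (\<lambda>x. F x * v h x)"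
        using f_unit[OF h] v_unit[OF h] F_unit by (auto intro!: integrable_mult_if_square_integrable sq)
      show "f h x * F x \<le> F x * v h x" for x
      proof -
        have "sqrt (c h) \<le> 1" "0 < sqrt (c h)" using c_le[OF h] c_pos[OF h] by auto
        then have "f h x \<le> f h x / sqrt (c h)"
          using f_pos[OF h, of x] by (simp add: le_divide_eq mult_left_le)
        then have "F x * f h x \<le> F x * (f h x / sqrt (c h))"
          using F_nonneg[of x] by (rule mult_left_mono)
        then show ?thesis by (simp add: v_def mult.commute)
      qed
    qed
    then have "ennreal (2 * (1 - (\<integral>x. F x * v h x \<partial>L))) \<le> ennreal (2 * (1 - (\<integral>x. f h x * F x \<partial>L)))"
      by (intro ennreal_leI) simp
    moreover have "sqnorm L (\<lambda>x. F x - v h x) = ennreal (2 * (1 - (\<integral>x. F x * v h x \<partial>L)))"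
      by (rule nn_integral_square_diff_unit_vectors) (use v_unit[OF h] F_unit in auto)
    moreover have "sqnorm L (\<lambda>x. f h x - F x) = ennreal (2 * (1 - (\<integral>x. f h x * F x \<partial>L)))"
      by (rule nn_integral_square_diff_unit_vectors) (use f_unit[OF h] F_unit in auto)
    ultimately show ?thesis by simp
  qed
  have "(\<integral>\<^sup>+h. sqnorm L (\<lambda>x. F x - v h x) \<partial>count_space (carrier G)) < \<infinity>"
    by (rule le_less_trans[OF nn_integral_mono close]) (use le in auto)
  from kakutani_unit_vectors_absolutely_continuous[OF this]
  have "absolutely_continuous Q (PiM (carrier G) (\<lambda>h. sqdensity L (v h)))"
    unfolding \<nu>_def .
  also have "PiM (carrier G) (\<lambda>h. sqdensity L (v h)) = PiM (carrier G) (\<lambda>h. uniform_measure (\<mu> h) Y0)"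
    by (intro PiM_cong refl v_density)
  finally have "emeasure (PiM (carrier G) (\<lambda>h. uniform_measure (\<mu> h) Y0)) A = 0"
    using A by (auto simp: absolutely_continuous_def)
  then show ?thesis
    using PY A Y_sets sets_Q by (intro null_setsI) auto
qed

lemma measure_equiv_restriction:
  "measure_equiv (restrict_space P Y) (PiM (carrier G) (\<lambda>_. restrict_space \<nu> Y0))"
proof -
  have eq: "PiM (carrier G) (\<lambda>_. restrict_space \<nu> Y0) = restrict_space Q Y"
    using Y0_sets by (intro PiM_restrict_space_full_measure prob_\<nu> cG AE_\<nu>_Y0) auto
  have "A \<in> null_sets P \<longleftrightarrow> A \<in> null_sets Q" if "A \<subseteq> Y" for A
  proof
    assume "A \<in> null_sets Q"
    then have "Y \<inter> A \<in> null_sets P" by (rule Q_null_imp_P_null_on_Y)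
    then show "A \<in> null_sets P" using that by (simp add: Int_absorb1)
  qed (use P_Q_absolutely_continuous in \<open>auto simp: absolutely_continuous_def\<close>)
  then show ?thesis
    unfolding eq measure_equiv_def
    using Y_sets sets_Q by (auto simp: null_sets_restrict_space sets_restrict_space)
qed

lemma \<mu>_complement_summable: "(\<lambda>g. measure (\<mu> g) (space X0 - Y0)) summable_on carrier G"
proof -
  have "(\<integral>\<^sup>+g. ennreal (measure (\<mu> g) (space X0 - Y0)) \<partial>count_space (carrier G)) \<le>
    (\<integral>\<^sup>+h. sqnorm L (\<lambda>x. f h x - F x) \<partial>count_space (carrier G))"
  proof (rule nn_integral_mono)
    fix g assume "g \<in> space (count_space (carrier G))"
    then have g: "g \<in> carrier G" by simp
    interpret prob_space "\<mu> g" by (rule prob[OF g])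
    have "ennreal (measure (\<mu> g) (space X0 - Y0)) = (\<integral>\<^sup>+x. ennreal ((f g x)\<^sup>2) * indicator (space X0 - Y0) x \<partial>L)"
      using Y0_sets by (simp add: emeasure_\<mu>[OF g] emeasure_eq_measure[symmetric])
    also have "\<dots> \<le> sqnorm L (\<lambda>x. f g x - F x)"
      by (intro nn_integral_mono) (auto simp: indicator_def Y0_def)
    finally show "ennreal (measure (\<mu> g) (space X0 - Y0)) \<le> sqnorm L (\<lambda>x. f g x - F x)" .
  qed
  then show ?thesis
    using close by (subst summable_on_iff_nn_integral) (auto dest: le_less_trans)
qed

lemma marginals_converge:
  assumes D: "D \<in> sets X0"
  shows "(\<lambda>n. measure (\<mu> (e n)) D) \<longlonglongrightarrow> measure \<nu> D"
proof -
  interpret \<nu>: prob_space \<nu> by (rule prob_\<nu>)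
  note [measurable] = D
  define r where "r n = enn2real (sqnorm L (\<lambda>x. f (e n) x - F x))" for n
  note fin = enn2real_tendsto_zero_if_count_space_finite(1)[OF e close]
  have r_eq: "sqnorm L (\<lambda>x. f (e n) x - F x) = ennreal (r n)" for n
    using fin[OF e_in[of n]] by (simp add: r_def)
  have r: "r \<longlonglongrightarrow> 0"
    unfolding r_def by (rule enn2real_tendsto_zero_if_count_space_finite(2)[OF e close])
  have le: "(sqrt (measure (\<mu> (e n)) D) - sqrt (measure \<nu> D))\<^sup>2 \<le> r n" for n
  proof -
    note [measurable] = f_meas[OF e_in[of n]]
    interpret \<mu>: prob_space "\<mu> (e n)" by (rule prob) simp
    have 1: "sqnorm L (\<lambda>x. f (e n) x * indicator D x) = ennreal (measure (\<mu> (e n)) D)"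
      unfolding \<mu>.emeasure_eq_measure[symmetric] emeasure_\<mu>[OF e_in D]
      by (intro nn_integral_cong) (auto simp: indicator_def)
    have 2: "sqnorm L (\<lambda>x. F x * indicator D x) = ennreal (measure \<nu> D)"
      unfolding \<nu>.emeasure_eq_measure[symmetric] emeasure_\<nu>[OF D]
      by (intro nn_integral_cong) (auto simp: indicator_def)
    have DL: "D \<in> sets L" using D by simp
    have m: "(\<lambda>x. f (e n) x * indicator D x) \<in> borel_measurable L" "(\<lambda>x. F x * indicator D x) \<in> borel_measurable L"
      using DL by measurable
    have "ennreal ((sqrt (measure (\<mu> (e n)) D) - sqrt (measure \<nu> D))\<^sup>2) \<le>
        sqnorm L (\<lambda>x. f (e n) x * indicator D x - F x * indicator D x)"
      using L2_norm_diff_le[OF m] by (simp add: 1 2)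
    also have "\<dots> \<le> ennreal (r n)"
      unfolding r_eq[symmetric] by (intro nn_integral_mono) (auto simp: indicator_def)
    finally show ?thesis by (subst (asm) ennreal_le_iff) (simp_all add: r_def)
  qed
  have "(\<lambda>n. (sqrt (measure (\<mu> (e n)) D) - sqrt (measure \<nu> D))\<^sup>2) \<longlonglongrightarrow> 0"
    by (rule tendsto_sandwich[OF _ _ tendsto_const r]) (use le in auto)
  then have "(\<lambda>n. sqrt (measure (\<mu> (e n)) D)) \<longlonglongrightarrow> sqrt (measure \<nu> D)"
    by (rule tendsto_if_square_diff_tendsto_zero)
  then have "(\<lambda>n. (sqrt (measure (\<mu> (e n)) D))\<^sup>2) \<longlonglongrightarrow> (sqrt (measure \<nu> D))\<^sup>2"
    by (rule tendsto_power)
  then show ?thesis by (simp only: real_sqrt_pow2[OF measure_nonneg])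
qed

text \<open>A probability measure taking only the values 0 and 1 is, on a countably separated space, a
  point mass at some \<open>a\<close>. The constant configuration \<open>a\<close> would then have full measure for \<open>\<nu>\<^sup>G\<close>, hence
  positive measure for \<open>P\<close>, and would be an atom.\<close>

lemma \<nu>_not_point_mass: "\<exists>D\<in>sets X0. 0 < measure \<nu> D \<and> measure \<nu> D < 1"
proof (rule ccontr)
  assume contra: "\<not> (\<exists>D\<in>sets X0. 0 < measure \<nu> D \<and> measure \<nu> D < 1)"
  interpret \<nu>: prob_space \<nu> by (rule prob_\<nu>)
  obtain B :: "nat \<Rightarrow> 'a set" where B: "\<And>n. B n \<in> sets X0"
    and sep: "\<And>x y. x \<in> space X0 \<Longrightarrow> y \<in> space X0 \<Longrightarrow> (\<And>n. x \<in> B n \<longleftrightarrow> y \<in> B n) \<Longrightarrow> x = y"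
    using standard_borel_separating_sequence[OF X0] by blast
  have "AE x in \<nu>. x \<in> B n \<longleftrightarrow> measure \<nu> (B n) = 1" for n
  proof (cases "measure \<nu> (B n) = 1")
    case True
    then have "AE x in \<nu>. x \<in> B n" using B by (subst (asm) \<nu>.prob_eq_1) auto
    then show ?thesis using True by simp
  next
    case False
    moreover have "\<not> (0 < measure \<nu> (B n) \<and> measure \<nu> (B n) < 1)"
      using contra B[of n] by blast
    ultimately have "measure \<nu> (B n) = 0"
      using \<nu>.prob_le_1[of "B n"] measure_nonneg[of \<nu> "B n"] by linarith
    then have "AE x in \<nu>. x \<notin> B n"
      using B by (intro AE_not_in) (simp add: null_sets_def \<nu>.emeasure_eq_measure)
    then show ?thesis using False by simp
  qed
  then have "AE x in \<nu>. \<forall>n. x \<in> B n \<longleftrightarrow> measure \<nu> (B n) = 1"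
    by (simp add: AE_all_countable)
  with AE_space have typical: "AE x in \<nu>. x \<in> space X0 \<and> (\<forall>n. x \<in> B n \<longleftrightarrow> measure \<nu> (B n) = 1)"
    by eventually_elim simp
  obtain a where a: "a \<in> space X0" "\<And>n. a \<in> B n \<longleftrightarrow> measure \<nu> (B n) = 1"
  proof (rule ccontr)
    assume "\<not> thesis"
    then have "\<not> (\<exists>a. a \<in> space X0 \<and> (\<forall>n. a \<in> B n \<longleftrightarrow> measure \<nu> (B n) = 1))"
      using that by blast
    then have none: "\<not> (a \<in> space X0 \<and> (\<forall>n. a \<in> B n \<longleftrightarrow> measure \<nu> (B n) = 1))" for a
      by blast
    from typical have "AE x in \<nu>. False"
      by eventually_elim (rule notE[OF none])
    then show False by simp
  qed
  have AE_a: "AE x in \<nu>. x = a"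
    using typical by eventually_elim (use a sep in auto)
  have "AE x in Q. x i = a" if i: "i \<in> carrier G" for i
    by (rule AE_PiM_component[OF prob_\<nu> i AE_a])
  then have "AE x in Q. \<forall>i\<in>carrier G. x i = a"
    by (simp add: AE_ball_countable[OF cG])
  with AE_space have AE_eq: "AE x in Q. x \<in> {\<lambda>i\<in>carrier G. a}"
    by eventually_elim (auto simp: space_PiM PiE_iff extensional_def fun_eq_iff)
  let ?S = "{\<lambda>i\<in>carrier G. a}"
  have S_sp: "?S \<subseteq> space P" using a by (auto simp: space_P)
  obtain \<phi> :: "('g \<Rightarrow> 'a) \<Rightarrow> real" where \<phi>: "\<phi> \<in> borel_measurable P" "inj_on \<phi> (space P)"
    using PiM_real_injection[OF X0 cG, of \<mu>] sets by auto
  have "?S = \<phi> -` {\<phi> (\<lambda>i\<in>carrier G. a)} \<inter> space P"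
    using S_sp \<phi>(2) by (auto dest: inj_onD)
  then have S_sets: "?S \<in> sets P"
    using measurable_sets[OF \<phi>(1), of "{\<phi> (\<lambda>i\<in>carrier G. a)}"] by simp
  have "0 < emeasure P ?S" by (rule emeasure_P_pos[OF S_sets AE_eq])
  then obtain A where "A \<in> sets P" "A \<subseteq> ?S" "0 < emeasure P A" "emeasure P A < emeasure P ?S"
    using nonatomic S_sets unfolding nonatomic_def by blast
  then show False by (auto simp: subset_singleton_iff)
qed

lemma AE_free:
  assumes "g \<in> carrier G" "g \<noteq> \<one>"
  shows "AE x in P. bernoulli G g x \<noteq> x"
proof -
  obtain D where D: "D \<in> sets X0" and p: "0 < measure \<nu> D" "measure \<nu> D < 1"
    using \<nu>_not_point_mass by blast
  \<comment> \<open>Half the distance of \<open>\<nu> D\<close> from 0 and 1; the marginals stay this far away except at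
    finitely many coordinates.\<close>
  define \<epsilon> where "\<epsilon> = min (measure \<nu> D) (1 - measure \<nu> D) / 2"
  have \<epsilon>: "0 < \<epsilon>" "\<epsilon> < measure \<nu> D" "measure \<nu> D < 1 - \<epsilon>"
    using p by (auto simp: \<epsilon>_def min_def field_simps)
  have "\<forall>\<^sub>F n in sequentially. \<epsilon> < measure (\<mu> (e n)) D \<and> measure (\<mu> (e n)) D < 1 - \<epsilon>"
    using order_tendstoD[OF marginals_converge[OF D]] \<epsilon> by (auto intro: eventually_conj)
  then obtain N where N: "\<And>n. N \<le> n \<Longrightarrow> \<epsilon> < measure (\<mu> (e n)) D \<and> measure (\<mu> (e n)) D < 1 - \<epsilon>"
    by (auto simp: eventually_sequentially)
  show ?thesis
  proof (rule bernoulli_AE_free[OF G iG sets prob D _ \<epsilon>(1) _ assms])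
    show "finite (e ` {..<N})" by simp
    fix h assume h: "h \<in> carrier G - e ` {..<N}"
    then obtain n where n: "h = e n" using e by (auto simp: bij_betw_def)
    then have "N \<le> n" using h by (auto simp: not_less[symmetric])
    then show "\<epsilon> \<le> measure (\<mu> h) D \<and> measure (\<mu> h) D \<le> 1 - \<epsilon>"
      using N n by (auto intro: less_imp_le)
  qed
qed

lemma dissipative_complement:
  "dissipative_action G (restrict_space P (space P - Y)) (bernoulli G)"
proof (rule dissipative_bernoulli_finitely_many_visits[OF G cG iG X0 sets prob ns AE_free])
  show "space X0 - Y0 \<in> sets X0" using Y0_sets by auto
  show "space P - Y = {x \<in> space P. \<exists>h\<in>carrier G. x h \<in> space X0 - Y0}"
    by (auto simp: space_P PiE_iff extensional_def)
qed (use \<mu>_complement_summable in auto)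

lemma prob_space_restricted_limit: "prob_space (restrict_space \<nu> Y0)"
proof -
  interpret \<nu>: prob_space \<nu> by (rule prob_\<nu>)
  have "space (restrict_space \<nu> Y0) = Y0"
    by (auto simp: space_restrict_space Y0_def)
  then show ?thesis
    using AE_\<nu>_Y0 Y0_sets
    by (intro prob_spaceI) (simp add: emeasure_restrict_space \<nu>.emeasure_eq_1_AE)
qed

end

theorem theorem3p1:
  fixes G :: "('g, 'b) monoid_scheme"
    and X0 :: "'a measure"
    and \<mu> :: "'g \<Rightarrow> 'a measure"
  assumes "group G" and "countable (carrier G)" and "infinite (carrier G)"
    and "carrier (l2_H1 G) = {\<one>\<^bsub>l2_H1 G\<^esub>}"
    and "standard_borel X0"
    and "\<And>g. g \<in> carrier G \<Longrightarrow> prob_space (\<mu> g)"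
    and "\<And>g. g \<in> carrier G \<Longrightarrow> sets (\<mu> g) = sets X0"
    and "nonatomic (PiM (carrier G) \<mu>)"
    and "nonsingular_action G (PiM (carrier G) \<mu>) (bernoulli G)"
  shows "\<exists>Y0 Z0. Y0 \<in> sets X0 \<and> Z0 \<in> sets X0 \<and> Y0 \<union> Z0 = space X0 \<and> Y0 \<inter> Z0 = {} \<and>
    (let P = PiM (carrier G) \<mu>; Y = PiE (carrier G) (\<lambda>_. Y0) in
      emeasure P Y > 0 \<and>
      (\<exists>\<nu>. prob_space \<nu> \<and> sets \<nu> = sets (restrict_space X0 Y0) \<and>
           measure_equiv (restrict_space P Y) (PiM (carrier G) (\<lambda>_. \<nu>)) \<and>
           pmp_action G (PiM (carrier G) (\<lambda>_. \<nu>)) (bernoulli G) \<and>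
           ergodic_action G (PiM (carrier G) (\<lambda>_. \<nu>)) (bernoulli G)) \<and>
      (\<lambda>g. measure (\<mu> g) Z0) summable_on carrier G \<and>
      dissipative_action G (restrict_space P (space P - Y)) (bernoulli G))"
proof -
  interpret nonsingular_bernoulli G X0 \<mu>
    by (intro nonsingular_bernoulli.intro assms)
  obtain f F where "bernoulli_with_limit G X0 \<mu> f F"
    using square_root_densities_converge[OF assms(4)] assms(8)
    unfolding bernoulli_with_limit_def bernoulli_with_limit_axioms_def
    using nonsingular_bernoulli_axioms by blast
  then interpret bernoulli_with_limit G X0 \<mu> f F .
  have \<nu>: "sets (restrict_space \<nu> Y0) = sets (restrict_space X0 Y0)"
    by (intro sets_restrict_space_cong) simp
  have "0 < emeasure P Y" by (rule emeasure_P_pos[OF Y_sets AE_Q_Y])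
  then show ?thesis
    unfolding Let_def
    using Y0_sets sets.sets_into_space[OF Y0_sets] \<nu> prob_space_restricted_limit measure_equiv_restriction
      pmp_action_bernoulli[OF assms(1) prob_space_restricted_limit]
      ergodic_action_bernoulli[OF assms(1,3) prob_space_restricted_limit]
      \<mu>_complement_summable dissipative_complement
    by (intro exI[of _ "Y0"] exI[of _ "space X0 - Y0"] conjI exI[of _ "restrict_space \<nu> Y0"]) auto
qed

end
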